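(* Let $\Omega\subset\mathbb{R}^2$ be an open bounded strictly convex set. Suppose that $\phi$ is a metric integrand depending only on the second variable. Let $f\in C(\partial\Omega)$. Then there exists at least one solution to the anisotropic least gradient problem $$\min\Big\{\int_\Omega\phi(Du):\ u\in BV(\Omega),\ u|_{\partial\Omega}=f\Big\}.$$
   Context: A metric integrand depending only on the second variable is a convex function $\phi:\mathbb{R}^2\to[0,\infty)$ with $\phi(t\xi)=|t|\phi(\xi)$ for $t\in\mathbb{R}$ and $\lambda|\xi|\le\phi(\xi)\le\Gamma|\xi|$ for some constants $\lambda,\Gamma>0$ (i.e. a norm); its unit ball need not be strictly convex. A strictly convex set is a convex set whose boundary contains no nondegenerate line segment. With $\phi^0(\xi^* )=\sup\{\langle\xi^*,\xi\rangle:\phi(\xi)\le1\}$, the $\phi$-total variation is $$\int_\Omega\phi(Du)=\int_\Omega|Du|_\phi=\sup\Big\{\int_\Omega u\,\mathrm{div}\,\mathbf{z}\,dx:\ \mathbf{z}\in C_c^1(\Omega;\mathbb{R}^2),\ \phi^0(\mathbf{z}(x))\le1\ \text{a.e.}\Big\}.$$ A function $u\in BV(\Omega)$ is of $\phi$-least gradient if $\int_\Omega|Du|_\phi\le\int_\Omega|D(u+v)|_\phi$ for every compactly supported $v\in BV(\Omega)$ (equivalently here, for every $v\in BV(\Omega)$ with zero trace). A solution to the problem is a function $u$ of $\phi$-least gradient with trace $Tu=f$. *)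

theory Defs
  imports "HOL-Analysis.Analysis"
begin

definition strictly_convex :: "(real^2) set \<Rightarrow> bool" where
  "strictly_convex S \<longleftrightarrow>
     convex S \<and> (\<forall>a b. a \<noteq> b \<longrightarrow> \<not> closed_segment a b \<subseteq> frontier S)"

definition metric_integrand :: "(real^2 \<Rightarrow> real) \<Rightarrow> bool" where
  "metric_integrand \<phi> \<longleftrightarrow>
     convex_on UNIV \<phi> \<and> (\<forall>\<xi>. 0 \<le> \<phi> \<xi>) \<and>
     (\<forall>t \<xi>. \<phi> (t *\<^sub>R \<xi>) = \<bar>t\<bar> * \<phi> \<xi>) \<and>
     (\<exists>l>0. \<exists>\<Gamma>>0. \<forall>\<xi>. l * norm \<xi> \<le> \<phi> \<xi> \<and> \<phi> \<xi> \<le> \<Gamma> * norm \<xi>)"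

(* The supremum is taken in the reals; it is over a nonempty set bounded above
   whenever \<phi> is a metric integrand. *)
definition polar :: "(real^2 \<Rightarrow> real) \<Rightarrow> real^2 \<Rightarrow> real" where
  "polar \<phi> \<eta> = (SUP \<xi>\<in>{\<xi>. \<phi> \<xi> \<le> 1}. \<eta> \<bullet> \<xi>)"

(* Functions on \<Omega> are total functions; their values off \<Omega> never matter. *)
definition C1c_fields :: "(real^2) set \<Rightarrow> (real^2 \<Rightarrow> real^2) set" where
  "C1c_fields \<Omega> = {z.
     (\<exists>z' :: real^2 \<Rightarrow> (real^2) \<Rightarrow>\<^sub>L (real^2).
        continuous_on \<Omega> z' \<and> (\<forall>x\<in>\<Omega>. (z has_derivative blinfun_apply (z' x)) (at x))) \<and>
     (\<exists>K. compact K \<and> K \<subseteq> \<Omega> \<and> (\<forall>x\<in>\<Omega> - K. z x = 0))}"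

definition div_field :: "(real^2 \<Rightarrow> real^2) \<Rightarrow> real^2 \<Rightarrow> real" where
  "div_field z x = (\<Sum>i\<in>UNIV. frechet_derivative z (at x) (axis i 1) $ i)"

definition total_variation ::
    "(real^2 \<Rightarrow> real) \<Rightarrow> (real^2) set \<Rightarrow> (real^2 \<Rightarrow> real) \<Rightarrow> ereal" where
  "total_variation \<phi> \<Omega> u =
     (SUP z\<in>{z \<in> C1c_fields \<Omega>. AE x in lebesgue_on \<Omega>. polar \<phi> (z x) \<le> 1}.
        ereal (LINT x|lebesgue_on \<Omega>. u x * div_field z x))"

definition BV :: "(real^2) set \<Rightarrow> (real^2 \<Rightarrow> real) set" where
  "BV \<Omega> = {u. integrable (lebesgue_on \<Omega>) u \<and>
     bdd_above {LINT x|lebesgue_on \<Omega>. u x * div_field z x | z.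
       z \<in> C1c_fields \<Omega> \<and> (\<forall>x\<in>\<Omega>. norm (z x) \<le> 1)}}"

definition least_gradient ::
    "(real^2 \<Rightarrow> real) \<Rightarrow> (real^2) set \<Rightarrow> (real^2 \<Rightarrow> real) \<Rightarrow> bool" where
  "least_gradient \<phi> \<Omega> u \<longleftrightarrow> u \<in> BV \<Omega> \<and>
     (\<forall>v\<in>BV \<Omega>. (\<exists>K. compact K \<and> K \<subseteq> \<Omega> \<and> (AE x in lebesgue_on \<Omega>. x \<notin> K \<longrightarrow> v x = 0)) \<longrightarrow>
        total_variation \<phi> \<Omega> u \<le> total_variation \<phi> \<Omega> (\<lambda>x. u x + v x))"

(* One-dimensional Hausdorff measure. The sets U n have to be bounded because diameter
   is real-valued, with an unspecified value on unbounded sets. *)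
definition hausdorff1_pre :: "real \<Rightarrow> (real^2) set \<Rightarrow> ennreal" where
  "hausdorff1_pre \<delta> A =
     (INF U\<in>{U :: nat \<Rightarrow> (real^2) set.
          A \<subseteq> (\<Union>n. U n) \<and> (\<forall>n. bounded (U n) \<and> diameter (U n) \<le> \<delta>)}.
        (\<Sum>n. ennreal (diameter (U n))))"

definition hausdorff1 :: "(real^2) set \<Rightarrow> ennreal" where
  "hausdorff1 A = (SUP \<delta>\<in>{0<..}. hausdorff1_pre \<delta> A)"

(* The averages of |u - g x| over B(x,r) \<inter> \<Omega> tend to 0 for H^1-almost every boundary
   point x. For u in BV \<Omega>, \<Omega> bounded and Lipschitz, this determines g up to H^1-null
   subsets of the boundary and says that g is the BV trace of u. *)
definition has_trace ::
    "(real^2) set \<Rightarrow> (real^2 \<Rightarrow> real) \<Rightarrow> (real^2 \<Rightarrow> real) \<Rightarrow> bool" where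
  "has_trace \<Omega> u g \<longleftrightarrow>
     hausdorff1 {x \<in> frontier \<Omega>.
       \<not> ((\<lambda>r. (LINT y|lebesgue_on (ball x r \<inter> \<Omega>). \<bar>u y - g x\<bar>) / measure lebesgue (ball x r \<inter> \<Omega>))
            \<longlongrightarrow> 0) (at_right 0)} = 0"

definition anisotropic_lgp_solution ::
    "(real^2 \<Rightarrow> real) \<Rightarrow> (real^2) set \<Rightarrow> (real^2 \<Rightarrow> real) \<Rightarrow> (real^2 \<Rightarrow> real) \<Rightarrow> bool" where
  "anisotropic_lgp_solution \<phi> \<Omega> f u \<longleftrightarrow> least_gradient \<phi> \<Omega> u \<and> has_trace \<Omega> u f"

end

theory Submission
  imports Defs
begin

text \<open>
  The difficulty is that the unit ball of \<open>\<phi>\<close> may contain segments: segments are then still shortest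
  curves for the induced length, but not the only ones, so that truncating a function of least variation on a cap
  of \<open>\<Omega>\<close> need not strictly lower its variation, and not every minimiser of a relaxed problem attains the
  boundary values. One that does has to be selected. This is done by minimising
  under pointwise constraints that force the boundary values, and by showing afterwards that the
  constraints are harmless.
  
  First extend \<open>f\<close> to a continuous function \<open>F\<close> of finite total variation (\<open>boundary_extension\<close>; a
  merely continuous \<open>f\<close> requires a layered construction near the boundary). For a half-plane \<open>H\<close>,
  call \<open>\<Omega> \<inter> H\<close> a cap, and require of \<open>u\<close> that its values on each of countably many caps lie
  between the infimum and the supremum of \<open>F\<close> on this cap. This class is convex, closed, and contains \<open>F\<close>.
  Strict convexity of \<open>\<Omega>\<close> provides arbitrarily small caps around every boundary point
  (\<open>countable_cap_family\<close>), so by continuity of \<open>F\<close> every function of the class has the trace \<open>f\<close>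
  (\<open>has_trace_if_limit\<close>). The total variation is convex and lower semicontinuous, and it attains its
  minimum on the class at some \<open>u\<close> (\<open>minimizer_exists\<close>).
  
  It remains to compare \<open>u\<close> with an unconstrained competitor \<open>w = u + v\<close>, where \<open>v\<close> has compact support.
  Clip \<open>w\<close> to the interval of the first cap, then of the second, and so on. A single clip does not
  increase the total variation (\<open>cap_truncation\<close>): near the boundary \<open>w\<close> equals \<open>u\<close> and obeys the bounds,
  so the clip only removes a part of \<open>w\<close> that is compactly supported in the domain, and the jump that it may
  create along the edge of the cap costs no more than the variation removed, since a constant field
  calibrates the edge (\<open>calibrated_cut\<close>). The intervals of two intersecting caps share the values of \<open>F\<close> on
  the intersection. Therefore earlier constraints stay satisfied, the clipped values converge, and the
  limit belongs to the class (\<open>sequential_clipping_limit\<close>). By lower semicontinuity its total variation is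
  at most that of \<open>w\<close>, and by minimality at least that of \<open>u\<close>.
  
  The calibration argument needs the chain rule and is therefore carried out for mollified functions; the
  passage to the limit uses only \<open>L\<^sup>1\<close> convergence.
\<close>

section \<open>Gradients and divergences of continuously differentiable maps\<close>

definition grad :: "(real^2 \<Rightarrow> real) \<Rightarrow> real^2 \<Rightarrow> real^2" where
  "grad g x = (\<chi> j. frechet_derivative g (at x) (axis j 1))"

definition C1 :: "(real^2 \<Rightarrow> real) \<Rightarrow> bool" where
  "C1 g \<longleftrightarrow> (\<forall>x. g differentiable (at x)) \<and> continuous_on UNIV (grad g)"

lemma grad_eqI:
  assumes "(g has_derivative (\<lambda>h. v \<bullet> h)) (at x)"
  shows "grad g x = v"
proof -
  have "frechet_derivative g (at x) = (\<lambda>h. v \<bullet> h)"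
    using frechet_derivative_at[OF assms] by simp
  then show ?thesis
    unfolding grad_def by (simp add: vec_eq_iff inner_axis)
qed

lemma linear_inner_representation:
  fixes L :: "real^2 \<Rightarrow> real"
  assumes "linear L"
  shows "L h = (\<chi> j. L (axis j 1)) \<bullet> h"
proof -
  have "L h = L (\<Sum>j\<in>UNIV. h $ j *\<^sub>R axis j 1)"
    by (metis basis_expansion scalar_mult_eq_scaleR)
  also have "\<dots> = (\<Sum>j\<in>UNIV. h $ j * L (axis j 1))"
    by (simp add: linear_sum[OF assms] linear_cmul[OF assms])
  also have "\<dots> = (\<chi> j. L (axis j 1)) \<bullet> h"
    by (simp add: inner_vec_def mult.commute)
  finally show ?thesis .
qed

lemma C1_has_derivative:
  assumes "C1 g"
  shows "(g has_derivative (\<lambda>h. grad g x \<bullet> h)) (at x)"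
proof -
  have d: "(g has_derivative frechet_derivative g (at x)) (at x)"
    using assms by (simp add: C1_def frechet_derivative_works)
  have "frechet_derivative g (at x) = (\<lambda>h. grad g x \<bullet> h)"
    unfolding grad_def
    using linear_inner_representation[OF has_derivative_linear[OF d]] by blast
  with d show ?thesis by simp
qed

lemma C1I:
  assumes "\<And>x. (g has_derivative (\<lambda>h. g' x \<bullet> h)) (at x)" and "continuous_on UNIV g'"
  shows "C1 g"
proof -
  have "grad g = g'" using grad_eqI[OF assms(1)] by blast
  with assms show ?thesis unfolding C1_def differentiable_def by auto
qed

lemma C1_continuous_grad: "C1 g \<Longrightarrow> continuous_on A (grad g)"
  unfolding C1_def using continuous_on_subset by blast

lemma C1_continuous: "C1 g \<Longrightarrow> continuous_on A g"
  by (meson C1_def continuous_at_imp_continuous_on differentiable_imp_continuous_within)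

lemma C1_const [simp]: "C1 (\<lambda>x. a)"
  by (rule C1I[where g'="\<lambda>x. 0"]) auto

lemma grad_const [simp]: "grad (\<lambda>x. a) x = 0"
  by (rule grad_eqI) auto

lemma has_derivative_grad_mult:
  assumes "C1 f" "C1 g"
  shows "((\<lambda>x. f x * g x) has_derivative (\<lambda>h. (f x *\<^sub>R grad g x + g x *\<^sub>R grad f x) \<bullet> h)) (at x)"
  by (rule has_derivative_eq_rhs[OF has_derivative_mult[OF C1_has_derivative C1_has_derivative]])
     (auto simp: assms inner_add_left algebra_simps)

lemma C1_mult: "C1 f \<Longrightarrow> C1 g \<Longrightarrow> C1 (\<lambda>x. f x * g x)"
  by (rule C1I[OF has_derivative_grad_mult])
     (auto intro!: continuous_intros C1_continuous C1_continuous_grad)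

lemma grad_mult:
  "C1 f \<Longrightarrow> C1 g \<Longrightarrow> grad (\<lambda>x. f x * g x) x = f x *\<^sub>R grad g x + g x *\<^sub>R grad f x"
  by (rule grad_eqI[OF has_derivative_grad_mult])

lemma has_derivative_grad_add:
  assumes "C1 f" "C1 g"
  shows "((\<lambda>x. f x + g x) has_derivative (\<lambda>h. (grad f x + grad g x) \<bullet> h)) (at x)"
  by (rule has_derivative_eq_rhs[OF has_derivative_add[OF C1_has_derivative C1_has_derivative]])
     (auto simp: assms inner_add_left algebra_simps)

lemma C1_add: "C1 f \<Longrightarrow> C1 g \<Longrightarrow> C1 (\<lambda>x. f x + g x)"
  by (rule C1I[OF has_derivative_grad_add])
     (auto intro!: continuous_intros C1_continuous_grad)

lemma grad_add: "C1 f \<Longrightarrow> C1 g \<Longrightarrow> grad (\<lambda>x. f x + g x) x = grad f x + grad g x"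
  by (rule grad_eqI[OF has_derivative_grad_add])

lemma C1_cmult: "C1 g \<Longrightarrow> C1 (\<lambda>x. a * g x)"
  by (rule C1_mult[OF C1_const])

lemma grad_cmult: "C1 g \<Longrightarrow> grad (\<lambda>x. a * g x) x = a *\<^sub>R grad g x"
  by (simp add: grad_mult)

lemma C1_uminus: "C1 g \<Longrightarrow> C1 (\<lambda>x. - g x)"
  using C1_cmult[of g "-1"] by simp

lemma grad_uminus: "C1 g \<Longrightarrow> grad (\<lambda>x. - g x) x = - grad g x"
  using grad_cmult[of g "-1"] by simp

lemma C1_diff: "C1 f \<Longrightarrow> C1 g \<Longrightarrow> C1 (\<lambda>x. f x - g x)"
  using C1_add[OF _ C1_uminus, of f g] by simp

lemma grad_diff: "C1 f \<Longrightarrow> C1 g \<Longrightarrow> grad (\<lambda>x. f x - g x) x = grad f x - grad g x"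
  using grad_add[OF _ C1_uminus, of f g x] by (simp add: grad_uminus)

lemma has_derivative_affine: "((\<lambda>x. n \<bullet> x + a) has_derivative (\<lambda>h. n \<bullet> h)) (at x)"
  by (auto intro!: derivative_eq_intros)

lemma C1_affine: "C1 (\<lambda>x. n \<bullet> x + a)"
  by (rule C1I[OF has_derivative_affine]) auto

lemma grad_affine: "grad (\<lambda>x. n \<bullet> x + a) x = n"
  by (rule grad_eqI[OF has_derivative_affine])

lemma has_derivative_grad_compose:
  assumes "C1 g" "\<And>t. (q has_real_derivative q' t) (at t)"
  shows "((\<lambda>x. q (g x)) has_derivative (\<lambda>h. (q' (g x) *\<^sub>R grad g x) \<bullet> h)) (at x)"
  using has_derivative_compose[OF C1_has_derivative[OF assms(1)] assms(2)[unfolded has_field_derivative_def]]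
  by (auto simp: mult_ac)

lemma C1_compose:
  assumes "C1 g" "\<And>t. (q has_real_derivative q' t) (at t)" "continuous_on UNIV q'"
  shows "C1 (\<lambda>x. q (g x))"
  by (rule C1I[OF has_derivative_grad_compose[OF assms(1,2)]])
     (auto intro!: continuous_intros C1_continuous_grad assms
        continuous_on_compose2[OF assms(3) C1_continuous])

lemma grad_compose:
  assumes "C1 g" "\<And>t. (q has_real_derivative q' t) (at t)"
  shows "grad (\<lambda>x. q (g x)) x = q' (g x) *\<^sub>R grad g x"
  by (rule grad_eqI[OF has_derivative_grad_compose[OF assms]])

lemma grad_cong_open:
  assumes "open U" "x \<in> U" "\<And>y. y \<in> U \<Longrightarrow> f y = g y" "C1 g"
  shows "grad f x = grad g x"
  by (rule grad_eqI, rule has_derivative_transform_within_open[OF C1_has_derivative[OF assms(4)] assms(1,2)])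
     (simp add: assms(3))

lemma grad_eq_0_off:
  assumes "closed K" "\<And>y. y \<notin> K \<Longrightarrow> g y = a" "x \<notin> K"
  shows "grad g x = 0"
  using grad_cong_open[of "- K" x g "\<lambda>_. a"] assms by auto

definition C1_field :: "(real^2 \<Rightarrow> real^2) \<Rightarrow> bool" where
  "C1_field z \<longleftrightarrow> (\<forall>i. C1 (\<lambda>x. z x $ i))"

text \<open>
  The set \<open>K\<close> may be larger than the support, so that one compact set can serve for a function, its
  gradient, and all products containing it.
\<close>

definition supported_in :: "(real^2 \<Rightarrow> 'b::zero) \<Rightarrow> (real^2) set \<Rightarrow> bool" where
  "supported_in z K \<longleftrightarrow> compact K \<and> (\<forall>x. x \<notin> K \<longrightarrow> z x = 0)"

lemma C1_field_has_derivative: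
  assumes "C1_field z"
  shows "(z has_derivative (\<lambda>h. \<chi> i. grad (\<lambda>y. z y $ i) x \<bullet> h)) (at x)"
  unfolding has_derivative_componentwise_within[of z]
  using assms C1_has_derivative
  by (auto simp: C1_field_def Basis_vec_def inner_axis' inner_axis)

lemma div_field_eq:
  assumes "C1_field z"
  shows "div_field z x = (\<Sum>i\<in>UNIV. grad (\<lambda>y. z y $ i) x $ i)"
  unfolding div_field_def
  by (simp add: inner_axis flip: frechet_derivative_at[OF C1_field_has_derivative[OF assms]])

lemma C1_field_scaleR: "C1 g \<Longrightarrow> C1_field z \<Longrightarrow> C1_field (\<lambda>x. g x *\<^sub>R z x)"
  by (simp add: C1_field_def C1_mult)

lemma C1_field_add: "C1_field y \<Longrightarrow> C1_field z \<Longrightarrow> C1_field (\<lambda>x. y x + z x)"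
  by (simp add: C1_field_def C1_add)

lemma C1_field_const [simp]: "C1_field (\<lambda>x. c)"
  by (simp add: C1_field_def)

lemma C1_field_uminus: "C1_field z \<Longrightarrow> C1_field (\<lambda>x. - z x)"
  by (simp add: C1_field_def C1_uminus)

lemma div_field_scaleR:
  assumes "C1 g" "C1_field z"
  shows "div_field (\<lambda>x. g x *\<^sub>R z x) x = g x * div_field z x + grad g x \<bullet> z x"
proof -
  have "C1 (\<lambda>x. z x $ i)" for i using assms(2) by (simp add: C1_field_def)
  then show ?thesis
    unfolding div_field_eq[OF assms(2)] div_field_eq[OF C1_field_scaleR[OF assms]]
    by (simp add: grad_mult[OF assms(1)] inner_vec_def sum.distrib sum_distrib_left mult.commute)
qed

lemma div_field_uminus: "C1_field z \<Longrightarrow> div_field (\<lambda>x. - z x) x = - div_field z x"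
  by (simp add: div_field_eq C1_field_uminus) (simp add: C1_field_def grad_uminus sum_negf)

lemma div_field_const [simp]: "div_field (\<lambda>x. c) x = 0"
  by (simp add: div_field_eq)

lemma C1_field_continuous:
  assumes "C1_field z" shows "continuous_on A z"
proof -
  have "continuous_on A (\<lambda>x. \<chi> i. z x $ i)"
    using assms by (intro continuous_on_vec_lambda) (auto simp: C1_field_def intro: C1_continuous)
  then show ?thesis by simp
qed

lemma continuous_div_field: "C1_field z \<Longrightarrow> continuous_on A (div_field z)"
  by (subst continuous_on_cong[OF refl div_field_eq])
     (auto simp: C1_field_def intro!: continuous_intros C1_continuous_grad)

lemma supported_in_div:
  assumes "C1_field z" "supported_in z K"
  shows "supported_in (div_field z) K"
proof -
  have "grad (\<lambda>y. z y $ i) x = 0" if "x \<notin> K" for x i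
    using assms(2) that by (intro grad_eq_0_off[where K=K and a=0])
       (auto simp: supported_in_def compact_imp_closed)
  with assms show ?thesis by (auto simp: supported_in_def div_field_eq)
qed

lemma supported_in_grad:
  "supported_in g K \<Longrightarrow> supported_in (grad g) K"
  using grad_eq_0_off[where K=K and g=g and a=0] compact_imp_closed unfolding supported_in_def by blast

lemma supported_in_bounded:
  fixes f :: "real^2 \<Rightarrow> 'b::real_normed_vector"
  assumes "continuous_on UNIV f" "supported_in f K"
  obtains B where "B > 0" "\<And>x. norm (f x) \<le> B"
proof -
  have "compact (f ` K)"
    using assms by (auto simp: supported_in_def intro: compact_continuous_image continuous_on_subset)
  then obtain B where "B > 0" "\<And>x. x \<in> K \<Longrightarrow> norm (f x) \<le> B"
    by (metis bounded_pos compact_imp_bounded imageI)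
  with that show ?thesis using assms(2) unfolding supported_in_def
    by (metis less_eq_real_def norm_zero)
qed

lemma supported_in_uniformly_continuous:
  fixes f :: "real^2 \<Rightarrow> 'b::real_normed_vector"
  assumes "continuous_on UNIV f" "supported_in f K"
  shows "uniformly_continuous_on UNIV f"
proof -
  obtain R where R: "K \<subseteq> ball 0 R"
    by (meson assms(2) bounded_subset_ballD compact_imp_bounded supported_in_def)
  have u: "uniformly_continuous_on (cball 0 (R+1)) f"
    by (rule compact_uniformly_continuous) (auto intro: continuous_on_subset[OF assms(1)])
  show ?thesis
    unfolding uniformly_continuous_on_def
  proof (intro allI impI)
    fix e :: real assume "e > 0"
    then obtain d where d: "d > 0" "\<And>x y. x \<in> cball 0 (R+1) \<Longrightarrow> y \<in> cball 0 (R+1) \<Longrightarrow> dist y x < d \<Longrightarrow> dist (f y) (f x) < e"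
      using u unfolding uniformly_continuous_on_def by metis
    have "dist (f y) (f x) < e" if "dist y x < min d 1" for x y
    proof (cases "x \<in> cball 0 (R+1) \<and> y \<in> cball 0 (R+1)")
      case True
      then show ?thesis using d that by simp
    next
      case False
      have "norm x \<le> norm y + dist y x" "norm y \<le> norm x + dist y x"
        by (metis add.commute dist_commute dist_norm norm_triangle_sub)
         (metis dist_norm norm_triangle_sub)
      then have "x \<notin> ball 0 R" "y \<notin> ball 0 R"
        using False that by auto
      then have "f x = 0" "f y = 0"
        using R assms(2) by (auto simp: supported_in_def)
      then show ?thesis using \<open>e > 0\<close> by simp
    qed
    then show "\<exists>d>0. \<forall>x\<in>UNIV. \<forall>x'\<in>UNIV. dist x' x < d \<longrightarrow> dist (f x') (f x) < e"
      using d(1) by (intro exI[of _ "min d 1"]) auto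
  qed
qed

text \<open>
  A compactly supported continuous gradient is uniformly continuous, so the first order expansion of
  \<open>g\<close> holds with an error that is uniform in the base point. This uniformity is what allows
  difference quotients to be integrated against a function that is merely integrable.
\<close>

lemma uniform_linearization:
  assumes "C1 g" "supported_in g K" "e > 0"
  obtains d where "d > 0"
    "\<And>x h. norm h < d \<Longrightarrow> \<bar>g (x + h) - g x - grad g x \<bullet> h\<bar> \<le> e * norm h"
proof -
  have "uniformly_continuous_on UNIV (grad g)"
    using assms by (intro supported_in_uniformly_continuous supported_in_grad C1_continuous_grad)
  then obtain d where d: "d > 0" "\<And>x y. dist y x < d \<Longrightarrow> dist (grad g y) (grad g x) < e"
    unfolding uniformly_continuous_on_def using \<open>e > 0\<close> by (metis UNIV_I)
  have "\<bar>g (x + h) - g x - grad g x \<bullet> h\<bar> \<le> e * norm h" if h: "norm h < d" for x h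
  proof -
    have "norm (g (x + h) - g x - grad g x \<bullet> (x + h - x)) \<le> norm (x + h - x) * e"
    proof (rule differentiable_bound_linearization[where S="ball x d" and f'="\<lambda>y h. grad g y \<bullet> h"])
      fix t :: real assume "t \<in> {0..1}"
      then have "\<bar>t\<bar> * norm h \<le> norm h" by (simp add: mult_left_le_one_le)
      then show "x + t *\<^sub>R (x + h - x) \<in> ball x d"
        using h by (simp add: dist_norm)
    next
      fix y assume y: "y \<in> ball x d"
      show "(g has_derivative (\<lambda>h. grad g y \<bullet> h)) (at y within ball x d)"
        using C1_has_derivative[OF assms(1)] has_derivative_at_withinI by blast
      have "onorm (\<lambda>h. (grad g y - grad g x) \<bullet> h) \<le> norm (grad g y - grad g x)"
        by (rule onorm_bound) (auto simp: Cauchy_Schwarz_ineq2)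
      also have "\<dots> \<le> e" using d(2)[of y x] y by (auto simp: dist_norm norm_minus_commute)
      finally show "onorm ((\<lambda>h. grad g y \<bullet> h) - (\<lambda>h. grad g x \<bullet> h)) \<le> e"
        by (simp add: fun_diff_def inner_diff_left)
    qed (use d in auto)
    then show ?thesis by (simp add: mult.commute)
  qed
  with d(1) that show ?thesis by blast
qed

section \<open>Differentiation under the integral sign\<close>

lemma integrable_mult_bounded:
  fixes g f :: "'a \<Rightarrow> real"
  assumes "integrable M g" "f \<in> borel_measurable M" "\<And>x. \<bar>f x\<bar> \<le> B"
  shows "integrable M (\<lambda>x. g x * f x)"
proof (rule Bochner_Integration.integrable_bound)
  show "integrable M (\<lambda>x. B * g x)" using assms(1) by simp
  show "(\<lambda>x. g x * f x) \<in> borel_measurable M"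
    using assms(1,2) by measurable
  have "\<bar>g x\<bar> * \<bar>f x\<bar> \<le> \<bar>B\<bar> * \<bar>g x\<bar>" for x
    using assms(3)[of x] by (metis abs_ge_zero abs_of_nonneg mult.commute mult_left_mono order_trans)
  then show "AE x in M. norm (g x * f x) \<le> norm (B * g x)"
    by (simp add: abs_mult)
qed

lemma integrable_continuous_supported:
  fixes f :: "real^2 \<Rightarrow> 'b::{banach, second_countable_topology}"
  assumes "continuous_on UNIV f" "supported_in f K"
  shows "integrable lborel f"
proof -
  have "integrable lborel (\<lambda>x. indicator K x *\<^sub>R f x)"
    using assms by (intro borel_integrable_compact) (auto simp: supported_in_def intro: continuous_on_subset)
  moreover have "indicator K x *\<^sub>R f x = f x" for x
    using assms(2) by (auto simp: supported_in_def indicator_def)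
  ultimately show ?thesis by simp
qed

lemma borel_measurable_C1: "C1 g \<Longrightarrow> g \<in> borel_measurable borel"
  by (rule borel_measurable_continuous_onI[OF C1_continuous])

lemma borel_measurable_grad: "C1 g \<Longrightarrow> grad g \<in> borel_measurable borel"
  by (rule borel_measurable_continuous_onI[OF C1_continuous_grad])

lemma borel_measurable_div_field: "C1_field z \<Longrightarrow> div_field z \<in> borel_measurable borel"
  by (rule borel_measurable_continuous_onI[OF continuous_div_field])

lemma
  fixes f :: "real^2 \<Rightarrow> real"
  assumes f: "f \<in> borel_measurable borel"
  shows lborel_integral_translate: "(LBINT x. f (c + x)) = (LBINT x. f x)"
    and lborel_integrable_translate: "integrable lborel (\<lambda>x. f (c + x)) \<longleftrightarrow> integrable lborel f"
proof -
  have "(\<integral>x. f x \<partial>distr lborel borel ((+) c)) = (LBINT x. f (c + x))"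
    using f by (intro integral_distr) auto
  then show "(LBINT x. f (c + x)) = (LBINT x. f x)"
    by (simp add: lborel_distr_plus)
  have "integrable (distr lborel borel ((+) c)) f \<longleftrightarrow> integrable lborel (\<lambda>x. f (c + x))"
    using f by (intro integrable_distr_eq) auto
  then show "integrable lborel (\<lambda>x. f (c + x)) \<longleftrightarrow> integrable lborel f"
    by (simp add: lborel_distr_plus)
qed

lemma lborel_distr_reflect:
  "distr lborel borel (\<lambda>x::real^2. c - x) = lborel"
  using lborel_affine[of "-1" c] by (simp add: density_1)

lemma
  fixes f :: "real^2 \<Rightarrow> real"
  assumes f: "f \<in> borel_measurable borel"
  shows lborel_integral_reflect: "(LBINT x. f (c - x)) = (LBINT x. f x)"
    and lborel_integrable_reflect: "integrable lborel (\<lambda>x. f (c - x)) \<longleftrightarrow> integrable lborel f"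
proof -
  have "(\<integral>x. f x \<partial>distr lborel borel (\<lambda>x. c - x)) = (LBINT x. f (c - x))"
    using f by (intro integral_distr) auto
  then show "(LBINT x. f (c - x)) = (LBINT x. f x)"
    by (simp add: lborel_distr_reflect)
  have "integrable (distr lborel borel (\<lambda>x. c - x)) f \<longleftrightarrow> integrable lborel (\<lambda>x. f (c - x))"
    using f by (intro integrable_distr_eq) auto
  then show "integrable lborel (\<lambda>x. f (c - x)) \<longleftrightarrow> integrable lborel f"
    by (simp add: lborel_distr_reflect)
qed

lemma abs_integral_le:
  fixes f g :: "'a \<Rightarrow> real"
  assumes "integrable M g" "\<And>x. \<bar>f x\<bar> \<le> g x"
  shows "\<bar>\<integral>x. f x \<partial>M\<bar> \<le> (\<integral>x. g x \<partial>M)"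
proof (cases "integrable M f")
  case True
  have "\<bar>\<integral>x. f x \<partial>M\<bar> \<le> (\<integral>x. \<bar>f x\<bar> \<partial>M)" by (rule integral_abs_bound)
  also have "\<dots> \<le> (\<integral>x. g x \<partial>M)" using True assms by (intro integral_mono) auto
  finally show ?thesis .
next
  case False
  have "0 \<le> g x" for x using assms(2)[of x] by linarith
  then show ?thesis using False by (simp add: not_integrable_integral_eq)
qed

text \<open>
  By a translation of the integration variable the difference quotient of \<open>g\<close> becomes one of \<open>z\<close>,
  which converges uniformly. For \<open>g\<close> the indicator of a disc this yields the divergence theorem, and
  for \<open>g\<close> Lipschitz it yields a bound on the variation of \<open>g\<close>.
\<close>

lemma integral_diff_quotient_tendsto:
  assumes g: "integrable lborel g" and z: "C1 z" "supported_in z K"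
  shows "((\<lambda>h. (LBINT x. (g (x - h *\<^sub>R e) - g x) * z x) / h)
            \<longlongrightarrow> (LBINT x. g x * (grad z x \<bullet> e))) (at_right 0)"
proof -
  obtain B where B: "\<And>x. \<bar>z x\<bar> \<le> B"
    using supported_in_bounded[OF C1_continuous[OF z(1)] z(2)] by auto
  obtain B' where B': "\<And>x. norm (grad z x) \<le> B'"
    using supported_in_bounded[OF C1_continuous_grad[OF z(1)] supported_in_grad[OF z(2)]] by auto
  have [measurable]: "g \<in> borel_measurable borel" using g by auto
  note [measurable] = borel_measurable_C1[OF z(1)] borel_measurable_grad[OF z(1)]
  have shift: "(LBINT x. (g (x - h *\<^sub>R e) - g x) * z x) = (LBINT x. g x * (z (x + h *\<^sub>R e) - z x))" for h
  proof -
    have gi: "integrable lborel (\<lambda>x. g (x - h *\<^sub>R e))"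
      using lborel_integrable_translate[of g "- (h *\<^sub>R e)"] g by (simp add: algebra_simps)
    have "(LBINT x. (g (x - h *\<^sub>R e) - g x) * z x)
        = (LBINT x. g (x - h *\<^sub>R e) * z x) - (LBINT x. g x * z x)"
      unfolding left_diff_distrib
      by (intro Bochner_Integration.integral_diff integrable_mult_bounded[OF gi _ B] integrable_mult_bounded[OF g _ B])
         auto
    also have "(LBINT x. g (x - h *\<^sub>R e) * z x) = (LBINT x. g x * z (x + h *\<^sub>R e))"
      using lborel_integral_translate[of "\<lambda>x. g (x - h *\<^sub>R e) * z x" "h *\<^sub>R e"]
      by (simp add: algebra_simps)
    also have "\<dots> - (LBINT x. g x * z x) = (LBINT x. g x * (z (x + h *\<^sub>R e) - z x))"
      unfolding right_diff_distrib
      by (intro Bochner_Integration.integral_diff[symmetric] integrable_mult_bounded[OF g _ B]) auto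
    finally show ?thesis .
  qed
  show ?thesis
    unfolding shift
  proof (rule tendstoI)
    \<comment> \<open>The summand 1 keeps the denominator positive also when \<open>g\<close> vanishes almost everywhere.\<close>
    fix \<epsilon> :: real assume "\<epsilon> > 0"
    define N where "N = (LBINT x. \<bar>g x\<bar>)"
    have "N \<ge> 0" by (simp add: N_def)
    define c where "c = \<epsilon> / (1 + N * (norm e + 1))"
    have "c > 0" using \<open>\<epsilon> > 0\<close> \<open>N \<ge> 0\<close> by (simp add: c_def add_pos_nonneg)
    obtain d where d: "d > 0" "\<And>x h. norm h < d \<Longrightarrow> \<bar>z (x + h) - z x - grad z x \<bullet> h\<bar> \<le> c * norm h"
      using uniform_linearization[OF z \<open>c > 0\<close>] by blast
    have "dist ((LBINT x. g x * (z (x + h *\<^sub>R e) - z x)) / h) (LBINT x. g x * (grad z x \<bullet> e)) < \<epsilon>"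
      if h: "0 < h" "h < d / (norm e + 1)" for h
    proof -
      have "h * norm e < d"
      proof -
        have "h * norm e \<le> h * (norm e + 1)" using h by simp
        also have "\<dots> < d" using h by (simp add: pos_less_divide_eq add_nonneg_pos)
        finally show ?thesis .
      qed
      have gb: "\<bar>grad z x \<bullet> e\<bar> \<le> B' * norm e" for x
        using Cauchy_Schwarz_ineq2[of "grad z x" e] mult_right_mono[OF B'[of x], of "norm e"] by simp
      have zb: "\<bar>z (x + h *\<^sub>R e) - z x\<bar> \<le> B + B" for x
        using B[of x] B[of "x + h *\<^sub>R e"] by linarith
      have "(LBINT x. g x * (z (x + h *\<^sub>R e) - z x)) / h - (LBINT x. g x * (grad z x \<bullet> e))
          = (LBINT x. g x * (z (x + h *\<^sub>R e) - z x) / h - g x * (grad z x \<bullet> e))"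
        by (subst Bochner_Integration.integral_diff)
           (auto intro!: integrable_mult_bounded[OF g _ gb] integrable_mult_bounded[OF g _ zb] Bochner_Integration.integrable_divide)
      also have "\<bar>\<dots>\<bar> \<le> (LBINT x. \<bar>g x\<bar> * (c * norm e))"
      proof (rule abs_integral_le)
        show "integrable lborel (\<lambda>x. \<bar>g x\<bar> * (c * norm e))" using g by simp
        fix x
        have "\<bar>z (x + h *\<^sub>R e) - z x - h * (grad z x \<bullet> e)\<bar> \<le> c * (h * norm e)"
          using d(2)[of "h *\<^sub>R e" x] h \<open>h * norm e < d\<close> by simp
        then have "\<bar>(z (x + h *\<^sub>R e) - z x - h * (grad z x \<bullet> e)) / h\<bar> \<le> c * norm e"
          using h by (simp add: field_simps)
        moreover have "g x * (z (x + h *\<^sub>R e) - z x) / h - g x * (grad z x \<bullet> e)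
           = g x * ((z (x + h *\<^sub>R e) - z x - h * (grad z x \<bullet> e)) / h)"
          using h by (simp add: field_simps)
        ultimately show "\<bar>g x * (z (x + h *\<^sub>R e) - z x) / h - g x * (grad z x \<bullet> e)\<bar> \<le> \<bar>g x\<bar> * (c * norm e)"
          by (metis abs_mult abs_ge_zero mult_left_mono)
      qed
      also have "\<dots> = c * (N * norm e)" by (simp add: N_def mult_ac)
      also have "\<dots> < c * (1 + N * (norm e + 1))"
        using \<open>c > 0\<close> \<open>N \<ge> 0\<close> by (intro mult_strict_left_mono) (simp_all add: algebra_simps add_strict_increasing)
      also have "\<dots> = \<epsilon>"
      proof -
        have "1 + N * (norm e + 1) > 0" using \<open>N \<ge> 0\<close> by (simp add: add_pos_nonneg)
        then show ?thesis by (simp add: c_def)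
      qed
      finally show ?thesis by (simp add: dist_real_def)
    qed
    moreover have "d / (norm e + 1) > 0" using d(1) by (simp add: add_nonneg_pos)
    ultimately show "\<forall>\<^sub>F h in at_right 0. dist ((LBINT x. g x * (z (x + h *\<^sub>R e) - z x)) / h) (LBINT x. g x * (grad z x \<bullet> e)) < \<epsilon>"
      unfolding eventually_at_right_field by blast
  qed
qed

text \<open>
  On the support of \<open>z\<close>, short translates of the indicator of a much larger disc agree with it, so its
  difference quotients vanish there.
\<close>

lemma integral_grad_eq_0:
  assumes z: "C1 z" "supported_in z K"
  shows "(LBINT x. grad z x \<bullet> e) = 0"
proof -
  obtain R where R: "K \<subseteq> ball 0 R" and "R > 0"
    by (metis bounded_subset_ballD compact_imp_bounded supported_in_def z(2))
  define g :: "real^2 \<Rightarrow> real" where "g = indicator (ball 0 (R + 1))"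
  have g: "integrable lborel g"
    unfolding g_def by (rule integrable_real_indicator) (use emeasure_bounded_finite[OF bounded_ball] in \<open>auto simp: less_top\<close>)
  have lim: "((\<lambda>h. (LBINT x. (g (x - h *\<^sub>R e) - g x) * z x) / h)
            \<longlongrightarrow> (LBINT x. g x * (grad z x \<bullet> e))) (at_right 0)"
    by (rule integral_diff_quotient_tendsto[OF g z])
  have "(LBINT x. (g (x - h *\<^sub>R e) - g x) * z x) / h = 0"
    if h: "0 < h" "h < 1 / (norm e + 1)" for h
  proof -
    have eq0: "(g (x - h *\<^sub>R e) - g x) * z x = 0" for x
    proof (cases "x \<in> K")
      case True
      have "h * norm e \<le> h * (norm e + 1)" using h by simp
      also have "\<dots> < 1" using h by (simp add: pos_less_divide_eq add_nonneg_pos)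
      finally have "norm (h *\<^sub>R e) < 1" using h by simp
      then have "norm (x - h *\<^sub>R e) < R + 1" "norm x < R + 1"
        using True R norm_triangle_ineq4[of x "h *\<^sub>R e"] by auto
      then show ?thesis by (simp add: g_def)
    qed (use z(2) in \<open>simp add: supported_in_def\<close>)
    show ?thesis unfolding eq0 by simp
  qed
  then have "\<forall>\<^sub>F h in at_right 0. (LBINT x. (g (x - h *\<^sub>R e) - g x) * z x) / h = 0"
    unfolding eventually_at_right_field
    by (intro exI[of _ "1 / (norm e + 1)"]) (simp add: add_nonneg_pos)
  from tendsto_eventually[OF this] lim have "(LBINT x. g x * (grad z x \<bullet> e)) = 0"
    using tendsto_unique trivial_limit_at_right_real by blast
  moreover have "g x * (grad z x \<bullet> e) = grad z x \<bullet> e" for x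
    using supported_in_grad[OF z(2)] R by (cases "x \<in> K") (auto simp: supported_in_def g_def indicator_def)
  ultimately show ?thesis by simp
qed

lemma supported_in_component: "supported_in z K \<Longrightarrow> supported_in (\<lambda>x. z x $ i) K"
  by (simp add: supported_in_def)

lemma integral_div_field_eq_0:
  assumes z: "C1_field z" "supported_in z K"
  shows "(LBINT x. div_field z x) = 0"
proof -
  have c: "C1 (\<lambda>x. z x $ i)" for i using z by (simp add: C1_field_def)
  have "(LBINT x. div_field z x) = (LBINT x. (\<Sum>i\<in>UNIV. grad (\<lambda>y. z y $ i) x \<bullet> axis i 1))"
    using z by (simp add: div_field_eq inner_axis)
  also have "\<dots> = (\<Sum>i\<in>UNIV. (LBINT x. grad (\<lambda>y. z y $ i) x \<bullet> axis i 1))"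
  proof (rule Bochner_Integration.integral_sum)
    fix i :: 2
    show "integrable lborel (\<lambda>x. grad (\<lambda>y. z y $ i) x \<bullet> axis i 1)"
      using integrable_continuous_supported[OF C1_continuous_grad[OF c] supported_in_grad[OF supported_in_component[OF z(2)]]]
      by simp
  qed
  also have "\<dots> = 0"
    using integral_grad_eq_0[OF c supported_in_component[OF z(2)]] by simp
  finally show ?thesis .
qed

text \<open>
  The map \<open>q\<close> covers both uses of convolution: \<open>q = uminus\<close> smooths an integrable function \<open>k\<close> by a
  kernel \<open>g\<close>, while \<open>q\<close> the identity averages a smooth function \<open>g\<close> with the weight \<open>k\<close>.
\<close>

lemma
  assumes k: "integrable lborel k" and q: "q \<in> borel_measurable borel"
    and g: "C1 g" "supported_in g K"
  shows C1_convolution: "C1 (\<lambda>y. LBINT x. k x * g (y + q x))" (is "C1 ?G")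
    and grad_convolution: "grad (\<lambda>y. LBINT x. k x * g (y + q x)) y = (LBINT x. k x *\<^sub>R grad g (y + q x))"
proof -
  let ?D = "\<lambda>y. LBINT x. k x *\<^sub>R grad g (y + q x)"
  define N where "N = (LBINT x. \<bar>k x\<bar>)"
  have "N \<ge> 0" by (simp add: N_def)
  note [measurable] = borel_measurable_C1[OF g(1)] borel_measurable_grad[OF g(1)] q
  have [measurable]: "k \<in> borel_measurable borel" using k by auto
  obtain B where B: "\<And>x. \<bar>g x\<bar> \<le> B"
    using supported_in_bounded[OF C1_continuous[OF g(1)] g(2)] by auto
  obtain B' where B': "\<And>x. norm (grad g x) \<le> B'"
    using supported_in_bounded[OF C1_continuous_grad[OF g(1)] supported_in_grad[OF g(2)]] by auto
  have ig: "integrable lborel (\<lambda>x. k x * g (y + q x))" for y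
    by (rule integrable_mult_bounded[OF k _ B]) simp
  have iD: "integrable lborel (\<lambda>x. k x *\<^sub>R grad g (y + q x))" for y
  proof (rule Bochner_Integration.integrable_bound)
    show "integrable lborel (\<lambda>x. k x * B')" using k by simp
    have "\<bar>k x\<bar> * norm (grad g (y + q x)) \<le> \<bar>k x\<bar> * \<bar>B'\<bar>" for x
      using B'[of "y + q x"] by (intro mult_left_mono) auto
    then show "AE x in lborel. norm (k x *\<^sub>R grad g (y + q x)) \<le> norm (k x * B')"
      by (simp add: abs_mult)
  qed measurable
  have deriv: "(?G has_derivative (\<lambda>h. ?D y \<bullet> h)) (at y)" for y
    unfolding has_derivative_at_alt
  proof (intro conjI allI impI)
    show "bounded_linear (\<lambda>h. ?D y \<bullet> h)" by (rule bounded_linear_inner_right)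
    fix \<epsilon> :: real assume "\<epsilon> > 0"
    define c where "c = \<epsilon> / (1 + N)"
    have "c > 0" "c * N \<le> \<epsilon>" using \<open>\<epsilon> > 0\<close> \<open>N \<ge> 0\<close> by (auto simp: c_def field_simps)
    obtain d where d: "d > 0" "\<And>x h. norm h < d \<Longrightarrow> \<bar>g (x + h) - g x - grad g x \<bullet> h\<bar> \<le> c * norm h"
      using uniform_linearization[OF g \<open>c > 0\<close>] by blast
    have "norm (?G w - ?G y - ?D y \<bullet> (w - y)) \<le> \<epsilon> * norm (w - y)" if w: "norm (w - y) < d" for w
    proof -
      have "?D y \<bullet> (w - y) = (LBINT x. (k x *\<^sub>R grad g (y + q x)) \<bullet> (w - y))"
        by (rule integral_inner_left[symmetric]) (rule iD)
      then have "?G w - ?G y - ?D y \<bullet> (w - y) =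
          (LBINT x. k x * g (w + q x) - k x * g (y + q x) - (k x *\<^sub>R grad g (y + q x)) \<bullet> (w - y))"
        by (simp only: Bochner_Integration.integral_diff ig iD integrable_inner_left Bochner_Integration.integrable_diff)
      also have "\<bar>\<dots>\<bar> \<le> (LBINT x. \<bar>k x\<bar> * (c * norm (w - y)))"
      proof (rule abs_integral_le)
        show "integrable lborel (\<lambda>x. \<bar>k x\<bar> * (c * norm (w - y)))" using k by simp
        fix x
        have "\<bar>g (w + q x) - g (y + q x) - grad g (y + q x) \<bullet> (w - y)\<bar> \<le> c * norm (w - y)"
          using d(2)[OF w, of "y + q x"] by (simp add: algebra_simps)
        then have "\<bar>k x\<bar> * \<bar>g (w + q x) - g (y + q x) - grad g (y + q x) \<bullet> (w - y)\<bar> \<le> \<bar>k x\<bar> * (c * norm (w - y))"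
          by (intro mult_left_mono) auto
        then show "\<bar>k x * g (w + q x) - k x * g (y + q x) - (k x *\<^sub>R grad g (y + q x)) \<bullet> (w - y)\<bar> \<le> \<bar>k x\<bar> * (c * norm (w - y))"
          by (simp add: abs_mult[symmetric] right_diff_distrib)
      qed
      also have "\<dots> = (c * N) * norm (w - y)" by (simp add: N_def mult_ac)
      also have "\<dots> \<le> \<epsilon> * norm (w - y)" using \<open>c * N \<le> \<epsilon>\<close> by (rule mult_right_mono) simp
      finally show ?thesis by simp
    qed
    then show "\<exists>d>0. \<forall>w. norm (w - y) < d \<longrightarrow> norm (?G w - ?G y - ?D y \<bullet> (w - y)) \<le> \<epsilon> * norm (w - y)"
      using d(1) by blast
  qed
  have "continuous_on UNIV ?D"
    unfolding continuous_on_iff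
  proof (intro ballI allI impI)
    fix y :: "real^2" and \<epsilon> :: real assume "\<epsilon> > 0"
    define c where "c = \<epsilon> / (1 + N)"
    have "c > 0" "c * N < \<epsilon>" using \<open>\<epsilon> > 0\<close> \<open>N \<ge> 0\<close> by (auto simp: c_def field_simps)
    have "uniformly_continuous_on UNIV (grad g)"
      using g by (intro supported_in_uniformly_continuous supported_in_grad C1_continuous_grad)
    then obtain d where d: "d > 0" "\<And>x y. dist y x < d \<Longrightarrow> dist (grad g y) (grad g x) < c"
      unfolding uniformly_continuous_on_def using \<open>c > 0\<close> by (metis UNIV_I)
    have "dist (?D w) (?D y) < \<epsilon>" if w: "dist w y < d" for w
    proof -
      have "?D w - ?D y = (LBINT x. k x *\<^sub>R grad g (w + q x) - k x *\<^sub>R grad g (y + q x))"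
        by (simp add: Bochner_Integration.integral_diff iD)
      also have "norm \<dots> \<le> (LBINT x. norm (k x *\<^sub>R grad g (w + q x) - k x *\<^sub>R grad g (y + q x)))"
        by (rule integral_norm_bound)
      also have "\<dots> \<le> (LBINT x. \<bar>k x\<bar> * c)"
      proof (rule integral_mono)
        show "integrable lborel (\<lambda>x. norm (k x *\<^sub>R grad g (w + q x) - k x *\<^sub>R grad g (y + q x)))"
          using iD by simp
        show "integrable lborel (\<lambda>x. \<bar>k x\<bar> * c)" using k by simp
        fix x
        have "norm (grad g (w + q x) - grad g (y + q x)) \<le> c"
          using d(2)[of "w + q x" "y + q x"] w by (simp add: dist_norm)
        then show "norm (k x *\<^sub>R grad g (w + q x) - k x *\<^sub>R grad g (y + q x)) \<le> \<bar>k x\<bar> * c"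
          by (simp add: scaleR_diff_right[symmetric] mult_left_mono)
      qed
      also have "\<dots> = c * N" by (simp add: N_def mult_ac)
      finally show ?thesis using \<open>c * N < \<epsilon>\<close> by (simp add: dist_norm)
    qed
    then show "\<exists>d>0. \<forall>w\<in>UNIV. dist w y < d \<longrightarrow> dist (?D w) (?D y) < \<epsilon>"
      using d(1) by blast
  qed
  with deriv show "C1 ?G" by (rule C1I)
  show "grad ?G y = ?D y" using deriv by (rule grad_eqI)
qed

section \<open>Mollification\<close>

text \<open>
  The positive part of a polynomial is squared, which makes the kernel continuously differentiable across the circle of radius \<open>e\<close>.
\<close>

definition bump :: "real \<Rightarrow> real^2 \<Rightarrow> real" where
  "bump e x = (max 0 (e\<^sup>2 - x \<bullet> x))\<^sup>2"

definition mollifier :: "real \<Rightarrow> real^2 \<Rightarrow> real" where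
  "mollifier e x = bump e x / (LBINT y. bump e y)"

text \<open>
  Freezing a function on the negative half-line keeps it differentiable at 0 when value and derivative
  vanish there.
\<close>

lemma DERIV_compose_max_0:
  fixes F F' :: "real \<Rightarrow> real"
  assumes F: "\<And>t. (F has_real_derivative F' t) (at t)" and "F 0 = 0" "F' 0 = 0"
  shows "((\<lambda>t. F (max 0 t)) has_real_derivative F' (max 0 t)) (at t)"
proof (cases t "0::real" rule: linorder_cases)
  case less
  have "((\<lambda>t. 0) has_real_derivative 0) (at t)" by simp
  then have "((\<lambda>t. F (max 0 t)) has_real_derivative 0) (at t)"
    by (rule has_field_derivative_transform_within_open[where S="{..<0}"]) (use less assms in auto)
  with less assms show ?thesis by simp
next
  case greater
  have "((\<lambda>t. F (max 0 t)) has_real_derivative F' t) (at t)"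
    by (rule has_field_derivative_transform_within_open[OF F, where S="{0<..}"]) (use greater in auto)
  with greater show ?thesis by simp
next
  case equal
  have "((\<lambda>h. F h / h) \<longlongrightarrow> 0) (at 0)"
    using F[of 0] assms(2,3) by (simp add: DERIV_def)
  then have 0: "((\<lambda>h. \<bar>F h / h\<bar>) \<longlongrightarrow> 0) (at 0)" by (rule tendsto_rabs_zero)
  have "((\<lambda>h. F (max 0 h) / h) \<longlongrightarrow> 0) (at 0)"
    by (rule Lim_null_comparison[OF always_eventually 0]) (auto simp: max_def assms(2) divide_nonneg_neg not_le)
  then show ?thesis using equal assms by (simp add: DERIV_def)
qed

lemma DERIV_max_0_square: "((\<lambda>t. (max 0 t)\<^sup>2) has_real_derivative 2 * max 0 t) (at t)"
  by (rule DERIV_compose_max_0[of "\<lambda>t. t\<^sup>2" "\<lambda>t. 2 * t"]) (auto intro!: derivative_eq_intros)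

lemma C1_bump: "C1 (bump e)"
proof -
  have 1: "((\<lambda>x. e\<^sup>2 - x \<bullet> x) has_derivative (\<lambda>h. (- 2 *\<^sub>R x) \<bullet> h)) (at x)" for x :: "real^2"
    by (auto intro!: derivative_eq_intros simp: inner_commute)
  have "C1 (\<lambda>x::real^2. e\<^sup>2 - x \<bullet> x)"
    by (rule C1I[OF 1]) (auto intro!: continuous_intros)
  then show ?thesis
    unfolding bump_def by (rule C1_compose[OF _ DERIV_max_0_square]) (auto intro!: continuous_intros)
qed

lemma bump_nonneg: "0 \<le> bump e x" by (simp add: bump_def)

lemma bump_supported: "e > 0 \<Longrightarrow> supported_in (bump e) (cball 0 e)"
  by (auto simp: supported_in_def bump_def dot_square_norm intro!: power_mono)

lemma bump_integrable: "e > 0 \<Longrightarrow> integrable lborel (bump e)"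
  by (rule integrable_continuous_supported[OF C1_continuous[OF C1_bump] bump_supported])

text \<open>
  If the integral vanished, the disc on which the kernel is positive would be a null set.
\<close>

lemma bump_integral_pos:
  assumes "e > 0" shows "(LBINT y. bump e y) > 0"
proof -
  have "(LBINT y. bump e y) \<noteq> 0"
  proof
    assume "(LBINT y. bump e y) = 0"
    then have ae: "AE y in lborel. bump e y = 0"
      using integral_nonneg_eq_0_iff_AE[OF bump_integrable[OF assms]] bump_nonneg by auto
    have "bump e y \<noteq> 0" if "y \<in> ball 0 e" for y
    proof -
      have "(norm y)\<^sup>2 < e\<^sup>2" using that by (intro power_strict_mono) auto
      then show ?thesis by (simp add: bump_def dot_square_norm)
    qed
    with ae have "AE y in lborel. y \<notin> ball (0::real^2) e" by (auto elim!: eventually_mono)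
    then have "ball (0::real^2) e \<in> null_sets lborel"
      by (subst AE_iff_null_sets) auto
    then have "negligible (ball (0::real^2) e)"
      by (simp add: negligible_iff_null_sets null_sets_completionI)
    then show False using open_not_negligible[of "ball (0::real^2) e"] assms by auto
  qed
  moreover have "(LBINT y. bump e y) \<ge> 0" by (simp add: bump_nonneg)
  ultimately show ?thesis by linarith
qed

lemma C1_mollifier: "C1 (mollifier e)"
  using C1_cmult[OF C1_bump, of "1 / (LBINT y. bump e y)" e] by (simp add: mollifier_def[abs_def])

lemma mollifier_nonneg: "e > 0 \<Longrightarrow> 0 \<le> mollifier e x"
  using bump_integral_pos bump_nonneg by (simp add: mollifier_def less_imp_le)

lemma mollifier_supported: "e > 0 \<Longrightarrow> supported_in (mollifier e) (cball 0 e)"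
  using bump_supported[of e] by (simp add: supported_in_def mollifier_def)

lemma mollifier_eq_0: "e > 0 \<Longrightarrow> e < norm x \<Longrightarrow> mollifier e x = 0"
  using mollifier_supported[of e] by (auto simp: supported_in_def)

lemma mollifier_integrable: "e > 0 \<Longrightarrow> integrable lborel (mollifier e)"
  by (rule integrable_continuous_supported[OF C1_continuous[OF C1_mollifier] mollifier_supported])

lemma mollifier_integral: "e > 0 \<Longrightarrow> (LBINT x. mollifier e x) = 1"
  using bump_integral_pos[of e] by (simp add: mollifier_def)

lemma mollifier_measurable [measurable]: "mollifier e \<in> borel_measurable borel"
  by (rule borel_measurable_C1[OF C1_mollifier])

lemma mollifier_bounded:
  assumes "e > 0" obtains B where "B > 0" "\<And>x. \<bar>mollifier e x\<bar> \<le> B"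
  using supported_in_bounded[OF C1_continuous[OF C1_mollifier] mollifier_supported[OF assms]] by auto

definition smoothing :: "real \<Rightarrow> (real^2 \<Rightarrow> real) \<Rightarrow> real^2 \<Rightarrow> real" where
  "smoothing e w y = (LBINT x. w x * mollifier e (y - x))"

lemma C1_smoothing:
  assumes "e > 0" "integrable lborel w"
  shows "C1 (smoothing e w)"
  using C1_convolution[OF assms(2) _ C1_mollifier mollifier_supported[OF assms(1)], of uminus]
  unfolding smoothing_def[abs_def] by simp

lemma smoothing_integrable_kernel:
  assumes "e > 0" "integrable lborel w"
  shows "integrable lborel (\<lambda>x. w x * mollifier e (y - x))"
proof -
  obtain B where "\<And>x. \<bar>mollifier e x\<bar> \<le> B" using mollifier_bounded[OF assms(1)] by metis
  then show ?thesis by (intro integrable_mult_bounded[OF assms(2)]) auto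
qed

lemma smoothing_diff:
  assumes "e > 0" "integrable lborel v" "integrable lborel w"
  shows "smoothing e (\<lambda>x. v x - w x) y = smoothing e v y - smoothing e w y"
  unfolding smoothing_def left_diff_distrib
  by (intro Bochner_Integration.integral_diff smoothing_integrable_kernel assms)

text \<open>
  The value of the smoothed function at \<open>y\<close> is an average over the disc of radius \<open>e\<close> about \<open>y\<close>, so
  bounds that hold on this disc pass to it. This keeps the constraint on a cap intact, at the price of
  shrinking the cap slightly.
\<close>

lemma smoothing_le:
  assumes e: "e > 0" and w: "integrable lborel w" and M: "\<And>x. x \<in> cball y e \<Longrightarrow> w x \<le> M"
  shows "smoothing e w y \<le> M"
proof -
  have i: "integrable lborel (\<lambda>x. mollifier e (y - x))"
    using mollifier_integrable[OF e] by (simp add: lborel_integrable_reflect)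
  have "smoothing e w y \<le> (LBINT x. M * mollifier e (y - x))"
    unfolding smoothing_def
  proof (rule integral_mono)
    show "integrable lborel (\<lambda>x. w x * mollifier e (y - x))" by (rule smoothing_integrable_kernel[OF e w])
    show "integrable lborel (\<lambda>x. M * mollifier e (y - x))" using i by simp
    fix x show "w x * mollifier e (y - x) \<le> M * mollifier e (y - x)"
    proof (cases "x \<in> cball y e")
      case True
      then show ?thesis using M mollifier_nonneg[OF e] by (intro mult_right_mono) auto
    next
      case False
      then show ?thesis using mollifier_eq_0[OF e, of "y - x"] by (simp add: dist_norm)
    qed
  qed
  also have "\<dots> = M" using mollifier_integral[OF e] by (simp add: lborel_integral_reflect)
  finally show ?thesis .
qed

lemma smoothing_ge:
  assumes e: "e > 0" and w: "integrable lborel w" and M: "\<And>x. x \<in> cball y e \<Longrightarrow> M \<le> w x"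
  shows "M \<le> smoothing e w y"
proof -
  have "smoothing e (\<lambda>x. - w x) y \<le> - M"
    using w M by (intro smoothing_le[OF e]) auto
  then show ?thesis by (simp add: smoothing_def)
qed

text \<open>
  This is the integrability that justifies Fubini's theorem for smoothing.
\<close>

lemma smoothing_product_integrable:
  assumes e: "e > 0" and w: "integrable lborel w"
  shows "integrable (lborel \<Otimes>\<^sub>M lborel) (\<lambda>(x, y). w x * mollifier e (y - x))"
proof (rule lborel_pair.Fubini_integrable)
  have [measurable]: "w \<in> borel_measurable borel" using w by auto
  show "(\<lambda>(x, y). w x * mollifier e (y - x)) \<in> borel_measurable (lborel \<Otimes>\<^sub>M lborel)"
    by measurable
  have r: "(\<lambda>y. mollifier e (y - x)) = (\<lambda>y. mollifier e ((-x) + y))" for x by simp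
  have i: "integrable lborel (\<lambda>y. mollifier e (y - x))" for x
    unfolding r using mollifier_integrable[OF e] by (subst lborel_integrable_translate) auto
  have m: "(LBINT y. mollifier e (y - x)) = 1" for x
    unfolding r using mollifier_integral[OF e] by (subst lborel_integral_translate) auto
  have "(LBINT y. norm (case (x, y) of (x, y) \<Rightarrow> w x * mollifier e (y - x))) = \<bar>w x\<bar>" for x
    using m[of x] mollifier_nonneg[OF e] by (simp add: abs_mult)
  then show "integrable lborel (\<lambda>x. LBINT y. norm (case (x, y) of (x, y) \<Rightarrow> w x * mollifier e (y - x)))"
    using w by simp
  show "AE x in lborel. integrable lborel (\<lambda>y. case (x, y) of (x, y) \<Rightarrow> w x * mollifier e (y - x))"
    using i by simp
qed

lemma smoothing_integrable:
  assumes e: "e > 0" and w: "integrable lborel w"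
  shows "integrable lborel (smoothing e w)"
  using lborel_pair.integrable_snd[OF smoothing_product_integrable[OF assms]]
  by (simp add: smoothing_def[abs_def])

lemma smoothing_L1_le:
  assumes e: "e > 0" and w: "integrable lborel w"
  shows "(LBINT y. \<bar>smoothing e w y\<bar>) \<le> (LBINT y. \<bar>w y\<bar>)"
proof -
  have aw: "integrable lborel (\<lambda>x. \<bar>w x\<bar>)" using w by simp
  have "(LBINT y. \<bar>smoothing e w y\<bar>) \<le> (LBINT y. smoothing e (\<lambda>x. \<bar>w x\<bar>) y)"
  proof (rule integral_mono)
    fix y show "\<bar>smoothing e w y\<bar> \<le> smoothing e (\<lambda>x. \<bar>w x\<bar>) y"
      unfolding smoothing_def using mollifier_nonneg[OF e]
      by (intro abs_integral_le smoothing_integrable_kernel[OF e aw]) (simp add: abs_mult)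
  qed (use smoothing_integrable[OF e w] smoothing_integrable[OF e aw] in auto)
  also have "\<dots> = (LBINT x. (LBINT y. \<bar>w x\<bar> * mollifier e (y - x)))"
    unfolding smoothing_def by (rule lborel_pair.Fubini_integral[OF smoothing_product_integrable[OF e aw]])
  also have "\<dots> = (LBINT y. \<bar>w y\<bar>)"
  proof -
    have r: "(\<lambda>y. mollifier e (y - x)) = (\<lambda>y. mollifier e ((-x) + y))" for x by simp
    have m: "(LBINT y. mollifier e (y - x)) = 1" for x
      unfolding r using mollifier_integral[OF e] by (subst lborel_integral_translate) auto
    then show ?thesis by simp
  qed
  finally show ?thesis .
qed

text \<open>
  Fubini's theorem moves the smoothing from the function to the test function. Applied to the
  divergence of a field, it bounds the variation of a smoothed function by that of the function.
\<close>

lemma smoothing_adjoint: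
  assumes e: "e > 0" and w: "integrable lborel w"
    and d: "d \<in> borel_measurable borel" "\<And>x. \<bar>d x\<bar> \<le> B"
  shows "(LBINT y. smoothing e w y * d y) = (LBINT x. w x * (LBINT t. mollifier e t * d (x + t)))"
proof -
  have "integrable (lborel \<Otimes>\<^sub>M lborel) (\<lambda>(x, y). w x * mollifier e (y - x) * d y)"
    using integrable_mult_bounded[OF smoothing_product_integrable[OF e w], of "\<lambda>p. d (snd p)" B] d
    by (simp add: case_prod_beta')
  then have "(LBINT y. (LBINT x. w x * mollifier e (y - x) * d y))
     = (LBINT x. (LBINT y. w x * mollifier e (y - x) * d y))"
    by (rule lborel_pair.Fubini_integral)
  moreover have "(LBINT y. w x * mollifier e (y - x) * d y) = w x * (LBINT t. mollifier e t * d (x + t))" for x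
    using lborel_integral_translate[of "\<lambda>y. mollifier e (y - x) * d y" x] d(1)
    by (simp add: mult.assoc)
  ultimately show ?thesis by (simp add: smoothing_def)
qed

text \<open>
  A measurable function is almost everywhere the limit of continuous functions \<open>g n\<close>, but without a
  dominating function. Truncating the values to \<open>[-k, k]\<close> by \<open>T k\<close> and the support by the cut-off
  \<open>\<theta> k\<close> provides one, and neither truncation changes \<open>w\<close> much once \<open>k\<close> is large.
\<close>

lemma L1_approx_continuous:
  fixes w :: "real^2 \<Rightarrow> real"
  assumes w: "integrable lborel w" and "\<epsilon> > 0"
  obtains c K where "continuous_on UNIV c" "supported_in c K" "(LBINT x. \<bar>w x - c x\<bar>) < \<epsilon>"
proof -
  have [measurable]: "w \<in> borel_measurable borel" using w by auto
  have "w \<in> borel_measurable lebesgue" by (intro measurable_completion) simp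
  then have "w measurable_on UNIV" by (intro lebesgue_measurable_imp_measurable_on) auto
  then obtain N g where N: "negligible N" and g: "\<And>n. continuous_on UNIV (g n)"
    and lim: "\<And>x. x \<notin> N \<Longrightarrow> (\<lambda>n. g n x) \<longlonglongrightarrow> w x"
    unfolding measurable_on_def by auto
  have "AE x in lebesgue. x \<notin> N"
    using N by (intro AE_not_in) (simp add: negligible_iff_null_sets)
  then have ae: "AE x in lborel. x \<notin> N" by (simp add: AE_completion_iff)
  have [measurable]: "g n \<in> borel_measurable borel" for n
    by (rule borel_measurable_continuous_onI[OF g])
  define \<theta> where "\<theta> = (\<lambda>k (x::real^2). max 0 (min 1 (real k + 1 - norm x)))"
  have \<theta>: "0 \<le> \<theta> k x" "\<theta> k x \<le> 1" for k x by (auto simp: \<theta>_def)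
  have \<theta>_cont: "continuous_on UNIV (\<theta> k)" for k
    unfolding \<theta>_def by (intro continuous_intros)
  have \<theta>_supp: "supported_in (\<theta> k) (cball 0 (real k + 1))" for k
    by (auto simp: supported_in_def \<theta>_def)
  have [measurable]: "\<theta> k \<in> borel_measurable borel" for k
    by (rule borel_measurable_continuous_onI[OF \<theta>_cont])
  define T where "T = (\<lambda>k t. max (- real k) (min (real k) t))"
  have T: "\<bar>T k t\<bar> \<le> real k" "\<bar>T k t\<bar> \<le> \<bar>t\<bar>" for k t by (auto simp: T_def)
  have Tm [measurable]: "T k \<in> borel_measurable borel" for k unfolding T_def by measurable
  have "(\<lambda>k. LBINT x. \<bar>w x - T k (w x) * \<theta> k x\<bar>) \<longlonglongrightarrow> (\<integral>x. 0 \<partial>(lborel :: (real^2) measure))"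
  proof (rule integral_dominated_convergence[where w="\<lambda>x. 2 * \<bar>w x\<bar>"])
    show "AE x in lborel. (\<lambda>k. \<bar>w x - T k (w x) * \<theta> k x\<bar>) \<longlonglongrightarrow> 0"
    proof (rule AE_I2)
      fix x
      obtain k0 where k0: "real k0 \<ge> \<bar>w x\<bar>" "real k0 \<ge> norm x"
        by (metis max.bounded_iff real_arch_simple)
      have "T k (w x) * \<theta> k x = w x" if "k \<ge> k0" for k
      proof -
        have "real k \<ge> \<bar>w x\<bar>" "real k \<ge> norm x" using k0 that by auto
        then show ?thesis by (simp add: T_def \<theta>_def)
      qed
      then have "\<forall>\<^sub>F k in sequentially. \<bar>w x - T k (w x) * \<theta> k x\<bar> = 0"
        by (intro eventually_sequentiallyI[of k0]) simp
      then show "(\<lambda>k. \<bar>w x - T k (w x) * \<theta> k x\<bar>) \<longlonglongrightarrow> 0" by (rule tendsto_eventually)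
    qed
    show "AE x in lborel. norm \<bar>w x - T k (w x) * \<theta> k x\<bar> \<le> 2 * \<bar>w x\<bar>" for k
    proof (rule AE_I2)
      fix x
      have "\<bar>T k (w x) * \<theta> k x\<bar> \<le> \<bar>w x\<bar> * 1"
        unfolding abs_mult using T(2) \<theta> by (intro mult_mono) auto
      then show "norm \<bar>w x - T k (w x) * \<theta> k x\<bar> \<le> 2 * \<bar>w x\<bar>" by simp
    qed
  qed (use w in auto)
  then have "\<forall>\<^sub>F k in sequentially. (LBINT x. \<bar>w x - T k (w x) * \<theta> k x\<bar>) < \<epsilon> / 2"
    using order_tendstoD(2)[of _ 0 _ "\<epsilon>/2"] \<open>\<epsilon> > 0\<close> by simp
  then obtain k where k: "(LBINT x. \<bar>w x - T k (w x) * \<theta> k x\<bar>) < \<epsilon> / 2"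
    unfolding eventually_sequentially by blast
  have \<theta>_int: "integrable lborel (\<theta> k)"
    by (rule integrable_continuous_supported[OF \<theta>_cont \<theta>_supp])
  have b: "\<bar>T k t * \<theta> k x\<bar> \<le> real k * \<theta> k x" for t x
    unfolding abs_mult using T(1) \<theta> by (intro mult_mono) auto
  have iT: "integrable lborel (\<lambda>x. T k (f x) * \<theta> k x)" if [measurable]: "f \<in> borel_measurable borel" for f
    by (rule Bochner_Integration.integrable_bound[where f="\<lambda>x. real k * \<theta> k x"])
       (use \<theta>_int b \<theta> in \<open>auto simp: abs_mult intro!: mult_right_mono\<close>)
  have "(\<lambda>n. LBINT x. \<bar>T k (w x) * \<theta> k x - T k (g n x) * \<theta> k x\<bar>) \<longlonglongrightarrow> (\<integral>x. 0 \<partial>(lborel :: (real^2) measure))"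
  proof (rule integral_dominated_convergence[where w="\<lambda>x. 2 * (real k * \<theta> k x)"])
    show "AE x in lborel. (\<lambda>n. \<bar>T k (w x) * \<theta> k x - T k (g n x) * \<theta> k x\<bar>) \<longlonglongrightarrow> 0"
      using ae
    proof eventually_elim
      fix x assume "x \<notin> N"
      have "(\<lambda>n. \<bar>T k (w x) * \<theta> k x - T k (g n x) * \<theta> k x\<bar>) \<longlonglongrightarrow> \<bar>T k (w x) * \<theta> k x - T k (w x) * \<theta> k x\<bar>"
        unfolding T_def by (intro tendsto_intros lim[OF \<open>x \<notin> N\<close>])
      then show "(\<lambda>n. \<bar>T k (w x) * \<theta> k x - T k (g n x) * \<theta> k x\<bar>) \<longlonglongrightarrow> 0" by simp
    qed
    show "AE x in lborel. norm \<bar>T k (w x) * \<theta> k x - T k (g n x) * \<theta> k x\<bar> \<le> 2 * (real k * \<theta> k x)" for n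
    proof (rule AE_I2)
      fix x show "norm \<bar>T k (w x) * \<theta> k x - T k (g n x) * \<theta> k x\<bar> \<le> 2 * (real k * \<theta> k x)"
        using b[of "w x" x] b[of "g n x" x] unfolding real_norm_def by linarith
    qed
  qed (use \<theta>_int in auto)
  then have "\<forall>\<^sub>F n in sequentially. (LBINT x. \<bar>T k (w x) * \<theta> k x - T k (g n x) * \<theta> k x\<bar>) < \<epsilon> / 2"
    using order_tendstoD(2)[of _ 0 _ "\<epsilon>/2"] \<open>\<epsilon> > 0\<close> by simp
  then obtain n where n: "(LBINT x. \<bar>T k (w x) * \<theta> k x - T k (g n x) * \<theta> k x\<bar>) < \<epsilon> / 2"
    unfolding eventually_sequentially by blast
  let ?c = "\<lambda>x. T k (g n x) * \<theta> k x"
  show thesis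
  proof
    show "continuous_on UNIV ?c"
      unfolding T_def by (intro continuous_intros g \<theta>_cont)
    show "supported_in ?c (cball 0 (real k + 1))"
      using \<theta>_supp[of k] by (auto simp: supported_in_def)
    have "(LBINT x. \<bar>w x - ?c x\<bar>) \<le> (LBINT x. \<bar>w x - T k (w x) * \<theta> k x\<bar> + \<bar>T k (w x) * \<theta> k x - ?c x\<bar>)"
      using w iT by (intro integral_mono) auto
    also have "\<dots> = (LBINT x. \<bar>w x - T k (w x) * \<theta> k x\<bar>) + (LBINT x. \<bar>T k (w x) * \<theta> k x - ?c x\<bar>)"
      using w iT by (intro Bochner_Integration.integral_add) auto
    also have "\<dots> < \<epsilon>" using k n by simp
    finally show "(LBINT x. \<bar>w x - ?c x\<bar>) < \<epsilon>" .
  qed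
qed

text \<open>
  For a continuous function of compact support the convergence follows from uniform continuity. It
  extends to all integrable functions because smoothing is a contraction in \<open>L\<^sup>1\<close>.
\<close>

lemma smoothing_tendsto_L1:
  assumes w: "integrable lborel w"
  shows "((\<lambda>e. LBINT y. \<bar>smoothing e w y - w y\<bar>) \<longlongrightarrow> 0) (at_right 0)"
proof (rule tendstoI)
  fix \<epsilon> :: real assume "\<epsilon> > 0"
  obtain c K where c: "continuous_on UNIV c" "supported_in c K"
    and wc: "(LBINT x. \<bar>w x - c x\<bar>) < \<epsilon> / 4"
    using L1_approx_continuous[OF w, of "\<epsilon> / 4"] \<open>\<epsilon> > 0\<close> by auto
  have ci: "integrable lborel c" by (rule integrable_continuous_supported[OF c])
  obtain R where R: "K \<subseteq> ball 0 R" and "R > 0"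
    by (metis bounded_subset_ballD compact_imp_bounded supported_in_def c(2))
  let ?B = "cball (0::real^2) (R + 1)"
  define A where "A = measure lborel ?B"
  have "A \<ge> 0" by (simp add: A_def)
  define \<tau> where "\<tau> = \<epsilon> / (4 * (1 + A))"
  have "\<tau> > 0" "\<tau> * A \<le> \<epsilon> / 4" using \<open>\<epsilon> > 0\<close> \<open>A \<ge> 0\<close> by (auto simp: \<tau>_def field_simps)
  obtain d where d: "d > 0" "\<And>x y. dist y x < d \<Longrightarrow> dist (c y) (c x) < \<tau>"
    using supported_in_uniformly_continuous[OF c] \<open>\<tau> > 0\<close>
    unfolding uniformly_continuous_on_def by (metis UNIV_I)
  have "dist (LBINT y. \<bar>smoothing e w y - w y\<bar>) 0 < \<epsilon>" if e: "0 < e" "e < min d 1" for e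
  proof -
    have cc: "\<bar>smoothing e c y - c y\<bar> \<le> \<tau> * indicator ?B y" for y
    proof (cases "y \<in> ?B")
      case True
      have near: "\<bar>c x - c y\<bar> < \<tau>" if "x \<in> cball y e" for x
        using d(2)[of x y] that e by (simp add: dist_commute dist_real_def)
      have "smoothing e c y \<le> c y + \<tau>"
        using near by (intro smoothing_le[OF e(1) ci]) (smt (verit))
      moreover have "c y - \<tau> \<le> smoothing e c y"
        using near by (intro smoothing_ge[OF e(1) ci]) (smt (verit))
      ultimately show ?thesis using True by (simp add: abs_le_iff)
    next
      case False
      have z: "c x = 0" if "x \<in> cball y e" for x
      proof -
        have "norm y \<le> norm x + dist y x" by (metis dist_norm norm_triangle_sub)
        then have "x \<notin> ball 0 R" using False e that by auto
        then show ?thesis using R c(2) by (auto simp: supported_in_def)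
      qed
      have "smoothing e c y \<le> 0" using z by (intro smoothing_le[OF e(1) ci]) simp
      moreover have "0 \<le> smoothing e c y" using z by (intro smoothing_ge[OF e(1) ci]) simp
      moreover have "c y = 0" using z[of y] e by simp
      ultimately show ?thesis using False by simp
    qed
    have wci: "integrable lborel (\<lambda>x. w x - c x)" using w ci by simp
    have swc: "smoothing e w y - smoothing e c y = smoothing e (\<lambda>x. w x - c x) y" for y
      by (simp add: smoothing_diff[OF e(1) w ci])
    note si = smoothing_integrable[OF e(1)]
    have indi: "integrable lborel (indicator ?B :: _ \<Rightarrow> real)"
      by (rule integrable_real_indicator) (use emeasure_bounded_finite[OF bounded_cball] in \<open>auto simp: less_top\<close>)
    have "(LBINT y. \<bar>smoothing e w y - w y\<bar>)
      \<le> (LBINT y. \<bar>smoothing e (\<lambda>x. w x - c x) y\<bar> + (\<tau> * indicator ?B y + \<bar>w y - c y\<bar>))"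
    proof (rule integral_mono)
      show "integrable lborel (\<lambda>y. \<bar>smoothing e w y - w y\<bar>)" using si[OF w] w by simp
      show "integrable lborel (\<lambda>y. \<bar>smoothing e (\<lambda>x. w x - c x) y\<bar> + (\<tau> * indicator ?B y + \<bar>w y - c y\<bar>))"
        using si[OF wci] wci indi by simp
      fix y show "\<bar>smoothing e w y - w y\<bar> \<le> \<bar>smoothing e (\<lambda>x. w x - c x) y\<bar> + (\<tau> * indicator ?B y + \<bar>w y - c y\<bar>)"
        using cc[of y] swc[of y] by linarith
    qed
    also have "\<dots> = (LBINT y. \<bar>smoothing e (\<lambda>x. w x - c x) y\<bar>) + (\<tau> * A + (LBINT y. \<bar>w y - c y\<bar>))"
      using si[OF wci] wci indi by (simp add: A_def)
    also have "\<dots> \<le> (LBINT y. \<bar>w y - c y\<bar>) + (\<tau> * A + (LBINT y. \<bar>w y - c y\<bar>))"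
      using smoothing_L1_le[OF e(1) wci] by simp
    also have "\<dots> < \<epsilon>" using wc \<open>\<tau> * A \<le> \<epsilon> / 4\<close> \<open>\<epsilon> > 0\<close> by linarith
    finally show ?thesis by (simp add: dist_real_def)
  qed
  then show "\<forall>\<^sub>F e in at_right 0. dist (LBINT y. \<bar>smoothing e w y - w y\<bar>) 0 < \<epsilon>"
    unfolding eventually_at_right_field using d(1) by (intro exI[of _ "min d 1"]) simp
qed

section \<open>The Wulff shape and the anisotropic total variation\<close>

text \<open>
  The unit ball of the polar norm, described by linear inequalities so that no supremum is involved.
\<close>

definition wulff :: "(real^2 \<Rightarrow> real) \<Rightarrow> (real^2) set" where
  "wulff \<phi> = {\<eta>. \<forall>\<xi>. \<eta> \<bullet> \<xi> \<le> \<phi> \<xi>}"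

lemma metric_integrandE:
  assumes "metric_integrand \<phi>"
  obtains l \<Gamma> where "l > 0" "\<Gamma> > 0" "\<And>\<xi>. l * norm \<xi> \<le> \<phi> \<xi>" "\<And>\<xi>. \<phi> \<xi> \<le> \<Gamma> * norm \<xi>"
    "\<And>t \<xi>. \<phi> (t *\<^sub>R \<xi>) = \<bar>t\<bar> * \<phi> \<xi>" "\<And>\<xi>. 0 \<le> \<phi> \<xi>" "convex_on UNIV \<phi>"
  using assms unfolding metric_integrand_def by metis

lemma metric_integrand_pos:
  assumes "metric_integrand \<phi>" "\<xi> \<noteq> 0" shows "\<phi> \<xi> > 0"
proof -
  obtain l where "l > 0" "l * norm \<xi> \<le> \<phi> \<xi>" using assms(1) by (metis metric_integrandE)
  moreover have "l * norm \<xi> > 0" using \<open>l > 0\<close> assms(2) by simp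
  ultimately show ?thesis by linarith
qed

lemma metric_integrand_0: "metric_integrand \<phi> \<Longrightarrow> \<phi> 0 = 0"
  by (metis abs_zero metric_integrandE mult_zero_left scaleR_zero_left)

lemma wulff_0: "metric_integrand \<phi> \<Longrightarrow> 0 \<in> wulff \<phi>"
  by (auto simp: wulff_def elim: metric_integrandE)

lemma wulff_convex: "a \<in> wulff \<phi> \<Longrightarrow> b \<in> wulff \<phi> \<Longrightarrow> 0 \<le> s \<Longrightarrow> s \<le> 1 \<Longrightarrow> (1 - s) *\<^sub>R a + s *\<^sub>R b \<in> wulff \<phi>"
  unfolding wulff_def using convex_bound_le[of _ _ _ "1 - s" s] by (auto simp: inner_add_left)

lemma wulff_scale: "metric_integrand \<phi> \<Longrightarrow> a \<in> wulff \<phi> \<Longrightarrow> 0 \<le> s \<Longrightarrow> s \<le> 1 \<Longrightarrow> s *\<^sub>R a \<in> wulff \<phi>"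
  using wulff_convex[OF wulff_0, of \<phi> a s] by simp

lemma wulff_uminus:
  assumes "metric_integrand \<phi>" "a \<in> wulff \<phi>" shows "- a \<in> wulff \<phi>"
proof -
  have "\<phi> (- \<xi>) = \<phi> \<xi>" for \<xi>
    using assms(1) by (metis abs_minus_cancel abs_one metric_integrandE mult_1 scaleR_minus1_left)
  moreover have "a \<bullet> (- \<xi>) \<le> \<phi> (- \<xi>)" for \<xi> using assms(2) unfolding wulff_def by blast
  ultimately show ?thesis by (simp add: wulff_def)
qed

lemma wulff_norm_le:
  assumes "metric_integrand \<phi>"
  obtains R where "R > 0" "\<And>a. a \<in> wulff \<phi> \<Longrightarrow> norm a \<le> R"
proof -
  obtain \<Gamma> where \<Gamma>: "\<Gamma> > 0" "\<And>\<xi>. \<phi> \<xi> \<le> \<Gamma> * norm \<xi>" using assms by (metis metric_integrandE)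
  have "norm a \<le> \<Gamma>" if "a \<in> wulff \<phi>" for a
  proof (cases "a = 0")
    case False
    have "norm a * norm a \<le> \<Gamma> * norm a"
      using that \<Gamma>(2)[of a] unfolding wulff_def
      by (metis (mono_tags, lifting) dot_square_norm mem_Collect_eq order_trans power2_eq_square)
    then show ?thesis using False by simp
  qed (use \<Gamma>(1) in simp)
  with \<Gamma>(1) that show ?thesis by blast
qed

lemma closed_wulff: "closed (wulff \<phi>)"
proof -
  have "wulff \<phi> = (\<Inter>\<xi>. {\<eta>. \<xi> \<bullet> \<eta> \<le> \<phi> \<xi>})" by (auto simp: wulff_def inner_commute)
  then show ?thesis by (auto intro: closed_halfspace_le)
qed

lemma polar_le_1_iff:
  assumes "metric_integrand \<phi>"
  shows "polar \<phi> \<eta> \<le> 1 \<longleftrightarrow> \<eta> \<in> wulff \<phi>"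
proof
  obtain l \<Gamma> where l: "l > 0" and le: "\<And>\<xi>. l * norm \<xi> \<le> \<phi> \<xi>"
    and hom: "\<And>t \<xi>. \<phi> (t *\<^sub>R \<xi>) = \<bar>t\<bar> * \<phi> \<xi>" by (metis assms metric_integrandE)
  have bdd: "bdd_above ((\<lambda>\<xi>. \<eta> \<bullet> \<xi>) ` {\<xi>. \<phi> \<xi> \<le> 1})"
  proof (rule bdd_aboveI2)
    fix \<xi> assume "\<xi> \<in> {\<xi>. \<phi> \<xi> \<le> 1}"
    then have "l * norm \<xi> \<le> 1" using le[of \<xi>] by simp
    then have "norm \<xi> \<le> 1 / l" using l by (simp add: field_simps)
    then show "\<eta> \<bullet> \<xi> \<le> norm \<eta> * (1 / l)"
      by (meson mult_left_mono norm_cauchy_schwarz norm_ge_zero order_trans)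
  qed
  show "\<eta> \<in> wulff \<phi>" if p: "polar \<phi> \<eta> \<le> 1"
    unfolding wulff_def
  proof (intro CollectI allI)
    fix \<xi> show "\<eta> \<bullet> \<xi> \<le> \<phi> \<xi>"
    proof (cases "\<xi> = 0")
      case False
      then have pos: "\<phi> \<xi> > 0" by (rule metric_integrand_pos[OF assms])
      have "\<phi> ((1 / \<phi> \<xi>) *\<^sub>R \<xi>) \<le> 1" using pos by (simp add: hom)
      then have "\<eta> \<bullet> ((1 / \<phi> \<xi>) *\<^sub>R \<xi>) \<le> polar \<phi> \<eta>"
        unfolding polar_def using bdd by (intro cSUP_upper) auto
      with p have "(\<eta> \<bullet> \<xi>) / \<phi> \<xi> \<le> 1" by simp
      with pos show ?thesis by (simp add: field_simps)
    qed (use metric_integrand_0[OF assms] in simp)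
  qed
  show "polar \<phi> \<eta> \<le> 1" if "\<eta> \<in> wulff \<phi>"
    unfolding polar_def
  proof (rule cSUP_least)
    show "{\<xi>. \<phi> \<xi> \<le> 1} \<noteq> {}" using metric_integrand_0[OF assms] by (auto intro: exI[of _ 0])
    show "\<eta> \<bullet> \<xi> \<le> 1" if "\<xi> \<in> {\<xi>. \<phi> \<xi> \<le> 1}" for \<xi>
      using that \<open>\<eta> \<in> wulff \<phi>\<close> unfolding wulff_def by (auto intro: order_trans)
  qed
qed

text \<open>
  The Hahn-Banach theorem in the plane: a line through \<open>n\<close> that avoids the open ball
  \<open>{\<xi>. \<phi> \<xi> < \<phi> n}\<close> has a normal vector which, suitably scaled, lies in the Wulff shape. The
  constant field \<open>z\<close> then calibrates the lines with normal \<open>n\<close>.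
\<close>

lemma wulff_support:
  assumes "metric_integrand \<phi>"
  obtains z where "z \<in> wulff \<phi>" "z \<bullet> n = \<phi> n"
proof (cases "n = 0")
  case True
  then show ?thesis using that[OF wulff_0[OF assms]] metric_integrand_0[OF assms] by simp
next
  case False
  have cvx: "convex_on UNIV \<phi>" and hom: "\<And>t \<xi>. \<phi> (t *\<^sub>R \<xi>) = \<bar>t\<bar> * \<phi> \<xi>"
    using assms by (metis metric_integrandE)+
  have pn: "\<phi> n > 0" using metric_integrand_pos[OF assms False] .
  let ?S = "{\<xi>. \<phi> \<xi> < \<phi> n}"
  have "convex ?S"
  proof (rule convexI)
    fix x y and u v :: real assume "x \<in> ?S" "y \<in> ?S" "0 \<le> u" "0 \<le> v" "u + v = 1"
    moreover from this have "\<phi> (u *\<^sub>R x + v *\<^sub>R y) \<le> u * \<phi> x + v * \<phi> y"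
      using cvx unfolding convex_on_def by blast
    ultimately show "u *\<^sub>R x + v *\<^sub>R y \<in> ?S"
      using convex_bound_lt[of "\<phi> x" "\<phi> n" "\<phi> y" u v] by simp
  qed
  moreover have "0 \<in> ?S" using pn metric_integrand_0[OF assms] by simp
  ultimately obtain a b where "a \<noteq> 0" and a: "\<And>x. x \<in> ?S \<Longrightarrow> a \<bullet> x \<le> b" "b \<le> a \<bullet> n"
    using separating_hyperplane_sets[of ?S "{n}"] by auto
  have key: "\<phi> n * (a \<bullet> \<xi>) \<le> (a \<bullet> n) * \<phi> \<xi>" for \<xi>
  proof (cases "\<xi> = 0")
    case False
    then have p: "\<phi> \<xi> > 0" by (rule metric_integrand_pos[OF assms])
    have "\<phi> n / \<phi> \<xi> * (a \<bullet> \<xi>) \<le> a \<bullet> n"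
    \<comment> \<open>The separation is known on the open ball only, whence the factor \<open>t < 1\<close>.\<close>
    proof (rule field_le_mult_one_interval)
      fix t :: real assume t: "0 < t" "t < 1"
      have "\<phi> ((t * \<phi> n / \<phi> \<xi>) *\<^sub>R \<xi>) = t * \<phi> n" using t p pn by (simp add: hom)
      also have "\<dots> < \<phi> n" using t pn by simp
      finally have "a \<bullet> ((t * \<phi> n / \<phi> \<xi>) *\<^sub>R \<xi>) \<le> a \<bullet> n" using a by force
      then show "t * (\<phi> n / \<phi> \<xi> * (a \<bullet> \<xi>)) \<le> a \<bullet> n" by simp
    qed
    with p show ?thesis by (simp add: field_simps)
  qed (use metric_integrand_0[OF assms] in simp)
  have "\<phi> n * (a \<bullet> a) > 0" using pn \<open>a \<noteq> 0\<close> by simp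
  with key[of a] have "(a \<bullet> n) * \<phi> a > 0" by linarith
  then have an: "a \<bullet> n > 0" using metric_integrand_pos[OF assms \<open>a \<noteq> 0\<close>] by (simp add: zero_less_mult_iff)
  show ?thesis
  proof (rule that)
    show "(\<phi> n / (a \<bullet> n)) *\<^sub>R a \<in> wulff \<phi>"
      using key an by (auto simp: wulff_def field_simps)
    show "((\<phi> n / (a \<bullet> n)) *\<^sub>R a) \<bullet> n = \<phi> n" using an by simp
  qed
qed

text \<open>
  The fields over which the total variation is a supremum, normalised to be smooth on the whole plane
  and to satisfy the constraint everywhere.
\<close>

definition admissible :: "(real^2 \<Rightarrow> real) \<Rightarrow> (real^2) set \<Rightarrow> (real^2 \<Rightarrow> real^2) set" where
  "admissible \<phi> \<Omega> = {z. C1_field z \<and> (\<exists>K\<subseteq>\<Omega>. supported_in z K) \<and> (\<forall>x. z x \<in> wulff \<phi>)}"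

lemma C1_field_in_C1c_fields:
  assumes "C1_field z" "supported_in z K" "K \<subseteq> \<Omega>"
  shows "z \<in> C1c_fields \<Omega>"
proof -
  let ?d = "\<lambda>x h. \<chi> i. grad (\<lambda>y. z y $ i) x \<bullet> h"
  have bl: "bounded_linear (?d x)" for x
    using C1_field_has_derivative[OF assms(1)] has_derivative_bounded_linear by blast
  have "continuous_on \<Omega> (\<lambda>x. Blinfun (?d x))"
  proof (rule continuous_on_blinfun_componentwise)
    fix i :: "real^2"
    have "continuous_on \<Omega> (\<lambda>x. \<chi> k. grad (\<lambda>y. z y $ k) x \<bullet> i)"
      using assms(1) by (intro continuous_on_vec_lambda continuous_intros C1_continuous_grad) (auto simp: C1_field_def)
    then show "continuous_on \<Omega> (\<lambda>x. blinfun_apply (Blinfun (?d x)) i)"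
      by (simp add: bounded_linear_Blinfun_apply[OF bl])
  qed
  then have "continuous_on \<Omega> (\<lambda>x. Blinfun (?d x)) \<and>
      (\<forall>x\<in>\<Omega>. (z has_derivative blinfun_apply (Blinfun (?d x))) (at x))"
    using C1_field_has_derivative[OF assms(1)] by (simp add: bounded_linear_Blinfun_apply[OF bl])
  with assms(2,3) show ?thesis unfolding C1c_fields_def supported_in_def by blast
qed

text \<open>
  A test field is smooth near the points of \<open>\<Omega>\<close> and vanishes on \<open>\<Omega> - K\<close>. The open sets \<open>\<Omega>\<close> and
  \<open>- K\<close> cover the plane, and replacing the values off \<open>\<Omega>\<close> by zero gives a smooth field.
\<close>

lemma C1c_fields_extend:
  assumes "open \<Omega>" "z \<in> C1c_fields \<Omega>"
  obtains y K where "C1_field y" "K \<subseteq> \<Omega>" "supported_in y K" "\<And>x. x \<in> \<Omega> \<Longrightarrow> y x = z x"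
    "\<And>x. x \<in> \<Omega> \<Longrightarrow> div_field y x = div_field z x"
proof -
  obtain z' :: "real^2 \<Rightarrow> (real^2) \<Rightarrow>\<^sub>L (real^2)" and K where z': "continuous_on \<Omega> z'"
      "\<And>x. x \<in> \<Omega> \<Longrightarrow> (z has_derivative blinfun_apply (z' x)) (at x)"
    and K: "compact K" "K \<subseteq> \<Omega>" "\<And>x. x \<in> \<Omega> - K \<Longrightarrow> z x = 0"
    using assms(2) unfolding C1c_fields_def by blast
  define y where "y = (\<lambda>x. if x \<in> \<Omega> then z x else 0)"
  have oK: "open (- K)" using K(1) by (simp add: compact_imp_closed open_Compl)
  have y0: "y x = 0" if "x \<notin> K" for x using that K(3) by (auto simp: y_def)
  have dy: "(y has_derivative blinfun_apply (z' x)) (at x)" if "x \<in> \<Omega>" for x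
    by (rule has_derivative_transform_within_open[OF z'(2)[OF that] assms(1) that]) (simp add: y_def)
  have dy0: "(y has_derivative (\<lambda>h. 0)) (at x)" if "x \<notin> K" for x
    by (rule has_derivative_transform_within_open[of "\<lambda>x. 0", OF _ oK]) (use that y0 in auto)
  have z'0: "blinfun_apply (z' x) = (\<lambda>h. 0)" if "x \<in> \<Omega>" "x \<notin> K" for x
    using has_derivative_unique[OF dy[OF that(1)] dy0[OF that(2)]] .
  define G where "G = (\<lambda>i x. if x \<in> \<Omega> then (\<chi> j. blinfun_apply (z' x) (axis j 1) $ i) else (0::real^2))"
  have G0: "G i x = 0" if "x \<notin> K" for i x
    using z'0[of x] that by (auto simp: G_def vec_eq_iff)
  have dG: "((\<lambda>x. y x $ i) has_derivative (\<lambda>h. G i x \<bullet> h)) (at x)" for i x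
  proof (cases "x \<in> \<Omega>")
    case True
    have lin: "linear (\<lambda>h. blinfun_apply (z' x) h $ i)"
      by (intro bounded_linear.linear bounded_linear_compose[OF bounded_linear_vec_nth] blinfun.bounded_linear_right)
    have "((\<lambda>x. y x $ i) has_derivative (\<lambda>h. blinfun_apply (z' x) h $ i)) (at x)"
      by (rule bounded_linear.has_derivative[OF bounded_linear_vec_nth dy[OF True]])
    moreover have "(\<lambda>h. blinfun_apply (z' x) h $ i) = (\<lambda>h. G i x \<bullet> h)"
      unfolding G_def if_P[OF True] by (rule ext) (rule linear_inner_representation[OF lin])
    ultimately show ?thesis by simp
  next
    case False
    then have "x \<notin> K" using K(2) by blast
    have "((\<lambda>x. y x $ i) has_derivative (\<lambda>h. 0 $ i)) (at x)"
      by (rule bounded_linear.has_derivative[OF bounded_linear_vec_nth dy0[OF \<open>x \<notin> K\<close>]])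
    then show ?thesis using False by (simp add: G_def)
  qed
  have "continuous_on UNIV (G i)" for i
  proof -
    have "continuous_on \<Omega> (\<lambda>x. \<chi> j. blinfun_apply (z' x) (axis j 1) $ i)"
      using z'(1) by (intro continuous_on_vec_lambda continuous_intros)
    then have 1: "continuous_on \<Omega> (G i)" by (rule continuous_on_eq) (simp add: G_def)
    have 2: "continuous_on (- K) (G i)"
      by (rule continuous_on_eq[of _ "\<lambda>x. 0"]) (auto simp: G0)
    have "\<Omega> \<union> - K = UNIV" using K(2) by blast
    then show ?thesis using continuous_on_open_Un[OF assms(1) oK 1 2] by simp
  qed
  then have C: "C1_field y" unfolding C1_field_def using C1I[OF dG] by blast
  show ?thesis
  proof (rule that)
    show "supported_in y K" using K(1) y0 by (simp add: supported_in_def)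
    show "div_field y x = div_field z x" if "x \<in> \<Omega>" for x
      unfolding div_field_def
      by (simp flip: frechet_derivative_at[OF dy[OF that]] frechet_derivative_at[OF z'(2)[OF that]])
  qed (use C K in \<open>auto simp: y_def\<close>)
qed

lemma AE_lebesgue_on_iff:
  "open \<Omega> \<Longrightarrow> (AE x in lebesgue_on \<Omega>. P x) \<longleftrightarrow> (AE x in lebesgue. x \<in> \<Omega> \<longrightarrow> P x)"
  by (rule AE_restrict_space_iff) simp

lemma open_AE_imp_all:
  fixes z :: "real^2 \<Rightarrow> real^2"
  assumes "open \<Omega>" "continuous_on \<Omega> z" "closed C" "AE x in lebesgue_on \<Omega>. z x \<in> C" "x \<in> \<Omega>"
  shows "z x \<in> C"
proof (rule ccontr)
  assume "z x \<notin> C"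
  define U where "U = \<Omega> \<inter> z -` (- C)"
  have "open U" unfolding U_def
    using assms(1,2,3) by (simp add: continuous_on_open_vimage Int_commute open_Compl)
  have "AE x in lebesgue. x \<notin> U"
    using assms(4) unfolding AE_lebesgue_on_iff[OF assms(1)]
    by eventually_elim (auto simp: U_def)
  then have "U \<in> null_sets lebesgue"
    using \<open>open U\<close> by (subst AE_iff_null_sets) auto
  then have "negligible U" by (simp add: negligible_iff_null_sets)
  then have "U = {}" using open_not_negligible[OF \<open>open U\<close>] by blast
  then show False using \<open>z x \<notin> C\<close> assms(5) by (auto simp: U_def)
qed

lemma total_variation_eq_SUP_admissible:
  assumes "open \<Omega>" "metric_integrand \<phi>"
  shows "total_variation \<phi> \<Omega> u = (SUP z\<in>admissible \<phi> \<Omega>. ereal (LINT x|lebesgue_on \<Omega>. u x * div_field z x))"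
  unfolding total_variation_def polar_le_1_iff[OF assms(2)]
proof (rule antisym)
  show "(SUP z\<in>{z \<in> C1c_fields \<Omega>. AE x in lebesgue_on \<Omega>. z x \<in> wulff \<phi>}. ereal (LINT x|lebesgue_on \<Omega>. u x * div_field z x))
     \<le> (SUP z\<in>admissible \<phi> \<Omega>. ereal (LINT x|lebesgue_on \<Omega>. u x * div_field z x))"
  proof (rule SUP_least)
    fix z assume z: "z \<in> {z \<in> C1c_fields \<Omega>. AE x in lebesgue_on \<Omega>. z x \<in> wulff \<phi>}"
    then obtain y K where y: "C1_field y" "K \<subseteq> \<Omega>" "supported_in y K" "\<And>x. x \<in> \<Omega> \<Longrightarrow> y x = z x"
      "\<And>x. x \<in> \<Omega> \<Longrightarrow> div_field y x = div_field z x"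
      using C1c_fields_extend[OF assms(1), of z] by auto
    have "continuous_on \<Omega> z"
      using C1_field_continuous[OF y(1), of \<Omega>] by (rule continuous_on_eq) (simp add: y(4))
    then have "z x \<in> wulff \<phi>" if "x \<in> \<Omega>" for x
      using open_AE_imp_all[OF assms(1) _ closed_wulff _ that] z by blast
    then have "y x \<in> wulff \<phi>" for x
      using y(2,3,4) wulff_0[OF assms(2)] unfolding supported_in_def by (metis subsetD)
    then have "y \<in> admissible \<phi> \<Omega>" using y unfolding admissible_def by blast
    moreover have "(LINT x|lebesgue_on \<Omega>. u x * div_field z x) = (LINT x|lebesgue_on \<Omega>. u x * div_field y x)"
      by (intro Bochner_Integration.integral_cong refl) (simp add: y(5) space_restrict_space)
    ultimately show "ereal (LINT x|lebesgue_on \<Omega>. u x * div_field z x)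
       \<le> (SUP z\<in>admissible \<phi> \<Omega>. ereal (LINT x|lebesgue_on \<Omega>. u x * div_field z x))"
      by (metis (no_types, lifting) SUP_upper)
  qed
  have "admissible \<phi> \<Omega> \<subseteq> {z \<in> C1c_fields \<Omega>. AE x in lebesgue_on \<Omega>. z x \<in> wulff \<phi>}"
    unfolding admissible_def using C1_field_in_C1c_fields by auto
  then show "(SUP z\<in>admissible \<phi> \<Omega>. ereal (LINT x|lebesgue_on \<Omega>. u x * div_field z x))
     \<le> (SUP z\<in>{z \<in> C1c_fields \<Omega>. AE x in lebesgue_on \<Omega>. z x \<in> wulff \<phi>}. ereal (LINT x|lebesgue_on \<Omega>. u x * div_field z x))"
    by (rule SUP_subset_mono) simp
qed

lemma total_variation_ge:
  assumes "open \<Omega>" "metric_integrand \<phi>" "z \<in> admissible \<phi> \<Omega>"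
  shows "ereal (LINT x|lebesgue_on \<Omega>. u x * div_field z x) \<le> total_variation \<phi> \<Omega> u"
  unfolding total_variation_eq_SUP_admissible[OF assms(1,2)] by (rule SUP_upper[OF assms(3)])

lemma total_variation_le:
  assumes "open \<Omega>" "metric_integrand \<phi>"
    "\<And>z. z \<in> admissible \<phi> \<Omega> \<Longrightarrow> ereal (LINT x|lebesgue_on \<Omega>. u x * div_field z x) \<le> c"
  shows "total_variation \<phi> \<Omega> u \<le> c"
  unfolding total_variation_eq_SUP_admissible[OF assms(1,2)] by (rule SUP_least[OF assms(3)])

lemma admissible_0: "metric_integrand \<phi> \<Longrightarrow> (\<lambda>x. 0) \<in> admissible \<phi> \<Omega>"
  unfolding admissible_def supported_in_def by (auto simp: wulff_0 intro!: exI[of _ "{}"])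

lemma total_variation_nonneg: "open \<Omega> \<Longrightarrow> metric_integrand \<phi> \<Longrightarrow> 0 \<le> total_variation \<phi> \<Omega> u"
  using total_variation_ge[OF _ _ admissible_0, of \<Omega> \<phi> u] by (simp add: zero_ereal_def)

lemma admissible_uminus:
  assumes "metric_integrand \<phi>" "z \<in> admissible \<phi> \<Omega>"
  shows "(\<lambda>x. - z x) \<in> admissible \<phi> \<Omega>"
  using assms wulff_uminus unfolding admissible_def supported_in_def
  by (auto intro: C1_field_uminus)

lemma total_variation_uminus:
  assumes "open \<Omega>" "metric_integrand \<phi>"
  shows "total_variation \<phi> \<Omega> (\<lambda>x. - u x) = total_variation \<phi> \<Omega> u"
proof -
  have "total_variation \<phi> \<Omega> (\<lambda>x. - u x) \<le> total_variation \<phi> \<Omega> u" for u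
  proof (rule total_variation_le[OF assms])
    fix z assume z: "z \<in> admissible \<phi> \<Omega>"
    then have "div_field (\<lambda>x. - z x) x = - div_field z x" for x
      by (intro div_field_uminus) (simp add: admissible_def)
    then show "ereal (LINT x|lebesgue_on \<Omega>. - u x * div_field z x) \<le> total_variation \<phi> \<Omega> u"
      using total_variation_ge[OF assms admissible_uminus[OF assms(2) z], of u] by simp
  qed
  from this[of u] this[of "\<lambda>x. - u x"] show ?thesis by simp
qed

lemma total_variation_cong_AE:
  assumes "AE x in lebesgue_on \<Omega>. u x = v x"
    "u \<in> borel_measurable (lebesgue_on \<Omega>)" "v \<in> borel_measurable (lebesgue_on \<Omega>)"
    "open \<Omega>" "metric_integrand \<phi>"
  shows "total_variation \<phi> \<Omega> u = total_variation \<phi> \<Omega> v"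
  unfolding total_variation_eq_SUP_admissible[OF assms(4,5)]
proof (rule SUP_cong[OF refl])
  fix z assume "z \<in> admissible \<phi> \<Omega>"
  then have "div_field z \<in> borel_measurable (lebesgue_on \<Omega>)"
    using borel_measurable_div_field[of z] unfolding admissible_def
    by (intro measurable_restrict_space1 measurable_completion) auto
  with assms show "ereal (LINT x|lebesgue_on \<Omega>. u x * div_field z x) = ereal (LINT x|lebesgue_on \<Omega>. v x * div_field z x)"
    by (intro arg_cong[of _ _ ereal] integral_cong_AE) auto
qed

lemma admissible_div:
  assumes "z \<in> admissible \<phi> \<Omega>"
  obtains B where "B > 0" "\<And>x. \<bar>div_field z x\<bar> \<le> B" "div_field z \<in> borel_measurable borel"
    "div_field z \<in> borel_measurable (lebesgue_on \<Omega>)"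
proof -
  obtain K where z: "C1_field z" "supported_in z K"
    using assms unfolding admissible_def by blast
  obtain B where "B > 0" "\<And>x. \<bar>div_field z x\<bar> \<le> B"
    using supported_in_bounded[OF continuous_div_field[OF z(1)] supported_in_div[OF z]] by auto
  moreover have "div_field z \<in> borel_measurable borel" by (rule borel_measurable_div_field[OF z(1)])
  moreover from this have "div_field z \<in> borel_measurable (lebesgue_on \<Omega>)"
    by (intro measurable_restrict_space1 measurable_completion) simp
  ultimately show ?thesis using that by blast
qed

lemma integrable_mult_div_field:
  assumes "z \<in> admissible \<phi> \<Omega>" "integrable (lebesgue_on \<Omega>) u"
  shows "integrable (lebesgue_on \<Omega>) (\<lambda>x. u x * div_field z x)"
  using admissible_div[OF assms(1)] integrable_mult_bounded[OF assms(2)] by metis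

text \<open>
  Each test field gives a functional that is continuous under dominated convergence, and a supremum of
  continuous functionals is lower semicontinuous.
\<close>

lemma total_variation_lower_semicontinuous:
  assumes "open \<Omega>" "metric_integrand \<phi>"
    and u: "\<And>k. u k \<in> borel_measurable (lebesgue_on \<Omega>)" and v: "v \<in> borel_measurable (lebesgue_on \<Omega>)"
    and lim: "AE x in lebesgue_on \<Omega>. (\<lambda>k. u k x) \<longlonglongrightarrow> v x"
    and dom: "integrable (lebesgue_on \<Omega>) g" "\<And>k. AE x in lebesgue_on \<Omega>. \<bar>u k x\<bar> \<le> g x"
    and le: "\<And>k. total_variation \<phi> \<Omega> (u k) \<le> c k" and c: "c \<longlonglongrightarrow> c'"
  shows "total_variation \<phi> \<Omega> v \<le> c'"
proof (rule total_variation_le[OF assms(1,2)])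
  fix z assume z: "z \<in> admissible \<phi> \<Omega>"
  obtain B where B: "B > 0" "\<And>x. \<bar>div_field z x\<bar> \<le> B" and [measurable]: "div_field z \<in> borel_measurable (lebesgue_on \<Omega>)"
    using admissible_div[OF z] by metis
  note [measurable] = u v
  have "(\<lambda>k. LINT x|lebesgue_on \<Omega>. u k x * div_field z x) \<longlonglongrightarrow> (LINT x|lebesgue_on \<Omega>. v x * div_field z x)"
  proof (rule integral_dominated_convergence[where w="\<lambda>x. g x * B"])
    show "AE x in lebesgue_on \<Omega>. (\<lambda>k. u k x * div_field z x) \<longlonglongrightarrow> v x * div_field z x"
      using lim by eventually_elim (intro tendsto_intros)
    show "AE x in lebesgue_on \<Omega>. norm (u k x * div_field z x) \<le> g x * B" for k
      using dom(2)[of k]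
    proof eventually_elim
      fix x assume "\<bar>u k x\<bar> \<le> g x"
      then have "\<bar>u k x\<bar> * \<bar>div_field z x\<bar> \<le> g x * B" using B(2)[of x] by (intro mult_mono) auto
      then show "norm (u k x * div_field z x) \<le> g x * B" by (simp add: abs_mult)
    qed
  qed (use dom(1) in auto)
  then have "(\<lambda>k. ereal (LINT x|lebesgue_on \<Omega>. u k x * div_field z x)) \<longlonglongrightarrow> ereal (LINT x|lebesgue_on \<Omega>. v x * div_field z x)"
    by simp
  moreover have "ereal (LINT x|lebesgue_on \<Omega>. u k x * div_field z x) \<le> c k" for k
    using total_variation_ge[OF assms(1,2) z] le order_trans by blast
  ultimately show "ereal (LINT x|lebesgue_on \<Omega>. v x * div_field z x) \<le> c'"
    using LIMSEQ_le[OF _ c] by blast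
qed

lemma total_variation_convex:
  assumes "open \<Omega>" "metric_integrand \<phi>"
    and u: "integrable (lebesgue_on \<Omega>) u" "total_variation \<phi> \<Omega> u \<le> ereal c"
    and v: "integrable (lebesgue_on \<Omega>) v" "total_variation \<phi> \<Omega> v \<le> ereal c"
  shows "total_variation \<phi> \<Omega> (\<lambda>x. (u x + v x) / 2) \<le> ereal c"
proof (rule total_variation_le[OF assms(1,2)])
  fix z assume z: "z \<in> admissible \<phi> \<Omega>"
  have "(LINT x|lebesgue_on \<Omega>. (u x + v x) / 2 * div_field z x)
      = (LINT x|lebesgue_on \<Omega>. u x * div_field z x / 2 + v x * div_field z x / 2)"
    by (simp add: field_simps)
  also have "\<dots> = (LINT x|lebesgue_on \<Omega>. u x * div_field z x) / 2 + (LINT x|lebesgue_on \<Omega>. v x * div_field z x) / 2"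
    using integrable_mult_div_field[OF z u(1)] integrable_mult_div_field[OF z v(1)] by simp
  finally show "ereal (LINT x|lebesgue_on \<Omega>. (u x + v x) / 2 * div_field z x) \<le> ereal c"
    using order_trans[OF total_variation_ge[OF assms(1,2) z] u(2)]
      order_trans[OF total_variation_ge[OF assms(1,2) z] v(2)] by simp
qed

text \<open>
  Since \<open>l * norm \<xi> \<le> \<phi> \<xi>\<close>, scaling a field of norm at most 1 by \<open>l\<close> puts it into the Wulff shape.
\<close>

lemma BV_if_finite_total_variation:
  assumes "open \<Omega>" "metric_integrand \<phi>" "integrable (lebesgue_on \<Omega>) u" "total_variation \<phi> \<Omega> u < \<infinity>"
  shows "u \<in> BV \<Omega>"
proof -
  obtain l where l: "l > 0" "\<And>\<xi>. l * norm \<xi> \<le> \<phi> \<xi>" by (metis assms(2) metric_integrandE)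
  have "total_variation \<phi> \<Omega> u \<noteq> - \<infinity>" using total_variation_nonneg[OF assms(1,2), of u] by auto
  then obtain T where T: "total_variation \<phi> \<Omega> u = ereal T" using assms(4) by (cases "total_variation \<phi> \<Omega> u") auto
  have "(LINT x|lebesgue_on \<Omega>. u x * div_field z x) \<le> T / l"
    if z: "z \<in> C1c_fields \<Omega>" "\<forall>x\<in>\<Omega>. norm (z x) \<le> 1" for z
  proof -
    obtain y K where y: "C1_field y" "K \<subseteq> \<Omega>" "supported_in y K" "\<And>x. x \<in> \<Omega> \<Longrightarrow> y x = z x"
      "\<And>x. x \<in> \<Omega> \<Longrightarrow> div_field y x = div_field z x"
      using C1c_fields_extend[OF assms(1) z(1)] by metis
    have "norm (y x) \<le> 1" for x
      using y(2,3,4) z(2) unfolding supported_in_def by (metis norm_zero subsetD zero_le_one)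
    then have "l *\<^sub>R y x \<in> wulff \<phi>" for x
      unfolding wulff_def
    proof (intro CollectI allI)
      fix \<xi>
      have "y x \<bullet> \<xi> \<le> norm \<xi>"
        using norm_cauchy_schwarz[of "y x" \<xi>] mult_right_mono[OF \<open>\<And>x. norm (y x) \<le> 1\<close>[of x], of "norm \<xi>"] by simp
      then have "l * (y x \<bullet> \<xi>) \<le> l * norm \<xi>" using l(1) by simp
      then show "(l *\<^sub>R y x) \<bullet> \<xi> \<le> \<phi> \<xi>" using l(2)[of \<xi>] by simp
    qed
    moreover have "supported_in (\<lambda>x. l *\<^sub>R y x) K" using y(3) by (simp add: supported_in_def)
    ultimately have "(\<lambda>x. l *\<^sub>R y x) \<in> admissible \<phi> \<Omega>"
      using y C1_field_scaleR[OF C1_const] unfolding admissible_def by blast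
    from total_variation_ge[OF assms(1,2) this, of u]
    have "(LINT x|lebesgue_on \<Omega>. u x * div_field (\<lambda>x. l *\<^sub>R y x) x) \<le> T" by (simp add: T)
    moreover have "u x * div_field (\<lambda>x. l *\<^sub>R y x) x = l * (u x * div_field y x)" for x
      using div_field_scaleR[OF C1_const y(1), of l x] by simp
    moreover have "(LINT x|lebesgue_on \<Omega>. u x * div_field y x) = (LINT x|lebesgue_on \<Omega>. u x * div_field z x)"
      by (intro Bochner_Integration.integral_cong refl) (simp add: y(5) space_restrict_space)
    ultimately have "l * (LINT x|lebesgue_on \<Omega>. u x * div_field z x) \<le> T" by simp
    then show ?thesis using l(1) by (simp add: field_simps)
  qed
  then show ?thesis using assms(3) unfolding BV_def by (auto intro!: bdd_aboveI[of _ "T / l"])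
qed

section \<open>Truncation on a cap of the domain\<close>

text \<open>
  Smooth versions of the indicator of the positive half-line and of the positive part. The function
  \<open>ramp k\<close> is a primitive of \<open>step k\<close>, and \<open>step k\<close> is again continuously differentiable; both vanish on
  the negative half-line. The cut below uses \<open>step k\<close> twice, to smooth the edge of a half-plane and as
  the derivative of the truncation.
\<close>

definition step :: "real \<Rightarrow> real \<Rightarrow> real" where
  "step k t = 1 - 1 / (1 + (k * max 0 t)\<^sup>2)"

definition step_deriv :: "real \<Rightarrow> real \<Rightarrow> real" where
  "step_deriv k t = 2 * k\<^sup>2 * max 0 t / (1 + (k * max 0 t)\<^sup>2)\<^sup>2"

definition ramp :: "real \<Rightarrow> real \<Rightarrow> real" where
  "ramp k t = max 0 t - arctan (k * max 0 t) / k"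

lemma one_plus_square_pos: "1 + (x::real)\<^sup>2 > 0"
  by (simp add: add_pos_nonneg)

lemma DERIV_ramp:
  assumes "k > 0" shows "(ramp k has_real_derivative step k t) (at t)"
proof -
  have "((\<lambda>t. t - arctan (k * t) / k) has_real_derivative 1 - 1 / (1 + (k * t)\<^sup>2)) (at t)" for t
    using assms one_plus_square_pos[of "k * t"]
    by (auto intro!: derivative_eq_intros simp: divide_inverse)
  from DERIV_compose_max_0[OF this] show ?thesis
    by (simp add: ramp_def[abs_def] step_def)
qed

lemma DERIV_step: "(step k has_real_derivative step_deriv k t) (at t)"
proof -
  have "((\<lambda>t. 1 - 1 / (1 + (k * t)\<^sup>2)) has_real_derivative 2 * k\<^sup>2 * t / (1 + (k * t)\<^sup>2)\<^sup>2) (at t)" for t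
    using one_plus_square_pos[of "k * t"]
    by (auto intro!: derivative_eq_intros simp: power2_eq_square field_simps)
  from DERIV_compose_max_0[OF this] show ?thesis
    by (simp add: step_def[abs_def] step_deriv_def)
qed

lemma step_bounds: "0 \<le> step k t" "step k t \<le> 1"
  using one_plus_square_pos[of "k * max 0 t"] by (auto simp: step_def)

lemma step_nonpos: "t \<le> 0 \<Longrightarrow> step k t = 0"
  by (simp add: step_def)

lemma ramp_nonpos: "t \<le> 0 \<Longrightarrow> ramp k t = 0"
  by (simp add: ramp_def)

lemma step_deriv_nonneg: "0 \<le> step_deriv k t"
  by (simp add: step_deriv_def)

lemma continuous_step_deriv: "continuous_on A (step_deriv k)"
  unfolding step_deriv_def using one_plus_square_pos
  by (intro continuous_intros) (auto simp: less_imp_neq[THEN not_sym])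

lemma continuous_step: "continuous_on A (step k)"
  by (intro continuous_at_imp_continuous_on ballI DERIV_isCont[OF DERIV_step])

lemma ramp_lipschitz:
  assumes "k > 0" shows "\<bar>ramp k a - ramp k b\<bar> \<le> \<bar>a - b\<bar>"
proof -
  have "norm (ramp k a - ramp k b) \<le> 1 * norm (a - b)"
    by (rule field_differentiable_bound[of UNIV "ramp k" "step k"])
       (use DERIV_ramp[OF assms] step_bounds in auto)
  then show ?thesis by simp
qed

lemma ramp_bounds:
  assumes "k > 0" shows "0 \<le> ramp k t" "ramp k t \<le> \<bar>t\<bar>"
proof -
  have "ramp k 0 \<le> ramp k (max 0 t)"
    by (rule DERIV_nonneg_imp_nondecreasing) (use DERIV_ramp[OF assms] step_bounds(1) in auto)
  then show "0 \<le> ramp k t" by (simp add: ramp_def)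
  show "ramp k t \<le> \<bar>t\<bar>"
    using ramp_lipschitz[OF assms, of t 0] by (simp add: ramp_nonpos)
qed

lemma continuous_ramp: "k > 0 \<Longrightarrow> continuous_on A (ramp k)"
  by (intro continuous_at_imp_continuous_on ballI DERIV_isCont[OF DERIV_ramp])

lemma ramp_tendsto: "(\<lambda>j. ramp (real (Suc j)) t) \<longlonglongrightarrow> max 0 t"
proof -
  have "(\<lambda>j. arctan (real (Suc j) * max 0 t) / real (Suc j)) \<longlonglongrightarrow> 0"
  proof (rule Lim_null_comparison)
    show "\<forall>\<^sub>F j in sequentially. norm (arctan (real (Suc j) * max 0 t) / real (Suc j)) \<le> pi / 2 * inverse (real (Suc j))"
    proof (intro always_eventually allI)
      fix j
      have ab: "\<bar>arctan y\<bar> \<le> pi / 2" for y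
        using arctan_lbound[of y] arctan_ubound[of y] by linarith
      have "\<bar>arctan (real (Suc j) * max 0 t)\<bar> * inverse (real (Suc j)) \<le> pi / 2 * inverse (real (Suc j))"
        by (rule mult_right_mono[OF ab]) simp
      then show "norm (arctan (real (Suc j) * max 0 t) / real (Suc j)) \<le> pi / 2 * inverse (real (Suc j))"
        unfolding real_norm_def abs_divide abs_of_nat by (simp only: divide_inverse)
    qed
    show "(\<lambda>j. pi / 2 * inverse (real (Suc j))) \<longlonglongrightarrow> 0"
      by (rule tendsto_mult_right_zero[OF LIMSEQ_inverse_real_of_nat])
  qed
  then show ?thesis
    unfolding ramp_def using tendsto_diff[OF tendsto_const, of _ 0 sequentially "max 0 t"] by simp
qed

text \<open>
  The shift makes each approximation vanish on a neighbourhood of the edge, and disappears in the limit.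
\<close>

lemma step_shift_tendsto:
  "(\<lambda>j. step (real (Suc j)) (t - 1 / real (Suc j))) \<longlonglongrightarrow> (if t > 0 then 1 else 0)"
proof (cases "t > 0")
  case False
  then have "step (real (Suc j)) (t - 1 / real (Suc j)) = 0" for j
    by (intro step_nonpos) (smt (verit) False divide_nonneg_nonneg of_nat_0_le_iff)
  with False show ?thesis by simp
next
  case True
  have "filterlim (\<lambda>j. real (Suc j) * t - 1) at_top sequentially"
  proof -
    have "filterlim (\<lambda>j. t * real (Suc j)) at_top sequentially"
      by (intro filterlim_tendsto_pos_mult_at_top[OF tendsto_const True]
          filterlim_compose[OF filterlim_real_sequentially filterlim_Suc])
    from filterlim_tendsto_add_at_top[OF tendsto_const[of "-1"] this] show ?thesis
      by (simp add: algebra_simps)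
  qed
  then have "filterlim (\<lambda>j. 1 + (real (Suc j) * t - 1)\<^sup>2) at_top sequentially"
    by (intro filterlim_tendsto_add_at_top[OF tendsto_const] filterlim_pow_at_top) auto
  then have "(\<lambda>j. inverse (1 + (real (Suc j) * t - 1)\<^sup>2)) \<longlonglongrightarrow> 0"
    by (rule tendsto_inverse_0_at_top)
  then have "(\<lambda>j. 1 - inverse (1 + (real (Suc j) * t - 1)\<^sup>2)) \<longlonglongrightarrow> 1 - 0"
    by (intro tendsto_intros)
  moreover have "\<forall>\<^sub>F j in sequentially. 1 - inverse (1 + (real (Suc j) * t - 1)\<^sup>2) = step (real (Suc j)) (t - 1 / real (Suc j))"
  proof -
    have "\<forall>\<^sub>F j in sequentially. real (Suc j) * t - 1 \<ge> 0"
      using \<open>filterlim (\<lambda>j. real (Suc j) * t - 1) at_top sequentially\<close>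
      unfolding filterlim_at_top by blast
    then show ?thesis
    proof eventually_elim
      fix j assume j: "real (Suc j) * t - 1 \<ge> 0"
      then have "t - 1 / real (Suc j) \<ge> 0" by (simp add: field_simps)
      moreover have "real (Suc j) * (t - 1 / real (Suc j)) = real (Suc j) * t - 1" by (simp add: field_simps)
      ultimately show "1 - inverse (1 + (real (Suc j) * t - 1)\<^sup>2) = step (real (Suc j)) (t - 1 / real (Suc j))"
        by (simp add: step_def inverse_eq_divide)
    qed
  qed
  ultimately show ?thesis using True by (simp add: filterlim_cong[OF refl refl])
qed

lemma integral_by_parts:
  assumes "C1 V" "C1_field z" "supported_in z K"
  shows "(LBINT x. V x * div_field z x) = - (LBINT x. grad V x \<bullet> z x)"
proof -
  have s: "supported_in (\<lambda>x. V x *\<^sub>R z x) K" using assms(3) by (simp add: supported_in_def)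
  have c: "continuous_on UNIV (\<lambda>x. V x * div_field z x)" "continuous_on UNIV (\<lambda>x. grad V x \<bullet> z x)"
    by (intro continuous_intros C1_continuous[OF assms(1)] C1_continuous_grad[OF assms(1)]
        C1_field_continuous[OF assms(2)] continuous_div_field[OF assms(2)])+
  have s1: "supported_in (\<lambda>x. V x * div_field z x) K"
    using supported_in_div[OF assms(2,3)] by (simp add: supported_in_def)
  have s2: "supported_in (\<lambda>x. grad V x \<bullet> z x) K"
    using assms(3) by (simp add: supported_in_def)
  have "0 = (LBINT x. V x * div_field z x + grad V x \<bullet> z x)"
    using integral_div_field_eq_0[OF C1_field_scaleR[OF assms(1,2)] s] by (simp add: div_field_scaleR[OF assms(1,2)])
  also have "\<dots> = (LBINT x. V x * div_field z x) + (LBINT x. grad V x \<bullet> z x)"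
    by (rule Bochner_Integration.integral_add[OF integrable_continuous_supported[OF c(1) s1] integrable_continuous_supported[OF c(2) s2]])
  finally show ?thesis by simp
qed

text \<open>
  This is the calibration argument for a smooth function \<open>W\<close>. Let \<open>s\<close> be the smoothed indicator of
  the half-plane, \<open>G\<close> the smoothed excess of \<open>W\<close> over \<open>M\<close>, with \<open>grad G = \<sigma> *\<^sub>R grad W\<close>, and
  \<open>V = W - s * G\<close> the function with the excess removed. Removing it leaves only the fraction
  \<open>1 - s * \<sigma>\<close> of the gradient of \<open>W\<close> but adds a term of size \<open>G * s'\<close> in direction \<open>n\<close>, the smoothed
  jump along the edge. It costs at most \<open>G * s' * \<phi> n\<close>, where \<open>\<phi> n = z0 \<bullet> n\<close>. As \<open>s * G * \<eta>\<close> has compact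
  support, the divergence of \<open>(s * G * \<eta>) *\<^sub>R z0\<close> integrates to zero, which converts this cost into the
  variation of the removed excess as seen by the constant field \<open>z0\<close>. Hence the field \<open>Z\<close> that passes
  from \<open>z\<close>, where nothing is removed, to \<open>\<eta> *\<^sub>R z0\<close>, where the excess is removed, tests \<open>W\<close> at least as well as \<open>z\<close>
  tests \<open>V\<close>. It is a pointwise convex combination of elements of the Wulff shape.
  
  The cut-off \<open>\<eta>\<close> is needed because \<open>z0\<close> is constant; where \<open>\<eta>\<close> varies, the excess is assumed to be zero.
\<close>

lemma calibrated_cut:
  fixes W \<eta> :: "real^2 \<Rightarrow> real" and z :: "real^2 \<Rightarrow> real^2" and n z0 :: "real^2"
  assumes \<phi>: "metric_integrand \<phi>" and W: "C1 W" and k: "k > 0"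
    and z: "C1_field z" "supported_in z K" "\<And>x. z x \<in> wulff \<phi>"
    and \<eta>: "C1 \<eta>" "supported_in \<eta> L" "\<And>x. 0 \<le> \<eta> x" "\<And>x. \<eta> x \<le> 1" "\<And>x. z x \<noteq> 0 \<Longrightarrow> \<eta> x = 1"
    and z0: "z0 \<in> wulff \<phi>" "z0 \<bullet> n = \<phi> n"
    and cap: "\<And>x. n \<bullet> x > c \<Longrightarrow> grad \<eta> x \<noteq> 0 \<Longrightarrow> W x \<le> M"
  obtains Z where "C1_field Z" "supported_in Z L" "\<And>x. Z x \<in> wulff \<phi>"
    "(LBINT x. (W x - step k (n \<bullet> x - c) * ramp k (W x - M)) * div_field z x)
       \<le> (LBINT x. W x * div_field Z x)"
proof -
  define s where "s x = step k (n \<bullet> x - c)" for x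
  define s' where "s' x = step_deriv k (n \<bullet> x - c)" for x
  define \<sigma> where "\<sigma> x = step k (W x - M)" for x
  define G where "G x = ramp k (W x - M)" for x
  have zL: "supported_in z L"
    using \<eta>(2,5) unfolding supported_in_def by (metis zero_neq_one)
  have C1s: "C1 s" and gs: "grad s x = s' x *\<^sub>R n" for x
    using C1_compose[OF C1_affine[of n "-c"] DERIV_step continuous_step_deriv, of k]
      grad_compose[OF C1_affine[of n "-c"] DERIV_step, of k x]
    unfolding s_def[abs_def] s'_def using grad_affine[of n "-c"] by simp_all
  have WM: "C1 (\<lambda>x. W x - M)" "grad (\<lambda>x. W x - M) x = grad W x" for x
    using C1_diff[OF W C1_const, of M] grad_diff[OF W C1_const, of M x] by simp_all
  have C1\<sigma>: "C1 \<sigma>"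
    unfolding \<sigma>_def[abs_def] by (rule C1_compose[OF WM(1) DERIV_step continuous_step_deriv])
  have C1G: "C1 G" and gG: "grad G x = \<sigma> x *\<^sub>R grad W x" for x
    using C1_compose[OF WM(1) DERIV_ramp[OF k] continuous_step] grad_compose[OF WM(1) DERIV_ramp[OF k]]
    unfolding G_def[abs_def] \<sigma>_def by (simp_all add: WM(2))
  have sb: "0 \<le> s x" "s x \<le> 1" "0 \<le> \<sigma> x" "\<sigma> x \<le> 1" "0 \<le> s' x" "0 \<le> G x" for x
    using step_bounds step_deriv_nonneg ramp_bounds[OF k] by (auto simp: s_def \<sigma>_def s'_def G_def)
  define V where "V x = W x - s x * G x" for x
  have C1V: "C1 V" unfolding V_def[abs_def] by (intro C1_diff W C1_mult C1s C1G)
  have gV: "grad V x = (1 - s x * \<sigma> x) *\<^sub>R grad W x - (G x * s' x) *\<^sub>R n" for x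
    unfolding V_def[abs_def] grad_diff[OF W C1_mult[OF C1s C1G]] grad_mult[OF C1s C1G] gs gG
    by (simp add: algebra_simps)
  define Z where "Z x = (1 - s x * \<sigma> x) *\<^sub>R z x + (s x * \<sigma> x) *\<^sub>R \<eta> x *\<^sub>R z0" for x
  have C1Z: "C1_field Z"
    unfolding Z_def[abs_def]
    by (intro C1_field_add C1_field_scaleR z(1) C1_diff C1_mult C1_const C1s C1\<sigma> \<eta>(1) C1_field_const)
  have ZL: "supported_in Z L"
    using zL \<eta>(2) by (simp add: supported_in_def Z_def)
  have Zw: "Z x \<in> wulff \<phi>" for x
    unfolding Z_def using sb[of x] \<eta>(3,4)
    by (intro wulff_convex z(3) wulff_scale \<phi> z0(1)) (auto intro: mult_le_one)
  \<comment> \<open>The field whose vanishing total divergence pays for the new edge.\<close>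
  define Y where "Y x = (s x * G x * \<eta> x) *\<^sub>R z0" for x
  have C1sg: "C1 (\<lambda>x. s x * G x * \<eta> x)" by (intro C1_mult C1s C1G \<eta>(1))
  have C1Y: "C1_field Y" unfolding Y_def[abs_def] by (rule C1_field_scaleR[OF C1sg C1_field_const])
  have YL: "supported_in Y L" using \<eta>(2) by (simp add: supported_in_def Y_def)
  have divY: "div_field Y x = \<eta> x * (s x * \<sigma> x * (grad W x \<bullet> z0) + G x * s' x * \<phi> n)" for x
  proof -
    have 0: "s x * G x * (grad \<eta> x \<bullet> z0) = 0"
    proof (cases "n \<bullet> x > c \<and> grad \<eta> x \<noteq> 0")
      case True
      then have "G x = 0" using cap by (simp add: G_def ramp_nonpos)
      then show ?thesis by simp
    next
      case False
      then show ?thesis by (auto simp: s_def step_nonpos)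
    qed
    have "div_field Y x = grad (\<lambda>x. s x * G x * \<eta> x) x \<bullet> z0"
      unfolding Y_def[abs_def] div_field_scaleR[OF C1sg C1_field_const] by simp
    also have "grad (\<lambda>x. s x * G x * \<eta> x) x
      = (s x * G x) *\<^sub>R grad \<eta> x + \<eta> x *\<^sub>R (s x *\<^sub>R \<sigma> x *\<^sub>R grad W x + G x *\<^sub>R s' x *\<^sub>R n)"
      unfolding grad_mult[OF C1_mult[OF C1s C1G] \<eta>(1)] grad_mult[OF C1s C1G] gs gG ..
    also have "\<dots> \<bullet> z0 = s x * G x * (grad \<eta> x \<bullet> z0)
        + \<eta> x * (s x * \<sigma> x * (grad W x \<bullet> z0) + G x * s' x * (z0 \<bullet> n))"
      by (simp add: inner_add_left algebra_simps inner_commute)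
    finally show ?thesis using 0 z0(2) by simp
  qed
  \<comment> \<open>The inequality holds pointwise once the divergence of \<open>Y\<close> is added.\<close>
  have pt: "- (grad V x \<bullet> z x) \<le> - (grad W x \<bullet> Z x) + div_field Y x" for x
  proof -
    have "n \<bullet> z x \<le> \<eta> x * \<phi> n"
    proof (cases "z x = 0")
      case True
      then show ?thesis using \<eta>(3) \<phi> by (simp add: metric_integrand_def)
    next
      case False
      then show ?thesis using \<eta>(5) z(3)[of x] by (simp add: wulff_def inner_commute)
    qed
    then have "G x * s' x * (n \<bullet> z x) \<le> G x * s' x * (\<eta> x * \<phi> n)"
      using sb by (intro mult_left_mono) auto
    then show ?thesis
      unfolding gV divY Z_def by (simp add: inner_diff_left inner_add_right algebra_simps)
  qed
  have i1: "integrable lborel (\<lambda>x. grad V x \<bullet> z x)"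
    by (rule integrable_continuous_supported[where K=K])
       (use z(2) in \<open>auto simp: supported_in_def intro!: continuous_intros C1_continuous_grad[OF C1V] C1_field_continuous[OF z(1)]\<close>)
  have i2: "integrable lborel (\<lambda>x. grad W x \<bullet> Z x)"
    by (rule integrable_continuous_supported[where K=L])
       (use ZL in \<open>auto simp: supported_in_def intro!: continuous_intros C1_continuous_grad[OF W] C1_field_continuous[OF C1Z]\<close>)
  have i3: "integrable lborel (div_field Y)"
    by (rule integrable_continuous_supported[OF continuous_div_field[OF C1Y] supported_in_div[OF C1Y YL]])
  have "(LBINT x. V x * div_field z x) = (LBINT x. - (grad V x \<bullet> z x))"
    using integral_by_parts[OF C1V z(1,2)] by simp
  also have "\<dots> \<le> (LBINT x. - (grad W x \<bullet> Z x) + div_field Y x)"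
    using i1 i2 i3 pt by (intro integral_mono) auto
  also have "\<dots> = (LBINT x. - (grad W x \<bullet> Z x)) + (LBINT x. div_field Y x)"
    using i2 i3 by (intro Bochner_Integration.integral_add) auto
  also have "\<dots> = (LBINT x. W x * div_field Z x)"
    using integral_by_parts[OF W C1Z ZL] integral_div_field_eq_0[OF C1Y YL] by simp
  finally have "(LBINT x. V x * div_field z x) \<le> (LBINT x. W x * div_field Z x)" .
  then show ?thesis
    using that[OF C1Z ZL Zw] unfolding V_def s_def G_def by blast
qed

definition nbhd :: "(real^2) set \<Rightarrow> real \<Rightarrow> (real^2) set" where
  "nbhd C a = (\<Union>x\<in>C. cball x a)"

lemma compact_nbhd: "compact C \<Longrightarrow> compact (nbhd C a)"
proof -
  assume "compact C"
  have "nbhd C a = (\<Union>x\<in>C. \<Union>y\<in>cball 0 a. {x + y})"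
    unfolding nbhd_def
  proof (intro SUP_cong refl)
    fix x :: "real^2"
    have "y \<in> (\<Union>y\<in>cball 0 a. {x + y})" if "y \<in> cball x a" for y
      using that by (intro UN_I[of "y - x"]) (auto simp: dist_norm norm_minus_commute)
    then show "cball x a = (\<Union>y\<in>cball 0 a. {x + y})"
      by (auto simp: dist_norm)
  qed
  then show ?thesis using compact_sums'[OF \<open>compact C\<close> compact_cball] by simp
qed

lemma mem_nbhd: "y \<in> nbhd C a \<longleftrightarrow> (\<exists>x\<in>C. dist x y \<le> a)"
  by (auto simp: nbhd_def)

text \<open>
  The cut-off is obtained by smoothing the indicator of a neighbourhood of \<open>C\<close>. The radius \<open>r\<close> leaves
  room for one more smoothing around the points where the cut-off varies and around its support.
\<close>

lemma cutoff_exists: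
  assumes "open \<Omega>" "compact C" "C \<subseteq> \<Omega>"
  obtains \<eta> L r where "r > 0" "C1 \<eta>" "supported_in \<eta> L" "\<And>x. 0 \<le> \<eta> x" "\<And>x. \<eta> x \<le> 1"
    "\<And>x. x \<in> C \<Longrightarrow> \<eta> x = 1" "\<And>x. grad \<eta> x \<noteq> 0 \<Longrightarrow> cball x r \<subseteq> \<Omega> - C" "\<And>x. x \<in> L \<Longrightarrow> cball x r \<subseteq> \<Omega>"
proof -
  obtain \<epsilon> where \<epsilon>: "\<epsilon> > 0" "(\<Union>x\<in>C. cball x \<epsilon>) \<subseteq> \<Omega>"
    using compact_subset_open_imp_cball_epsilon_subset[OF assms(2,1,3)] by blast
  define R where "R = \<epsilon> / 4"
  have R: "R > 0" "nbhd C (4 * R) \<subseteq> \<Omega>" using \<epsilon> by (simp_all add: R_def nbhd_def)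
  define g :: "real^2 \<Rightarrow> real" where "g = indicator (nbhd C (2 * R))"
  have gm: "nbhd C (2 * R) \<in> sets borel" using compact_nbhd[OF assms(2)] by (intro borel_closed compact_imp_closed)
  have gi: "integrable lborel g"
    unfolding g_def
    by (rule integrable_real_indicator)
       (use gm emeasure_compact_finite[OF compact_nbhd[OF assms(2)]] in \<open>auto simp: less_top\<close>)
  let ?\<eta> = "smoothing R g"
  have one: "?\<eta> y = 1" if y: "y \<in> nbhd C R" for y
  proof -
    have "g x = 1" if x: "x \<in> cball y R" for x
    proof -
      obtain p where p: "p \<in> C" "dist p y \<le> R" using y by (auto simp: mem_nbhd)
      then have "dist p x \<le> 2 * R" using x dist_triangle[of p x y] by simp
      then have "x \<in> nbhd C (2 * R)" using p(1) by (auto simp: mem_nbhd)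
      then show ?thesis by (simp add: g_def)
    qed
    then have "?\<eta> y \<le> 1" "1 \<le> ?\<eta> y"
      by (auto intro!: smoothing_le[OF R(1) gi] smoothing_ge[OF R(1) gi])
    then show ?thesis by simp
  qed
  have zero: "?\<eta> y = 0" if y: "y \<notin> nbhd C (3 * R)" for y
  proof -
    have "g x = 0" if x: "x \<in> cball y R" for x
    proof -
      have "dist p x > 2 * R" if "p \<in> C" for p
        using y that x dist_triangle[of p y x] by (fastforce simp: mem_nbhd dist_commute)
      then have "x \<notin> nbhd C (2 * R)" by (auto simp: mem_nbhd not_le)
      then show ?thesis by (simp add: g_def)
    qed
    then have "?\<eta> y \<le> 0" "0 \<le> ?\<eta> y"
      by (auto intro!: smoothing_le[OF R(1) gi] smoothing_ge[OF R(1) gi])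
    then show ?thesis by simp
  qed
  have L: "compact (nbhd C (3 * R))" by (rule compact_nbhd[OF assms(2)])
  have sup: "supported_in ?\<eta> (nbhd C (3 * R))" using L zero by (simp add: supported_in_def)
  have inL: "cball x (R / 2) \<subseteq> \<Omega>" if x: "x \<in> nbhd C (3 * R)" for x
  proof
    fix y assume y: "y \<in> cball x (R / 2)"
    obtain p where p: "p \<in> C" "dist p x \<le> 3 * R" using x by (auto simp: mem_nbhd)
    then have "dist p y \<le> 4 * R" using y dist_triangle[of p y x] R(1) by simp
    then have "y \<in> nbhd C (4 * R)" using p(1) by (auto simp: mem_nbhd)
    then show "y \<in> \<Omega>" using R(2) by blast
  qed
  show ?thesis
  proof (rule that[of "R / 2" ?\<eta> "nbhd C (3 * R)"])
    show "0 \<le> ?\<eta> x" "?\<eta> x \<le> 1" for x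
    proof -
      have "0 \<le> g y" "g y \<le> 1" for y by (auto simp: g_def indicator_def)
      then show "0 \<le> ?\<eta> x" "?\<eta> x \<le> 1"
        by (auto intro!: smoothing_le[OF R(1) gi] smoothing_ge[OF R(1) gi])
    qed
    show "?\<eta> x = 1" if "x \<in> C" for x using that R(1) by (intro one) (auto simp: mem_nbhd intro: bexI[of _ x])
    show "cball x (R / 2) \<subseteq> \<Omega> - C" if gr: "grad ?\<eta> x \<noteq> 0" for x
    proof -
      have "x \<in> nbhd C (3 * R)"
        using supported_in_grad[OF sup] gr by (auto simp: supported_in_def)
      moreover have "y \<notin> C" if y: "y \<in> cball x (R / 2)" for y
      proof
        assume "y \<in> C"
        have "grad ?\<eta> x = 0"
        proof -
          have "grad ?\<eta> x = grad (\<lambda>_. 1) x"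
          proof (rule grad_cong_open[where U="ball y R"])
            show "x \<in> ball y R" using y R(1) by (simp add: dist_commute)
            show "?\<eta> u = 1" if "u \<in> ball y R" for u
              using that \<open>y \<in> C\<close> by (intro one) (auto simp: mem_nbhd intro: bexI[of _ y])
          qed auto
          then show ?thesis by simp
        qed
        with gr show False by simp
      qed
      ultimately show ?thesis using inL by blast
    qed
  qed (use R(1) gi sup inL C1_smoothing in auto)
qed

text \<open>
  An average of vectors of the convex set \<open>wulff \<phi>\<close> stays in it, so smoothing an admissible field gives
  an admissible one, as long as its support stays inside \<open>\<Omega>\<close>.
\<close>

lemma smoothing_field_admissible:
  assumes e: "e > 0" and z: "C1_field z" "supported_in z L" "\<And>x. z x \<in> wulff \<phi>"
    and L: "\<And>x. x \<in> L \<Longrightarrow> cball x e \<subseteq> \<Omega>"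
  obtains Y where "Y \<in> admissible \<phi> \<Omega>" "\<And>x. div_field Y x = (LBINT t. mollifier e t * div_field z (x + t))"
proof -
  define Y where "Y x = (\<chi> i. LBINT t. mollifier e t * z (x + t) $ i)" for x
  have C: "C1 (\<lambda>x. z x $ i)" and S: "supported_in (\<lambda>x. z x $ i) L" for i
    using z(1,2) by (auto simp: C1_field_def supported_in_def)
  note mi = mollifier_integrable[OF e]
  have C1Y: "C1_field Y"
    unfolding C1_field_def Y_def using C1_convolution[OF mi _ C S, of "\<lambda>t. t"] by simp
  have im: "integrable lborel (\<lambda>t. mollifier e t * f (x + t))"
    if f: "continuous_on UNIV f" "supported_in f L" for f :: "real^2 \<Rightarrow> real" and x
  proof -
    obtain B where "\<And>x. \<bar>f x\<bar> \<le> B" using supported_in_bounded[OF f] by auto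
    moreover have [measurable]: "f \<in> borel_measurable borel" by (rule borel_measurable_continuous_onI[OF f(1)])
    ultimately show ?thesis by (intro integrable_mult_bounded[OF mi]) auto
  qed
  have divY: "div_field Y x = (LBINT t. mollifier e t * div_field z (x + t))" for x
  proof -
    have gi: "integrable lborel (\<lambda>t. mollifier e t * grad (\<lambda>y. z y $ i) (x + t) $ i)" for i
      using supported_in_grad[OF S, of i]
      by (intro im[of "\<lambda>y. grad (\<lambda>y. z y $ i) y $ i"] continuous_intros C1_continuous_grad C) (auto simp: supported_in_def)
    have gvi: "integrable lborel (\<lambda>t. mollifier e t *\<^sub>R grad (\<lambda>y. z y $ i) (x + t))" for i
    proof -
      obtain B where B: "\<And>x. norm (grad (\<lambda>y. z y $ i) x) \<le> B"
        using supported_in_bounded[OF C1_continuous_grad[OF C] supported_in_grad[OF S]] by metis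
      note [measurable] = borel_measurable_grad[OF C]
      show ?thesis
      proof (rule Bochner_Integration.integrable_bound)
        show "integrable lborel (\<lambda>t. mollifier e t * B)" using mi by simp
        have "norm (mollifier e t *\<^sub>R grad (\<lambda>y. z y $ i) (x + t)) \<le> norm (mollifier e t * B)" for t
          using B[of "x + t"] by (simp add: abs_mult mult_left_mono order_trans[OF _ abs_ge_self])
        then show "AE t in lborel. norm (mollifier e t *\<^sub>R grad (\<lambda>y. z y $ i) (x + t)) \<le> norm (mollifier e t * B)"
          by simp
      qed measurable
    qed
    have "grad (\<lambda>y. Y y $ i) x $ i = (LBINT t. mollifier e t * grad (\<lambda>y. z y $ i) (x + t) $ i)" for i
    proof -
      have "grad (\<lambda>y. Y y $ i) x = (LBINT t. mollifier e t *\<^sub>R grad (\<lambda>y. z y $ i) (x + t))"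
        unfolding Y_def using grad_convolution[OF mi _ C S, of "\<lambda>t. t"] by simp
      then have "grad (\<lambda>y. Y y $ i) x $ i = (LBINT t. mollifier e t *\<^sub>R grad (\<lambda>y. z y $ i) (x + t)) \<bullet> axis i 1"
        by (simp add: inner_axis)
      also have "\<dots> = (LBINT t. (mollifier e t *\<^sub>R grad (\<lambda>y. z y $ i) (x + t)) \<bullet> axis i 1)"
        by (rule integral_inner_left[symmetric]) (rule gvi)
      finally show ?thesis by (simp add: inner_axis)
    qed
    then have "div_field Y x = (\<Sum>i\<in>UNIV. LBINT t. mollifier e t * grad (\<lambda>y. z y $ i) (x + t) $ i)"
      by (simp add: div_field_eq[OF C1Y])
    also have "\<dots> = (LBINT t. mollifier e t * div_field z (x + t))"
      unfolding div_field_eq[OF z(1)] sum_distrib_left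
      by (rule Bochner_Integration.integral_sum[symmetric]) (rule gi)
    finally show ?thesis .
  qed
  have supp: "supported_in Y (nbhd L e)"
    unfolding supported_in_def
  proof (intro conjI allI impI)
    show "compact (nbhd L e)" using z(2) by (intro compact_nbhd) (simp add: supported_in_def)
    fix x assume x: "x \<notin> nbhd L e"
    have m0: "mollifier e t * z (x + t) $ i = 0" for t i
    proof (cases "norm t \<le> e")
      case True
      then have "x + t \<notin> L" using x by (auto simp: mem_nbhd dist_norm)
      then show ?thesis using z(2) by (simp add: supported_in_def)
    qed (use mollifier_eq_0[OF e] in simp)
    show "Y x = 0" unfolding Y_def m0 by (simp add: vec_eq_iff)
  qed
  have "nbhd L e \<subseteq> \<Omega>" using L by (auto simp: nbhd_def)
  moreover have "Y x \<in> wulff \<phi>" for x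
    unfolding wulff_def
  proof (intro CollectI allI)
    fix \<xi>
    have ii: "integrable lborel (\<lambda>t. mollifier e t * z (x + t) $ i)" for i
      using S by (intro im[of "\<lambda>y. z y $ i"] C1_continuous C) auto
    have "Y x \<bullet> \<xi> = (\<Sum>i\<in>UNIV. (LBINT t. mollifier e t * z (x + t) $ i) * \<xi> $ i)"
      by (simp add: Y_def inner_vec_def)
    also have "\<dots> = (LBINT t. (\<Sum>i\<in>UNIV. mollifier e t * z (x + t) $ i * \<xi> $ i))"
      using ii by (simp add: Bochner_Integration.integral_sum)
    also have "\<dots> \<le> (LBINT t. mollifier e t * \<phi> \<xi>)"
    proof (rule integral_mono)
      fix t
      have "(\<Sum>i\<in>UNIV. mollifier e t * z (x + t) $ i * \<xi> $ i) = mollifier e t * (z (x + t) \<bullet> \<xi>)"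
        by (simp add: inner_vec_def sum_distrib_left mult.assoc)
      also have "\<dots> \<le> mollifier e t * \<phi> \<xi>"
        using z(3)[of "x + t"] mollifier_nonneg[OF e] by (intro mult_left_mono) (auto simp: wulff_def)
      finally show "(\<Sum>i\<in>UNIV. mollifier e t * z (x + t) $ i * \<xi> $ i) \<le> mollifier e t * \<phi> \<xi>" .
    qed (use ii mi in auto)
    also have "\<dots> = \<phi> \<xi>" using mollifier_integral[OF e] by simp
    finally show "Y x \<bullet> \<xi> \<le> \<phi> \<xi>" .
  qed
  ultimately have "Y \<in> admissible \<phi> \<Omega>" using C1Y supp unfolding admissible_def by blast
  then show ?thesis using that divY by blast
qed

lemma integral_lebesgue_on_eq_lborel:
  assumes "open \<Omega>" "z \<in> admissible \<phi> \<Omega>" "w \<in> borel_measurable borel"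
  shows "(LINT x|lebesgue_on \<Omega>. w x * div_field z x) = (LBINT x. w x * div_field z x)"
proof -
  obtain K where z: "C1_field z" "supported_in z K" "K \<subseteq> \<Omega>"
    using assms(2) unfolding admissible_def by blast
  have "div_field z x = 0" if "x \<notin> \<Omega>" for x
    using supported_in_div[OF z(1,2)] z(3) that by (auto simp: supported_in_def)
  then have ind: "indicator \<Omega> x *\<^sub>R (w x * div_field z x) = w x * div_field z x" for x
    by (auto simp: indicator_def)
  have "(LINT x|lebesgue_on \<Omega>. w x * div_field z x) = (\<integral>x. indicator \<Omega> x *\<^sub>R (w x * div_field z x) \<partial>lebesgue)"
    by (rule integral_restrict_space) (use assms(1) in simp)
  also have "\<dots> = (\<integral>x. w x * div_field z x \<partial>lebesgue)"
    unfolding ind ..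
  also have "\<dots> = (LBINT x. w x * div_field z x)"
    using assms(3) borel_measurable_div_field[OF z(1)] by (intro integral_completion) auto
  finally show ?thesis .
qed

lemma smooth_cut_integrable:
  assumes v: "integrable lborel v" and z: "z \<in> admissible \<phi> \<Omega>" and k: "k > 0"
  shows "integrable lborel (\<lambda>x. (v x - step k (n \<bullet> x - c) * ramp k (v x - M)) * div_field z x)"
    and "\<bar>(v x - step k (n \<bullet> x - c) * ramp k (v x - M)) * div_field z x\<bar>
       \<le> (2 * \<bar>v x\<bar> + \<bar>M\<bar>) * \<bar>div_field z x\<bar>"
    and "integrable lborel (\<lambda>x. (2 * \<bar>v x\<bar> + \<bar>M\<bar>) * \<bar>div_field z x\<bar>)"
proof -
  obtain B where B: "B > 0" "\<And>x. \<bar>div_field z x\<bar> \<le> B" and [measurable]: "div_field z \<in> borel_measurable borel"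
    using admissible_div[OF z] by metis
  have [measurable]: "v \<in> borel_measurable borel" using v by auto
  have [measurable]: "step k \<in> borel_measurable borel" "ramp k \<in> borel_measurable borel"
    by (intro borel_measurable_continuous_onI continuous_step continuous_ramp k)+
  obtain K where zK: "C1_field z" "supported_in z K" using z unfolding admissible_def by blast
  have di: "integrable lborel (div_field z)"
    by (rule integrable_continuous_supported[OF continuous_div_field[OF zK(1)] supported_in_div[OF zK]])
  have "integrable lborel (\<lambda>x. 2 * (\<bar>v x\<bar> * \<bar>div_field z x\<bar>) + \<bar>M\<bar> * \<bar>div_field z x\<bar>)"
    using v di B(2) by (intro Bochner_Integration.integrable_add integrable_mult_right integrable_mult_bounded) auto
  then show i: "integrable lborel (\<lambda>x. (2 * \<bar>v x\<bar> + \<bar>M\<bar>) * \<bar>div_field z x\<bar>)"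
    by (simp add: algebra_simps)
  show le: "\<bar>(v x - step k (n \<bullet> x - c) * ramp k (v x - M)) * div_field z x\<bar>
       \<le> (2 * \<bar>v x\<bar> + \<bar>M\<bar>) * \<bar>div_field z x\<bar>" for x
  proof -
    have "\<bar>step k (n \<bullet> x - c) * ramp k (v x - M)\<bar> \<le> 1 * \<bar>v x - M\<bar>"
      unfolding abs_mult using step_bounds ramp_bounds[OF k] by (intro mult_mono) auto
    then have "\<bar>v x - step k (n \<bullet> x - c) * ramp k (v x - M)\<bar> \<le> 2 * \<bar>v x\<bar> + \<bar>M\<bar>"
      using abs_triangle_ineq4[of "v x" "step k (n \<bullet> x - c) * ramp k (v x - M)"] abs_triangle_ineq4[of "v x" M]
      by linarith
    then show ?thesis unfolding abs_mult by (rule mult_right_mono) simp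
  qed
  show "integrable lborel (\<lambda>x. (v x - step k (n \<bullet> x - c) * ramp k (v x - M)) * div_field z x)"
    by (rule Bochner_Integration.integrable_bound[OF i])
       (use le in \<open>auto intro: order_trans[OF _ abs_ge_self]\<close>)
qed

text \<open>
  The calibrated cut of the smoothed function \<open>smoothing e w\<close> is tested by a field \<open>Z\<close>, and moving the
  smoothing onto \<open>Z\<close> yields an admissible field for \<open>w\<close>. The bound \<open>w \<le> M\<close> on the cap near the boundary
  survives the smoothing on the smaller cap \<open>n \<bullet> x > c'\<close>, for small \<open>e\<close>. Since \<open>ramp k\<close> is a contraction, the
  \<open>L\<^sup>1\<close> convergence of the smoothed functions suffices to let \<open>e\<close> tend to 0.
\<close>

lemma smooth_cut_le_total_variation:
  fixes n :: "real^2"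
  assumes \<Omega>: "open \<Omega>" and \<phi>: "metric_integrand \<phi>" and w: "integrable lborel w"
    and K: "compact K" "K \<subseteq> \<Omega>" "\<And>x. x \<in> \<Omega> \<Longrightarrow> x \<notin> K \<Longrightarrow> n \<bullet> x > c \<Longrightarrow> w x \<le> M"
    and z: "z \<in> admissible \<phi> \<Omega>" and k: "k > 0" and c': "c' > c"
  shows "ereal (LBINT x. (w x - step k (n \<bullet> x - c') * ramp k (w x - M)) * div_field z x)
     \<le> total_variation \<phi> \<Omega> w"
proof -
  obtain Kz where zf: "C1_field z" "supported_in z Kz" "Kz \<subseteq> \<Omega>" "\<And>x. z x \<in> wulff \<phi>"
    using z unfolding admissible_def by blast
  obtain B where B: "B > 0" "\<And>x. \<bar>div_field z x\<bar> \<le> B"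
    using admissible_div[OF z] by metis
  have cC: "compact (K \<union> Kz)" "K \<union> Kz \<subseteq> \<Omega>" using K zf(2,3) by (auto simp: supported_in_def)
  obtain \<eta> L r where r: "r > 0" and \<eta>: "C1 \<eta>" "supported_in \<eta> L" "\<And>x. 0 \<le> \<eta> x" "\<And>x. \<eta> x \<le> 1"
    "\<And>x. x \<in> K \<union> Kz \<Longrightarrow> \<eta> x = 1" "\<And>x. grad \<eta> x \<noteq> 0 \<Longrightarrow> cball x r \<subseteq> \<Omega> - (K \<union> Kz)"
    "\<And>x. x \<in> L \<Longrightarrow> cball x r \<subseteq> \<Omega>"
    by (rule cutoff_exists[OF \<Omega> cC]) (rule that; assumption)
  obtain z0 where z0: "z0 \<in> wulff \<phi>" "z0 \<bullet> n = \<phi> n" using wulff_support[OF \<phi>] by blast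
  have \<eta>z: "\<eta> x = 1" if "z x \<noteq> 0" for x using that zf(2) \<eta>(5)[of x] by (auto simp: supported_in_def)
  define A where "A v = (LBINT x. (v x - step k (n \<bullet> x - c') * ramp k (v x - M)) * div_field z x)" for v :: "real^2 \<Rightarrow> real"
  have wm: "w \<in> borel_measurable borel" using w by auto
  define r' where "r' = min r ((c' - c) / (norm n + 1))"
  have "r' > 0" using r c' by (simp add: r'_def add_nonneg_pos)
  have le: "ereal (A (smoothing e w)) \<le> total_variation \<phi> \<Omega> w" if e: "0 < e" "e < r'" for e
  proof -
    have ne: "norm n * e < c' - c"
    proof -
      have "norm n * e \<le> (norm n + 1) * e" using e by simp
      also have "\<dots> < c' - c" using e by (simp add: r'_def pos_less_divide_eq add_nonneg_pos mult.commute)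
      finally show ?thesis .
    qed
    have cap: "smoothing e w x \<le> M" if x: "n \<bullet> x > c'" "grad \<eta> x \<noteq> 0" for x
    proof (rule smoothing_le[OF e(1) w])
      fix y assume y: "y \<in> cball x e"
      then have "y \<in> cball x r" using e by (simp add: r'_def)
      with \<eta>(6)[OF x(2)] have 1: "y \<in> \<Omega>" "y \<notin> K" by auto
      have "n \<bullet> (x - y) \<le> norm n * norm (x - y)" by (rule norm_cauchy_schwarz)
      also have "\<dots> \<le> norm n * e" using y by (intro mult_left_mono) (auto simp: dist_norm)
      finally have "n \<bullet> y > c" using ne x(1) by (simp add: inner_diff_right)
      with 1 show "w y \<le> M" by (rule K(3))
    qed
    obtain Z where Z: "C1_field Z" "supported_in Z L" "\<And>x. Z x \<in> wulff \<phi>"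
      and AZ: "A (smoothing e w) \<le> (LBINT x. smoothing e w x * div_field Z x)"
      unfolding A_def
      by (rule calibrated_cut[where c=c' and M=M, OF \<phi> C1_smoothing[OF e(1) w] k zf(1,2,4) \<eta>(1,2,3,4) \<eta>z z0 cap], assumption, assumption, assumption)
        (rule that[unfolded A_def]; assumption)
    have eL: "cball x e \<subseteq> \<Omega>" if "x \<in> L" for x
      using \<eta>(7)[OF that] e by (auto simp: r'_def subset_eq)
    obtain Y where Y: "Y \<in> admissible \<phi> \<Omega>"
      "\<And>x. div_field Y x = (LBINT t. mollifier e t * div_field Z (x + t))"
      by (rule smoothing_field_admissible[OF e(1) Z eL], assumption) (rule that; assumption)
    obtain B' where B': "\<And>x. \<bar>div_field Z x\<bar> \<le> B'"
      using supported_in_bounded[OF continuous_div_field[OF Z(1)] supported_in_div[OF Z(1,2)]] by auto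
    have "(LBINT x. smoothing e w x * div_field Z x) = (LBINT x. w x * div_field Y x)"
      using smoothing_adjoint[OF e(1) w borel_measurable_div_field[OF Z(1)] B'] by (simp add: Y(2))
    also have "\<dots> = (LINT x|lebesgue_on \<Omega>. w x * div_field Y x)"
      by (rule integral_lebesgue_on_eq_lborel[OF \<Omega> Y(1) wm, symmetric])
    finally have "ereal (LBINT x. smoothing e w x * div_field Z x) \<le> total_variation \<phi> \<Omega> w"
      using total_variation_ge[OF \<Omega> \<phi> Y(1), of w] by simp
    then show ?thesis using AZ by (metis ereal_less_eq(3) order_trans)
  qed
  have "((\<lambda>e. A (smoothing e w)) \<longlongrightarrow> A w) (at_right 0)"
  proof (rule Lim_transform2)
    show "((\<lambda>e. A w) \<longlongrightarrow> A w) (at_right 0)" by simp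
    have "((\<lambda>e. 2 * B * (LBINT y. \<bar>smoothing e w y - w y\<bar>)) \<longlongrightarrow> 2 * B * 0) (at_right 0)"
      by (intro tendsto_intros smoothing_tendsto_L1 w)
    then have lim0: "((\<lambda>e. 2 * B * (LBINT y. \<bar>smoothing e w y - w y\<bar>)) \<longlongrightarrow> 0) (at_right 0)" by simp
    have nb: "norm (A w - A (smoothing e w)) \<le> 2 * B * (LBINT y. \<bar>smoothing e w y - w y\<bar>)" if e: "0 < e" for e
    proof -
      let ?W = "smoothing e w"
      have si: "integrable lborel ?W" by (rule smoothing_integrable[OF e w])
      have eq: "A w - A ?W = (LBINT x. (w x - step k (n \<bullet> x - c') * ramp k (w x - M)) * div_field z x
           - (?W x - step k (n \<bullet> x - c') * ramp k (?W x - M)) * div_field z x)"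
        unfolding A_def by (rule Bochner_Integration.integral_diff[symmetric]) (intro smooth_cut_integrable[OF _ z k] w si)+
      have "\<bar>A w - A ?W\<bar> \<le> (LBINT x. 2 * B * \<bar>?W x - w x\<bar>)"
        unfolding eq
      proof (rule abs_integral_le)
        show "integrable lborel (\<lambda>x. 2 * B * \<bar>?W x - w x\<bar>)" using si w by simp
        fix x
        let ?s = "step k (n \<bullet> x - c')"
        have "\<bar>?s * (ramp k (w x - M) - ramp k (?W x - M))\<bar> \<le> 1 * \<bar>(w x - M) - (?W x - M)\<bar>"
          unfolding abs_mult using step_bounds ramp_lipschitz[OF k, of "w x - M" "?W x - M"]
          by (intro mult_mono) auto
        then have "\<bar>(w x - ?W x) - ?s * (ramp k (w x - M) - ramp k (?W x - M))\<bar> \<le> 2 * \<bar>?W x - w x\<bar>"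
          using abs_triangle_ineq4[of "w x - ?W x" "?s * (ramp k (w x - M) - ramp k (?W x - M))"]
          by (simp add: abs_minus_commute)
        then have "\<bar>(w x - ?W x) - ?s * (ramp k (w x - M) - ramp k (?W x - M))\<bar> * \<bar>div_field z x\<bar> \<le> (2 * \<bar>?W x - w x\<bar>) * B"
          using B by (intro mult_mono) auto
        moreover have "(w x - ?s * ramp k (w x - M)) * div_field z x - (?W x - ?s * ramp k (?W x - M)) * div_field z x
           = ((w x - ?W x) - ?s * (ramp k (w x - M) - ramp k (?W x - M))) * div_field z x"
          by (simp add: algebra_simps)
        ultimately show "\<bar>(w x - ?s * ramp k (w x - M)) * div_field z x - (?W x - ?s * ramp k (?W x - M)) * div_field z x\<bar>
           \<le> 2 * B * \<bar>?W x - w x\<bar>"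
          by (simp add: abs_mult mult_ac)
      qed
      then show ?thesis by simp
    qed
    show "((\<lambda>e. A w - A (smoothing e w)) \<longlongrightarrow> 0) (at_right 0)"
    proof (rule Lim_null_comparison[OF _ lim0])
      show "\<forall>\<^sub>F e in at_right 0. norm (A w - A (smoothing e w))
          \<le> 2 * B * (LBINT y. \<bar>smoothing e w y - w y\<bar>)"
        using eventually_at_right_less[of "0::real"] by eventually_elim (rule nb)
    qed
  qed
  then have "((\<lambda>e. ereal (A (smoothing e w))) \<longlongrightarrow> ereal (A w)) (at_right 0)" by simp
  moreover have "\<forall>\<^sub>F e in at_right 0. ereal (A (smoothing e w)) \<le> total_variation \<phi> \<Omega> w"
    unfolding eventually_at_right_field using le \<open>r' > 0\<close> by blast
  ultimately have "ereal (A w) \<le> total_variation \<phi> \<Omega> w"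
    by (rule tendsto_upperbound) (rule trivial_limit_at_right_real)
  then show ?thesis by (simp add: A_def)
qed

lemma cap_truncation_borel:
  fixes n :: "real^2"
  assumes \<Omega>: "open \<Omega>" and \<phi>: "metric_integrand \<phi>" and w: "integrable lborel w"
    and K: "compact K" "K \<subseteq> \<Omega>" "\<And>x. x \<in> \<Omega> \<Longrightarrow> x \<notin> K \<Longrightarrow> n \<bullet> x > c \<Longrightarrow> w x \<le> M"
  shows "total_variation \<phi> \<Omega> (\<lambda>x. if n \<bullet> x > c then min M (w x) else w x) \<le> total_variation \<phi> \<Omega> w"
proof (rule total_variation_le[OF \<Omega> \<phi>])
  fix z assume z: "z \<in> admissible \<phi> \<Omega>"
  have [measurable]: "w \<in> borel_measurable borel" using w by auto
  obtain B where B: "B > 0" "\<And>x. \<bar>div_field z x\<bar> \<le> B" and [measurable]: "div_field z \<in> borel_measurable borel"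
    using admissible_div[OF z] by metis
  let ?t = "\<lambda>x. if n \<bullet> x > c then min M (w x) else w x"
  let ?f = "\<lambda>j x. (w x - step (real (Suc j)) (n \<bullet> x - (c + 1 / real (Suc j))) * ramp (real (Suc j)) (w x - M)) * div_field z x"
  have "(\<lambda>j. LBINT x. ?f j x) \<longlonglongrightarrow> (LBINT x. ?t x * div_field z x)"
  proof (rule integral_dominated_convergence[where w="\<lambda>x. (2 * \<bar>w x\<bar> + \<bar>M\<bar>) * \<bar>div_field z x\<bar>"])
    show "(\<lambda>x. ?t x * div_field z x) \<in> borel_measurable lborel" by measurable
    show "?f j \<in> borel_measurable lborel" for j
      by (rule borel_measurable_integrable) (rule smooth_cut_integrable(1)[OF w z], simp)
    show "integrable lborel (\<lambda>x. (2 * \<bar>w x\<bar> + \<bar>M\<bar>) * \<bar>div_field z x\<bar>)"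
      by (rule smooth_cut_integrable(3)[OF w z zero_less_one])
    show "AE x in lborel. norm (?f j x) \<le> (2 * \<bar>w x\<bar> + \<bar>M\<bar>) * \<bar>div_field z x\<bar>" for j
      unfolding real_norm_def by (intro AE_I2 smooth_cut_integrable(2)[OF w z]) simp
    show "AE x in lborel. (\<lambda>j. ?f j x) \<longlonglongrightarrow> ?t x * div_field z x"
    proof (rule AE_I2)
      fix x
      have s: "(\<lambda>j. step (real (Suc j)) (n \<bullet> x - (c + 1 / real (Suc j)))) \<longlonglongrightarrow> (if n \<bullet> x - c > 0 then 1 else 0)"
        using step_shift_tendsto[of "n \<bullet> x - c"] by (simp only: diff_diff_eq)
      have "(\<lambda>j. ?f j x) \<longlonglongrightarrow> (w x - (if n \<bullet> x - c > 0 then 1 else 0) * max 0 (w x - M)) * div_field z x"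
        by (intro tendsto_intros s ramp_tendsto)
      also have "w x - (if n \<bullet> x - c > 0 then 1 else 0) * max 0 (w x - M) = ?t x" by (auto simp: max_def min_def)
      finally show "(\<lambda>j. ?f j x) \<longlonglongrightarrow> ?t x * div_field z x" .
    qed
  qed
  then have "(\<lambda>j. ereal (LBINT x. ?f j x)) \<longlonglongrightarrow> ereal (LBINT x. ?t x * div_field z x)" by simp
  moreover have "ereal (LBINT x. ?f j x) \<le> total_variation \<phi> \<Omega> w" for j
    by (rule smooth_cut_le_total_variation[OF \<Omega> \<phi> w K z]) auto
  ultimately have "ereal (LBINT x. ?t x * div_field z x) \<le> total_variation \<phi> \<Omega> w"
    using LIMSEQ_le_const2 by blast
  moreover have "(LINT x|lebesgue_on \<Omega>. ?t x * div_field z x) = (LBINT x. ?t x * div_field z x)"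
    by (rule integral_lebesgue_on_eq_lborel[OF \<Omega> z]) measurable
  ultimately show "ereal (LINT x|lebesgue_on \<Omega>. ?t x * div_field z x) \<le> total_variation \<phi> \<Omega> w" by simp
qed

text \<open>
  Half-planes minimise the anisotropic perimeter, so cutting off at height \<open>M\<close>, on the cap
  \<open>n \<bullet> x > c\<close>, the part of a function that exceeds \<open>M\<close> on a compact subset does not increase the
  variation. The function may be arbitrary on the other side of the line: the jump created along the line
  is paid for by the variation removed inside the cap.
\<close>

lemma cap_truncation:
  fixes n :: "real^2"
  assumes \<Omega>: "open \<Omega>" and \<phi>: "metric_integrand \<phi>" and w: "integrable (lebesgue_on \<Omega>) w"
    and K: "compact K" "K \<subseteq> \<Omega>" "AE x in lebesgue_on \<Omega>. x \<notin> K \<longrightarrow> n \<bullet> x > c \<longrightarrow> w x \<le> M"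
  shows "total_variation \<phi> \<Omega> (\<lambda>x. if n \<bullet> x > c then min M (w x) else w x) \<le> total_variation \<phi> \<Omega> w"
proof -
  have wl: "integrable lebesgue (\<lambda>x. indicator \<Omega> x *\<^sub>R w x)"
    using w \<Omega> by (subst (asm) integrable_restrict_space) auto
  then obtain g where g [measurable]: "g \<in> borel_measurable lborel" and "AE x in lborel. indicator \<Omega> x *\<^sub>R w x = g x"
    using completion_ex_borel_measurable_real[OF borel_measurable_integrable[OF wl]] by blast
  then have gw: "AE x in lebesgue. indicator \<Omega> x *\<^sub>R w x = g x" by (intro AE_completion)
  have gm: "g \<in> borel_measurable lebesgue" using g by (rule measurable_completion)
  have "integrable lebesgue g"
    using integrable_cong_AE[OF borel_measurable_integrable[OF wl] gm gw] wl by simp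
  then have gi: "integrable lborel g" using g by (simp add: integrable_completion)
  define w0 where "w0 x = (if x \<in> \<Omega> - K \<and> n \<bullet> x > c then min M (g x) else g x)" for x
  have [measurable]: "\<Omega> \<in> sets borel" "K \<in> sets borel" using \<Omega> K(1) by (auto intro: borel_closed compact_imp_closed)
  have w0m [measurable]: "w0 \<in> borel_measurable borel" unfolding w0_def using g by measurable
  have "AE x in lebesgue. w0 x = g x"
    using gw K(3)[unfolded AE_lebesgue_on_iff[OF \<Omega>]] by eventually_elim (auto simp: w0_def)
  then have ae0: "AE x in lborel. w0 x = g x" by (simp add: AE_completion_iff)
  have w0i: "integrable lborel w0"
    using integrable_cong_AE[of w0 lborel g] ae0 gi g by simp
  have ae: "AE x in lebesgue_on \<Omega>. w0 x = w x"
    unfolding AE_lebesgue_on_iff[OF \<Omega>] using gw AE_completion[OF ae0] by eventually_elim auto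
  have w0l: "w0 \<in> borel_measurable (lebesgue_on \<Omega>)"
    by (intro measurable_restrict_space1 measurable_completion) simp
  note wlm [measurable] = borel_measurable_integrable[OF w]
  have hs: "{x \<in> space (lebesgue_on \<Omega>). n \<bullet> x > c} \<in> sets (lebesgue_on \<Omega>)"
  proof -
    have "(\<lambda>x. n \<bullet> x) \<in> borel_measurable (lebesgue_on \<Omega>)"
      by (intro measurable_restrict_space1 measurable_completion) simp
    then show ?thesis by measurable
  qed
  have tm: "(\<lambda>x. if n \<bullet> x > c then min M (f x) else f x) \<in> borel_measurable (lebesgue_on \<Omega>)"
    if "f \<in> borel_measurable (lebesgue_on \<Omega>)" for f
    by (rule measurable_If) (use that hs in auto)
  have "total_variation \<phi> \<Omega> (\<lambda>x. if n \<bullet> x > c then min M (w x) else w x)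
      = total_variation \<phi> \<Omega> (\<lambda>x. if n \<bullet> x > c then min M (w0 x) else w0 x)"
    using ae by (intro total_variation_cong_AE[OF _ tm[OF wlm] tm[OF w0l] \<Omega> \<phi>]) (auto elim!: eventually_mono)
  also have "\<dots> \<le> total_variation \<phi> \<Omega> w0"
    by (rule cap_truncation_borel[OF \<Omega> \<phi> w0i K(1,2)]) (simp add: w0_def)
  also have "\<dots> = total_variation \<phi> \<Omega> w"
    by (rule total_variation_cong_AE[OF ae w0l wlm \<Omega> \<phi>])
  finally show ?thesis .
qed

lemma cap_truncation_ge:
  fixes n :: "real^2"
  assumes \<Omega>: "open \<Omega>" and \<phi>: "metric_integrand \<phi>" and w: "integrable (lebesgue_on \<Omega>) w"
    and K: "compact K" "K \<subseteq> \<Omega>" "AE x in lebesgue_on \<Omega>. x \<notin> K \<longrightarrow> n \<bullet> x > c \<longrightarrow> m \<le> w x"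
  shows "total_variation \<phi> \<Omega> (\<lambda>x. if n \<bullet> x > c then max m (w x) else w x) \<le> total_variation \<phi> \<Omega> w"
proof -
  have "AE x in lebesgue_on \<Omega>. x \<notin> K \<longrightarrow> n \<bullet> x > c \<longrightarrow> - w x \<le> - m"
    using K(3) by eventually_elim auto
  then have "total_variation \<phi> \<Omega> (\<lambda>x. if n \<bullet> x > c then min (- m) (- w x) else - w x) \<le> total_variation \<phi> \<Omega> (\<lambda>x. - w x)"
    using w by (intro cap_truncation[OF \<Omega> \<phi> _ K(1,2)]) auto
  moreover have "(\<lambda>x. if n \<bullet> x > c then min (- m) (- w x) else - w x) = (\<lambda>x. - (if n \<bullet> x > c then max m (w x) else w x))"
    by (auto simp: max_def min_def)
  ultimately show ?thesis by (simp add: total_variation_uminus[OF \<Omega> \<phi>])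
qed

section \<open>An extension of the boundary data with finite total variation\<close>

text \<open>
  The infimal convolution of \<open>f\<close> with a steep cone. If \<open>f\<close> is bounded by \<open>M\<close> and varies by less than
  \<open>\<tau>\<close> over distances below \<open>d\<close>, the slope \<open>2 * M / d\<close> keeps points farther away than \<open>d\<close> from lowering the
  infimum.
\<close>

lemma lipschitz_approximation:
  fixes f :: "real^2 \<Rightarrow> real"
  assumes S: "compact S" and f: "continuous_on S f" and "\<tau> > 0"
  obtains G \<Lambda> where "\<Lambda> \<ge> 0" "\<And>x y. \<bar>G x - G y\<bar> \<le> \<Lambda> * norm (x - y)" "\<And>x. x \<in> S \<Longrightarrow> \<bar>G x - f x\<bar> \<le> \<tau>"
proof (cases "S = {}")
  case True
  then show ?thesis using that[of 0 "\<lambda>x. 0"] by simp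
next
  case False
  obtain M where M: "M > 0" "\<And>x. x \<in> S \<Longrightarrow> \<bar>f x\<bar> \<le> M"
  proof -
    have "bounded (f ` S)" using compact_continuous_image[OF f S] compact_imp_bounded by blast
    then show ?thesis using that unfolding bounded_pos by auto
  qed
  obtain d where d: "d > 0" "\<And>x y. x \<in> S \<Longrightarrow> y \<in> S \<Longrightarrow> dist y x < d \<Longrightarrow> dist (f y) (f x) < \<tau>"
    using compact_uniformly_continuous[OF f S] \<open>\<tau> > 0\<close> unfolding uniformly_continuous_on_def by metis
  define \<Lambda> where "\<Lambda> = 2 * M / d"
  have "\<Lambda> > 0" "\<Lambda> * d = 2 * M" using M(1) d(1) by (simp_all add: \<Lambda>_def)
  define G where "G x = (INF y\<in>S. f y + \<Lambda> * norm (x - y))" for x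
  have bdd: "bdd_below ((\<lambda>y. f y + \<Lambda> * norm (x - y)) ` S)" for x
  proof (rule bdd_belowI2)
    fix y assume "y \<in> S"
    then have "- M \<le> f y" using M(2) by fastforce
    moreover have "0 \<le> \<Lambda> * norm (x - y)" using \<open>\<Lambda> > 0\<close> by simp
    ultimately show "- M \<le> f y + \<Lambda> * norm (x - y)" by linarith
  qed
  have one: "G x - \<Lambda> * norm (x - y) \<le> G y" for x y
    unfolding G_def[of y]
  proof (rule cINF_greatest[OF False])
    fix s assume s: "s \<in> S"
    have "G x \<le> f s + \<Lambda> * norm (x - s)" unfolding G_def by (rule cINF_lower[OF bdd s])
    also have "\<dots> \<le> f s + \<Lambda> * (norm (x - y) + norm (y - s))"
      using \<open>\<Lambda> > 0\<close> norm_triangle_ineq[of "x - y" "y - s"] by simp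
    finally show "G x - \<Lambda> * norm (x - y) \<le> f s + \<Lambda> * norm (y - s)" by (simp add: algebra_simps)
  qed
  show ?thesis
  proof (rule that[of \<Lambda> G])
    show "\<bar>G x - G y\<bar> \<le> \<Lambda> * norm (x - y)" for x y
      using one[of x y] one[of y x] by (simp add: norm_minus_commute abs_le_iff)
    fix x assume x: "x \<in> S"
    have "G x \<le> f x + \<Lambda> * norm (x - x)" unfolding G_def by (rule cINF_lower[OF bdd x])
    moreover have "f x - \<tau> \<le> G x"
      unfolding G_def
    proof (rule cINF_greatest[OF False])
      fix y assume y: "y \<in> S"
      show "f x - \<tau> \<le> f y + \<Lambda> * norm (x - y)"
      proof (cases "dist y x < d")
        case True
        then have "f x - \<tau> \<le> f y" using d(2)[OF x y] by (simp add: dist_real_def)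
        moreover have "0 \<le> \<Lambda> * norm (x - y)" using \<open>\<Lambda> > 0\<close> by simp
        ultimately show ?thesis by linarith
      next
        case False
        then have "\<Lambda> * d \<le> \<Lambda> * norm (x - y)"
          using \<open>\<Lambda> > 0\<close> by (intro mult_left_mono) (auto simp: dist_norm norm_minus_commute)
        then show ?thesis using M(2)[OF x] M(2)[OF y] \<open>\<Lambda> * d = 2 * M\<close> \<open>\<tau> > 0\<close> by linarith
      qed
    qed
    ultimately show "\<bar>G x - f x\<bar> \<le> \<tau>" using \<open>\<tau> > 0\<close> by (simp add: abs_le_iff)
  qed (use \<open>\<Lambda> > 0\<close> in simp)
qed

lemma infdist_lessD:
  fixes x :: "'a::heine_borel"
  assumes "closed A" "A \<noteq> {}" "infdist x A < d"
  obtains a where "a \<in> A" "dist x a < d"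
  using infdist_attains_inf[OF assms(1,2), of x] assms(3) by metis

definition boundary_layer :: "(real^2) set \<Rightarrow> real \<Rightarrow> (real^2) set" where
  "boundary_layer \<Omega> \<delta> = {x \<in> \<Omega>. infdist x (frontier \<Omega>) < \<delta>}"

lemma open_boundary_layer: "open \<Omega> \<Longrightarrow> open (boundary_layer \<Omega> \<delta>)"
proof -
  assume "open \<Omega>"
  have "open {x. infdist x (frontier \<Omega>) < \<delta>}"
    by (intro open_Collect_less continuous_intros)
  moreover have "boundary_layer \<Omega> \<delta> = \<Omega> \<inter> {x. infdist x (frontier \<Omega>) < \<delta>}"
    by (auto simp: boundary_layer_def)
  ultimately show ?thesis using \<open>open \<Omega>\<close> by auto
qed

text \<open>
  Let the disc of radius \<open>r\<close> about \<open>p\<close> lie in the convex set \<open>\<Omega>\<close>. The homothety with centre \<open>p\<close> and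
  ratio \<open>m = 1 - \<delta> / r\<close> maps \<open>\<Omega>\<close> to a set \<open>T\<close> of points that are at least \<open>\<delta>\<close> away from the
  boundary, so the layer has at most the area \<open>(1 - m\<^sup>2) * measure lebesgue \<Omega>\<close>.
\<close>

lemma boundary_layer_measure:
  assumes \<Omega>: "open \<Omega>" "bounded \<Omega>" "convex \<Omega>" "\<Omega> \<noteq> {}"
  obtains C where "C \<ge> 0" "\<And>\<delta>. \<delta> > 0 \<Longrightarrow> measure lebesgue (boundary_layer \<Omega> \<delta>) \<le> C * \<delta>"
proof -
  obtain p r where p: "r > 0" "ball p r \<subseteq> \<Omega>" using \<Omega>(1,4) by (metis all_not_in_conv open_contains_ball)
  let ?A = "measure lebesgue \<Omega>"
  have \<Omega>m: "\<Omega> \<in> lmeasurable" using \<Omega> by (intro lmeasurable_open)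
  have layer: "boundary_layer \<Omega> \<delta> \<in> sets lebesgue" "boundary_layer \<Omega> \<delta> \<subseteq> \<Omega>" for \<delta>
    using open_boundary_layer[OF \<Omega>(1)] by (auto simp: boundary_layer_def)
  have fr: "frontier \<Omega> \<noteq> {}"
    using \<Omega>(2,4) by (metis frontier_eq_empty not_bounded_UNIV)
  have "measure lebesgue (boundary_layer \<Omega> \<delta>) \<le> 2 * ?A / r * \<delta>" if \<delta>: "\<delta> > 0" for \<delta>
  proof (cases "\<delta> < r")
    case False
    have "measure lebesgue (boundary_layer \<Omega> \<delta>) \<le> ?A * 1"
      using measure_mono_fmeasurable[OF layer(2,1) \<Omega>m] by simp
    also have "\<dots> \<le> ?A * (2 * \<delta> / r)" using False p(1) \<delta> by (intro mult_left_mono) (auto simp: field_simps)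
    finally show ?thesis by (simp add: field_simps)
  next
    case True
    define m where "m = 1 - \<delta> / r"
    have m: "0 < m" "m < 1" "1 - m = \<delta> / r" using True p(1) \<delta> by (auto simp: m_def field_simps)
    define T where "T = (\<lambda>x. m *\<^sub>R x + (1 - m) *\<^sub>R p) ` \<Omega>"
    have deep: "ball x \<delta> \<subseteq> \<Omega>" if x: "x \<in> T" for x
    proof
      fix w assume w: "w \<in> ball x \<delta>"
      obtain y where y: "y \<in> \<Omega>" "x = m *\<^sub>R y + (1 - m) *\<^sub>R p" using x by (auto simp: T_def)
      define q where "q = p + (r / \<delta>) *\<^sub>R (w - x)"
      have "dist p q = r / \<delta> * norm (w - x)" using p(1) \<delta> by (simp add: q_def dist_norm)
      also have "\<dots> < r / \<delta> * \<delta>" using w p(1) \<delta> by (intro mult_strict_left_mono) (auto simp: dist_norm norm_minus_commute)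
      finally have "q \<in> \<Omega>" using p(2) \<delta> by auto
      moreover have "(1 - m) *\<^sub>R q = (1 - m) *\<^sub>R p + (w - x)"
        unfolding q_def scaleR_right_distrib m(3) using p(1) \<delta> by simp
      then have "w = m *\<^sub>R y + (1 - m) *\<^sub>R q" using y(2) by simp
      ultimately show "w \<in> \<Omega>" using convexD[OF \<Omega>(3) y(1), of q m "1 - m"] m by simp
    qed
    have T\<Omega>: "T \<subseteq> \<Omega>" using deep \<delta> by (meson centre_in_ball subset_iff)
    have "open T"
      unfolding T_def using open_affinity[OF \<Omega>(1), of m "(1 - m) *\<^sub>R p"] m(1) by (simp add: add.commute)
    then have Tm: "T \<in> lmeasurable"
      using T\<Omega> \<Omega>(2) by (intro lmeasurable_open) (auto intro: bounded_subset)
    have measT: "measure lebesgue T = m\<^sup>2 * ?A"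
      unfolding T_def using measure_lebesgue_affine[of m "(1 - m) *\<^sub>R p" \<Omega>] by simp
    have "boundary_layer \<Omega> \<delta> \<subseteq> \<Omega> - T"
    proof
      fix x assume x: "x \<in> boundary_layer \<Omega> \<delta>"
      then obtain b where b: "b \<in> frontier \<Omega>" "dist x b < \<delta>"
        using infdist_lessD[OF frontier_closed fr] by (auto simp: boundary_layer_def)
      have "b \<notin> \<Omega>" using b(1) \<Omega>(1) by (simp add: frontier_def interior_open)
      moreover have "b \<in> ball x \<delta>" using b(2) by simp
      ultimately have "x \<notin> T" using deep by blast
      then show "x \<in> \<Omega> - T" using x by (simp add: boundary_layer_def)
    qed
    then have "measure lebesgue (boundary_layer \<Omega> \<delta>) \<le> measure lebesgue (\<Omega> - T)"
      using layer(1) \<Omega>m Tm by (intro measure_mono_fmeasurable) (auto intro: fmeasurable.Diff)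
    also have "\<dots> = ?A - m\<^sup>2 * ?A"
      using measurable_measure_Diff[OF \<Omega>m _ T\<Omega>] Tm measT by (simp add: fmeasurableD)
    also have "\<dots> = (1 - m) * (1 + m) * ?A" by (simp add: power2_eq_square algebra_simps)
    also have "\<dots> \<le> (1 - m) * 2 * ?A" using m by (intro mult_right_mono mult_left_mono) auto
    also have "\<dots> = 2 * ?A / r * \<delta>" using m(3) by simp
    finally show ?thesis .
  qed
  then show ?thesis using that[of "2 * ?A / r"] p(1) by simp
qed

lemma lipschitz_continuous_on:
  fixes g :: "real^2 \<Rightarrow> real"
  assumes "\<And>x y. \<bar>g x - g y\<bar> \<le> \<Lambda> * norm (x - y)"
  shows "continuous_on A g"
proof -
  have "0 \<le> \<bar>g (axis 1 1) - g 0\<bar>" by simp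
  then have "\<Lambda> \<ge> 0" using assms[of "axis 1 1" 0] by (simp add: norm_axis_1)
  then have "\<Lambda>-lipschitz_on A g"
    using assms by (intro lipschitz_onI) (auto simp: dist_real_def dist_norm)
  then show ?thesis by (rule lipschitz_on_continuous_on)
qed

text \<open>
  The difference quotients of \<open>g\<close> are bounded by its Lipschitz constant and vanish where \<open>g\<close> is zero
  nearby, so only the area of \<open>N\<close> counts. The factor 2 is the number of coordinates.
\<close>

lemma lipschitz_pairing:
  assumes \<Omega>: "open \<Omega>" "bounded \<Omega>" and z: "z \<in> admissible \<phi> \<Omega>" and R: "\<And>x. norm (z x) \<le> R"
    and g: "\<And>x y. \<bar>g x - g y\<bar> \<le> \<Lambda> * norm (x - y)"
    and N: "N \<in> lmeasurable" "N \<in> sets borel" and \<delta>: "\<delta> > 0"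
    and off: "\<And>x y. x \<in> \<Omega> \<Longrightarrow> y \<in> \<Omega> \<Longrightarrow> dist x y < \<delta> \<Longrightarrow> x \<notin> N \<Longrightarrow> g y = 0"
  shows "\<bar>LINT x|lebesgue_on \<Omega>. g x * div_field z x\<bar> \<le> 2 * (\<Lambda> * R * measure lebesgue N)"
proof -
  obtain K where zf: "C1_field z" "supported_in z K" "K \<subseteq> \<Omega>"
    using z unfolding admissible_def by blast
  have C: "C1 (\<lambda>x. z x $ i)" and S: "supported_in (\<lambda>x. z x $ i) K" for i
    using zf by (auto simp: C1_field_def supported_in_def)
  have "R \<ge> 0" using R[of 0] norm_ge_zero order_trans by blast
  have "0 \<le> \<bar>g (axis 1 1) - g 0\<bar>" by simp
  then have "\<Lambda> \<ge> 0" using g[of "axis 1 1" 0] by (simp add: norm_axis_1)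
  have gc: "continuous_on UNIV g" by (rule lipschitz_continuous_on[OF g])
  define g0 where "g0 x = indicator \<Omega> x * g x" for x
  have [measurable]: "\<Omega> \<in> sets borel" "g \<in> borel_measurable borel"
    using \<Omega>(1) gc by (auto intro: borel_measurable_continuous_onI)
  have [measurable]: "g0 \<in> borel_measurable borel" unfolding g0_def[abs_def] by measurable
  have g0i: "integrable lborel g0"
  proof -
    have "integrable lborel (\<lambda>x. indicator (closure \<Omega>) x *\<^sub>R g x)"
      using \<Omega>(2) by (intro borel_integrable_compact continuous_on_subset[OF gc]) (auto simp: compact_closure)
    then show ?thesis
      by (rule Bochner_Integration.integrable_bound)
         (use closure_subset[of \<Omega>] in \<open>auto simp: g0_def indicator_def\<close>)
  qed
  obtain r where r: "r > 0" "(\<Union>x\<in>K. cball x r) \<subseteq> \<Omega>"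
    using compact_subset_open_imp_cball_epsilon_subset[OF _ \<Omega>(1) zf(3)] zf(2) by (auto simp: supported_in_def)
  have Nfin: "emeasure lborel N < \<infinity>"
    using N by (simp add: fmeasurable_def)
  have Ni: "integrable lborel (indicator N :: _ \<Rightarrow> real)"
    by (rule integrable_real_indicator) (use N(2) Nfin in auto)
  have comp: "\<bar>LBINT x. g0 x * (grad (\<lambda>x. z x $ i) x \<bullet> axis i 1)\<bar> \<le> \<Lambda> * R * measure lebesgue N" for i
  proof (rule tendsto_upperbound[OF tendsto_rabs[OF integral_diff_quotient_tendsto[OF g0i C S]] _ trivial_limit_at_right_real])
    let ?e = "axis i 1 :: real^2"
    have "\<bar>(LBINT x. (g0 (x - h *\<^sub>R ?e) - g0 x) * z x $ i) / h\<bar> \<le> \<Lambda> * R * measure lebesgue N"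
      if h: "0 < h" "h < min \<delta> r" for h
    proof -
      have "\<bar>LBINT x. (g0 (x - h *\<^sub>R ?e) - g0 x) * z x $ i\<bar> \<le> (LBINT x. \<Lambda> * h * R * indicator N x)"
      proof (rule abs_integral_le)
        show "integrable lborel (\<lambda>x. \<Lambda> * h * R * indicator N x)" using Ni by simp
        fix x
        show "\<bar>(g0 (x - h *\<^sub>R ?e) - g0 x) * z x $ i\<bar> \<le> \<Lambda> * h * R * indicator N x"
        proof (cases "x \<in> K")
          case False
          then show ?thesis using zf(2) \<open>\<Lambda> \<ge> 0\<close> \<open>R \<ge> 0\<close> h by (simp add: supported_in_def)
        next
          case True
          have dx: "dist x (x - h *\<^sub>R ?e) = h" using h by (simp add: dist_norm norm_axis_1)
          have x: "x \<in> \<Omega>" "x - h *\<^sub>R ?e \<in> \<Omega>"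
          proof -
            have "x - h *\<^sub>R ?e \<in> cball x r" using dx h by simp
            then show "x - h *\<^sub>R ?e \<in> \<Omega>" using True r(2) by blast
            show "x \<in> \<Omega>" using True zf(3) by blast
          qed
          then have g0: "g0 (x - h *\<^sub>R ?e) = g (x - h *\<^sub>R ?e)" "g0 x = g x" by (simp_all add: g0_def)
          show ?thesis
          proof (cases "x \<in> N")
            case True
            have "\<bar>g (x - h *\<^sub>R ?e) - g x\<bar> \<le> \<Lambda> * h"
              using g[of "x - h *\<^sub>R ?e" x] h by (simp add: norm_axis_1)
            moreover have "\<bar>z x $ i\<bar> \<le> R" using component_le_norm_cart R order_trans by blast
            ultimately have "\<bar>g (x - h *\<^sub>R ?e) - g x\<bar> * \<bar>z x $ i\<bar> \<le> \<Lambda> * h * R"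
              using \<open>\<Lambda> \<ge> 0\<close> h by (intro mult_mono) auto
            then show ?thesis using True by (simp add: g0 abs_mult)
          next
            case False
            then have "g (x - h *\<^sub>R ?e) = 0" "g x = 0"
              using off[OF x(1,2)] off[OF x(1,1)] dx h \<delta> by auto
            then show ?thesis using False by (simp add: g0)
          qed
        qed
      qed
      also have "\<dots> = \<Lambda> * h * R * measure lborel N" using N(2) by simp
      also have "measure lborel N = measure lebesgue N" using N(2) by (simp add: measure_completion)
      finally show ?thesis using h by (simp add: abs_divide field_simps)
    qed
    then show "\<forall>\<^sub>F h in at_right 0. \<bar>(LBINT x. (g0 (x - h *\<^sub>R ?e) - g0 x) * z x $ i) / h\<bar> \<le> \<Lambda> * R * measure lebesgue N"
      unfolding eventually_at_right_field using \<delta> r(1) by (intro exI[of _ "min \<delta> r"]) simp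
  qed
  have gi: "integrable lborel (\<lambda>x. g0 x * (grad (\<lambda>x. z x $ i) x \<bullet> axis i 1))" for i
  proof -
    obtain B where B: "\<And>x. norm (grad (\<lambda>x. z x $ i) x) \<le> B"
      using supported_in_bounded[OF C1_continuous_grad[OF C] supported_in_grad[OF S]] by metis
    have "\<bar>grad (\<lambda>x. z x $ i) x \<bullet> axis i 1\<bar> \<le> B" for x
      using Cauchy_Schwarz_ineq2[of "grad (\<lambda>x. z x $ i) x" "axis i 1"] B[of x] by (simp add: norm_axis_1)
    then show ?thesis
      using borel_measurable_grad[OF C, of i] by (intro integrable_mult_bounded[OF g0i]) auto
  qed
  have "(LINT x|lebesgue_on \<Omega>. g x * div_field z x) = (LINT x|lebesgue_on \<Omega>. g0 x * div_field z x)"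
    by (rule Bochner_Integration.integral_cong) (auto simp: g0_def space_restrict_space)
  also have "\<dots> = (LBINT x. g0 x * div_field z x)"
    using g0i by (intro integral_lebesgue_on_eq_lborel[OF \<Omega>(1) z]) auto
  also have "\<dots> = (LBINT x. (\<Sum>i\<in>UNIV. g0 x * (grad (\<lambda>x. z x $ i) x \<bullet> axis i 1)))"
    by (simp add: div_field_eq[OF zf(1)] inner_axis sum_distrib_left)
  also have "\<dots> = (\<Sum>i\<in>UNIV. (LBINT x. g0 x * (grad (\<lambda>x. z x $ i) x \<bullet> axis i 1)))"
    by (rule Bochner_Integration.integral_sum) (rule gi)
  also have "\<bar>\<dots>\<bar> \<le> (\<Sum>i\<in>(UNIV::2 set). \<Lambda> * R * measure lebesgue N)"
    by (rule order_trans[OF sum_abs sum_mono]) (rule comp)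
  finally show ?thesis by simp
qed

text \<open>
  A continuous function on the boundary need not have bounded variation, so its extension has to be
  built with some care, as in Gagliardo's theorem. Choose Lipschitz functions \<open>G k\<close> that are \<open>2\<^sup>-\<^sup>k\<close>-close to
  \<open>f\<close> on the boundary, and sum the differences \<open>P k = G (Suc k) - G k\<close>, each multiplied by a cut-off \<open>\<tau> k\<close>
  supported in a boundary layer of width \<open>\<delta> k\<close>. If \<open>\<delta> k\<close> is so small that \<open>P k\<close> changes by at most \<open>2\<^sup>-\<^sup>k\<close>
  across the layer, the slope of the cut-off dominates: the product has slope of order \<open>2\<^sup>-\<^sup>k / \<delta> k\<close>, on an area
  of order \<open>\<delta> k\<close>. The variations are therefore summable, however large the Lipschitz constants are.
\<close>

lemma boundary_extension:
  assumes \<Omega>: "open \<Omega>" "bounded \<Omega>" "convex \<Omega>" "\<Omega> \<noteq> {}" and \<phi>: "metric_integrand \<phi>"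
    and f: "continuous_on (frontier \<Omega>) f"
  obtains F where "continuous_on UNIV F" "\<And>x. x \<in> frontier \<Omega> \<Longrightarrow> F x = f x"
    "total_variation \<phi> \<Omega> F < \<infinity>"
proof -
  have fr: "frontier \<Omega> \<noteq> {}" using \<Omega>(2,4) by (metis frontier_eq_empty not_bounded_UNIV)
  have "\<exists>G \<Lambda>. \<Lambda> \<ge> 0 \<and> (\<forall>x y. \<bar>G x - G y\<bar> \<le> \<Lambda> * norm (x - y)) \<and> (\<forall>x\<in>frontier \<Omega>. \<bar>G x - f x\<bar> \<le> (1/2)^k)" for k :: nat
    by (rule lipschitz_approximation[OF compact_frontier_bounded[OF \<Omega>(2)] f, of "(1/2)^k"]) (simp, blast)
  then obtain G \<Lambda> where \<Lambda>: "\<And>k. \<Lambda> k \<ge> 0" and G: "\<And>k x y. \<bar>G k x - G k y\<bar> \<le> \<Lambda> k * norm (x - y)"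
    and Gf: "\<And>k x. x \<in> frontier \<Omega> \<Longrightarrow> \<bar>G k x - f x\<bar> \<le> (1/2)^k"
    by metis
  obtain C where C: "C \<ge> 0" "\<And>\<delta>. \<delta> > 0 \<Longrightarrow> measure lebesgue (boundary_layer \<Omega> \<delta>) \<le> C * \<delta>"
    using boundary_layer_measure[OF \<Omega>] by blast
  obtain R where R: "R > 0" "\<And>a. a \<in> wulff \<phi> \<Longrightarrow> norm a \<le> R" using wulff_norm_le[OF \<phi>] by blast
  define q where "q k = (1/2::real)^k" for k :: nat
  have q: "q k > 0" "q (Suc k) \<le> q k" for k by (simp_all add: q_def)
  define P where "P k x = G (Suc k) x - G k x" for k x
  define B where "B k = \<Lambda> k + \<Lambda> (Suc k)" for k
  have B: "B k \<ge> 0" for k using \<Lambda> by (simp add: B_def)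
  have P: "\<bar>P k x - P k y\<bar> \<le> B k * norm (x - y)" for k x y
    using G[of k x y] G[of "Suc k" x y] unfolding P_def B_def distrib_right by linarith
  have Pfr: "\<bar>P k b\<bar> \<le> 2 * q k" if "b \<in> frontier \<Omega>" for k b
    using Gf[OF that, of k] Gf[OF that, of "Suc k"] q(2)[of k] unfolding P_def q_def by linarith
  \<comment> \<open>Thin enough for \<open>P k\<close> to stay of order \<open>q k\<close> throughout the layer.\<close>
  define \<delta> where "\<delta> k = q k / (B k + 1)" for k
  have \<delta>: "\<delta> k > 0" "B k * \<delta> k \<le> q k" for k
    using B[of k] q(1)[of k] by (auto simp: \<delta>_def field_simps)
  define d where "d x = infdist x (frontier \<Omega>)" for x
  have d: "\<bar>d x - d y\<bar> \<le> norm (x - y)" for x y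
    using infdist_triangle_abs[of x "frontier \<Omega>" y] by (simp add: d_def dist_norm)
  define \<tau> where "\<tau> k x = max 0 (1 - d x / \<delta> k)" for k x
  have d0: "0 \<le> d x" for x by (simp add: d_def infdist_nonneg)
  have \<tau>: "0 \<le> \<tau> k x" "\<tau> k x \<le> 1" for k x
    using d0[of x] \<delta>(1)[of k] by (auto simp: \<tau>_def)
  have \<tau>0: "\<tau> k x = 0" if "\<delta> k \<le> d x" for k x using that \<delta>(1)[of k] by (simp add: \<tau>_def)
  have \<tau>L: "\<bar>\<tau> k x - \<tau> k y\<bar> \<le> norm (x - y) / \<delta> k" for k x y
  proof -
    have "\<bar>\<tau> k x - \<tau> k y\<bar> \<le> \<bar>d x / \<delta> k - d y / \<delta> k\<bar>" by (auto simp: \<tau>_def)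
    also have "\<dots> = \<bar>d x - d y\<bar> / \<delta> k" using \<delta>(1)[of k] by (simp add: diff_divide_distrib[symmetric])
    also have "\<dots> \<le> norm (x - y) / \<delta> k" using d \<delta>(1)[of k] by (simp add: divide_right_mono)
    finally show ?thesis .
  qed
  have Pnear: "\<bar>P k x\<bar> \<le> 3 * q k" if dx: "d x < \<delta> k" for k x
  proof -
    obtain b where b: "b \<in> frontier \<Omega>" "dist x b < \<delta> k"
      using infdist_lessD[OF frontier_closed fr dx[unfolded d_def]] by blast
    have "B k * norm (x - b) \<le> B k * \<delta> k" using b(2) B by (intro mult_left_mono) (auto simp: dist_norm)
    then show ?thesis using P[of k x b] Pfr[OF b(1), of k] \<delta>(2)[of k] by linarith
  qed
  define F where "F k x = \<tau> k x * P k x" for k x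
  have Fb: "\<bar>F k x\<bar> \<le> 3 * q k" for k x
  proof (cases "d x < \<delta> k")
    case True
    have "\<tau> k x * \<bar>P k x\<bar> \<le> 1 * (3 * q k)" using \<tau>[where k=k and x=x] Pnear[OF True] by (intro mult_mono) auto
    then show ?thesis using \<tau>(1)[of k x] by (simp add: F_def abs_mult)
  next
    case False
    then show ?thesis using \<tau>0[of k x] q(1)[of k] by (simp add: F_def)
  qed
  have FL: "\<bar>F k x - F k y\<bar> \<le> 4 * q k / \<delta> k * norm (x - y)" for k x y
  proof -
    have aux: "\<bar>F k x - F k y\<bar> \<le> 4 * q k / \<delta> k * norm (x - y)" if dx: "d x < \<delta> k" for x y
    proof -
      have "F k x - F k y = (\<tau> k x - \<tau> k y) * P k x + \<tau> k y * (P k x - P k y)"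
        by (simp add: F_def algebra_simps)
      also have "\<bar>\<dots>\<bar> \<le> \<bar>\<tau> k x - \<tau> k y\<bar> * \<bar>P k x\<bar> + \<bar>\<tau> k y\<bar> * \<bar>P k x - P k y\<bar>"
        unfolding abs_mult[symmetric] by (rule abs_triangle_ineq)
      also have "\<dots> \<le> norm (x - y) / \<delta> k * (3 * q k) + 1 * (B k * norm (x - y))"
        using \<tau>L[of k x y] Pnear[OF dx] \<tau>[where k=k and x=y] P[of k x y] \<delta>(1)[of k]
        by (intro add_mono mult_mono) auto
      also have "\<dots> \<le> norm (x - y) / \<delta> k * (3 * q k) + q k / \<delta> k * norm (x - y)"
      proof -
        have "B k \<le> q k / \<delta> k" using \<delta>[of k] by (simp add: field_simps)
        then have "B k * norm (x - y) \<le> q k / \<delta> k * norm (x - y)" by (rule mult_right_mono) simp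
        then show ?thesis by (simp only: mult_1 add_le_cancel_left)
      qed
      also have "\<dots> = 4 * q k / \<delta> k * norm (x - y)" by (simp add: field_simps)
      finally show ?thesis .
    qed
    show ?thesis
    proof (cases "d x < \<delta> k \<or> d y < \<delta> k")
      case True
      then show ?thesis using aux[of x y] aux[of y x] by (auto simp: norm_minus_commute abs_minus_commute)
    next
      case False
      then have "F k x = 0" "F k y = 0" using \<tau>0 by (auto simp: F_def)
      then show ?thesis using q(1)[of k] \<delta>(1)[of k] by simp
    qed
  qed
  have q_sum: "summable q" "(\<Sum>i<k. q i) \<le> 2" for k
  proof -
    show "summable q" unfolding q_def by (simp add: summable_geometric)
    have "(\<Sum>i<k. q i) \<le> suminf q" using q(1) \<open>summable q\<close> by (intro sum_le_suminf) (auto intro: less_imp_le)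
    also have "suminf q = 2" unfolding q_def by (simp add: suminf_geometric)
    finally show "(\<Sum>i<k. q i) \<le> 2" .
  qed
  define S where "S k x = G 0 x + (\<Sum>i<k. F i x)" for k x
  define Finf where "Finf x = G 0 x + (\<Sum>i. F i x)" for x
  have ul: "uniform_limit UNIV (\<lambda>k x. \<Sum>i<k. F i x) (\<lambda>x. \<Sum>i. F i x) sequentially"
    by (rule Weierstrass_m_test[where M="\<lambda>k. 3 * q k"]) (use Fb q_sum(1) in \<open>auto intro: summable_mult\<close>)
  have Gc: "continuous_on A (G k)" for A k by (rule lipschitz_continuous_on[OF G])
  have Fc: "continuous_on A (F k)" for A k by (rule lipschitz_continuous_on[OF FL])
  have "continuous_on UNIV (\<lambda>x. \<Sum>i. F i x)"
    by (rule uniform_limit_theorem[OF _ ul]) (auto intro!: always_eventually continuous_intros Fc)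
  then have c: "continuous_on UNIV Finf" unfolding Finf_def by (intro continuous_intros Gc)
  have lim: "(\<lambda>k. S k x) \<longlonglongrightarrow> Finf x" for x
    unfolding S_def Finf_def by (intro tendsto_intros tendsto_uniform_limitI[OF ul]) simp
  have fin: "Finf x = f x" if x: "x \<in> frontier \<Omega>" for x
  proof -
    have "F k x = G (Suc k) x - G k x" for k using x by (simp add: F_def \<tau>_def d_def P_def)
    then have "S k x = G k x" for k
      using sum_lessThan_telescope[of "\<lambda>i. G i x" k] by (simp add: S_def)
    then have 1: "(\<lambda>k. G k x) \<longlonglongrightarrow> Finf x" using lim[of x] by simp
    have "(\<lambda>k. G k x - f x) \<longlonglongrightarrow> 0"
    proof (rule Lim_null_comparison)
      show "\<forall>\<^sub>F k in sequentially. norm (G k x - f x) \<le> (1/2)^k" using Gf[OF x] by simp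
      show "(\<lambda>k. (1/2::real)^k) \<longlonglongrightarrow> 0" by (rule LIMSEQ_realpow_zero) auto
    qed
    then have "(\<lambda>k. G k x) \<longlonglongrightarrow> f x" by (simp add: LIM_zero_iff)
    with 1 show ?thesis using LIMSEQ_unique by blast
  qed
  have \<Omega>m: "\<Omega> \<in> lmeasurable" using \<Omega> by (intro lmeasurable_open)
  interpret finite_measure "lebesgue_on \<Omega>" by (rule finite_measure_lebesgue_on[OF \<Omega>m])
  have meas: "h \<in> borel_measurable (lebesgue_on \<Omega>)" if "continuous_on UNIV h" for h :: "real^2 \<Rightarrow> real"
    using borel_measurable_continuous_onI[OF that] by (intro measurable_restrict_space1 measurable_completion) simp
  obtain b where b: "\<And>x. x \<in> \<Omega> \<Longrightarrow> \<bar>G 0 x\<bar> \<le> b"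
  proof -
    have "bounded (G 0 ` closure \<Omega>)"
      using \<Omega>(2) Gc by (intro compact_imp_bounded compact_continuous_image) (auto simp: compact_closure)
    then show ?thesis using that closure_subset[of \<Omega>] unfolding bounded_pos by fastforce
  qed
  have bi: "integrable (lebesgue_on \<Omega>) h" if "continuous_on UNIV h" "\<And>x. x \<in> \<Omega> \<Longrightarrow> \<bar>h x\<bar> \<le> b'" for h :: "real^2 \<Rightarrow> real" and b'
    using that(2) meas[OF that(1)] by (intro integrable_const_bound[of _ b']) (auto simp: space_restrict_space)
  have TV: "total_variation \<phi> \<Omega> (S k) \<le> ereal (2 * (\<Lambda> 0 * R * measure lebesgue \<Omega>) + 32 * R * C)" for k
  proof (rule total_variation_le[OF \<Omega>(1) \<phi>])
    fix z assume z: "z \<in> admissible \<phi> \<Omega>"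
    have zR: "norm (z x) \<le> R" for x using z R(2) unfolding admissible_def by blast
    have 0: "\<bar>LINT x|lebesgue_on \<Omega>. G 0 x * div_field z x\<bar> \<le> 2 * (\<Lambda> 0 * R * measure lebesgue \<Omega>)"
      by (rule lipschitz_pairing[OF \<Omega>(1,2) z zR G \<Omega>m _ zero_less_one]) (use \<Omega>(1) in auto)
    have Fi: "(LINT x|lebesgue_on \<Omega>. F i x * div_field z x) \<le> 16 * R * C * q i" for i
    proof -
      \<comment> \<open>Twice the width, since the difference quotients see points at a distance up to \<open>\<delta> i\<close>.\<close>
      let ?N = "boundary_layer \<Omega> (2 * \<delta> i)"
      have oN: "open ?N" by (rule open_boundary_layer[OF \<Omega>(1)])
      have Nm: "?N \<in> lmeasurable"
        by (rule lmeasurable_open[OF bounded_subset[OF \<Omega>(2)] oN]) (auto simp: boundary_layer_def)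
      have "\<bar>LINT x|lebesgue_on \<Omega>. F i x * div_field z x\<bar> \<le> 2 * (4 * q i / \<delta> i * R * measure lebesgue ?N)"
      proof (rule lipschitz_pairing[OF \<Omega>(1,2) z zR FL Nm _ \<delta>(1)[of i]])
        show "?N \<in> sets borel" using oN by simp
        fix x y assume "x \<in> \<Omega>" "y \<in> \<Omega>" "dist x y < \<delta> i" "x \<notin> ?N"
        then have "\<delta> i \<le> d y" using d[of x y] by (simp add: boundary_layer_def d_def dist_norm)
        then show "F i y = 0" using \<tau>0 by (simp add: F_def)
      qed
      also have "\<dots> \<le> 2 * (4 * q i / \<delta> i * R * (C * (2 * \<delta> i)))"
        using C(2)[of "2 * \<delta> i"] q(1)[of i] \<delta>(1)[of i] R(1) by (intro mult_left_mono) auto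
      also have "\<dots> = 16 * R * C * q i" using \<delta>(1)[of i] by simp
      finally show ?thesis by simp
    qed
    have iG: "integrable (lebesgue_on \<Omega>) (\<lambda>x. G 0 x * div_field z x)"
      by (rule integrable_mult_div_field[OF z bi[OF Gc b]])
    have iF: "integrable (lebesgue_on \<Omega>) (\<lambda>x. F i x * div_field z x)" for i
      by (rule integrable_mult_div_field[OF z bi[OF Fc Fb]])
    have "(LINT x|lebesgue_on \<Omega>. S k x * div_field z x)
       = (LINT x|lebesgue_on \<Omega>. G 0 x * div_field z x) + (\<Sum>i<k. LINT x|lebesgue_on \<Omega>. F i x * div_field z x)"
      unfolding S_def distrib_right sum_distrib_right
      using iG iF by (simp add: Bochner_Integration.integral_add Bochner_Integration.integral_sum)
    also have "\<dots> \<le> 2 * (\<Lambda> 0 * R * measure lebesgue \<Omega>) + (\<Sum>i<k. 16 * R * C * q i)"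
      using 0 Fi by (intro add_mono sum_mono) auto
    also have "\<dots> \<le> 2 * (\<Lambda> 0 * R * measure lebesgue \<Omega>) + 16 * R * C * 2"
      unfolding sum_distrib_left[symmetric] using q_sum(2)[of k] R(1) C(1) by (intro add_left_mono mult_left_mono) auto
    finally show "ereal (LINT x|lebesgue_on \<Omega>. S k x * div_field z x) \<le> ereal (2 * (\<Lambda> 0 * R * measure lebesgue \<Omega>) + 32 * R * C)"
      by simp
  qed
  have Sc: "continuous_on UNIV (S k)" for k unfolding S_def by (intro continuous_intros Gc Fc)
  have Sb: "\<bar>S k x\<bar> \<le> b + 6" if "x \<in> \<Omega>" for k x
  proof -
    have "\<bar>\<Sum>i<k. F i x\<bar> \<le> (\<Sum>i<k. 3 * q i)" by (rule order_trans[OF sum_abs sum_mono]) (rule Fb)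
    also have "\<dots> \<le> 6" unfolding sum_distrib_left[symmetric] using q_sum(2)[of k] by simp
    finally show ?thesis using b[OF that] unfolding S_def by linarith
  qed
  have "total_variation \<phi> \<Omega> Finf \<le> ereal (2 * (\<Lambda> 0 * R * measure lebesgue \<Omega>) + 32 * R * C)"
  proof (rule total_variation_lower_semicontinuous[OF \<Omega>(1) \<phi> meas[OF Sc] meas[OF c] _ _ _ TV tendsto_const, where g="\<lambda>x. b + 6"])
    show "AE x in lebesgue_on \<Omega>. (\<lambda>k. S k x) \<longlonglongrightarrow> Finf x" using lim by simp
    show "AE x in lebesgue_on \<Omega>. \<bar>S k x\<bar> \<le> b + 6" for k using Sb by (intro AE_I2) (simp add: space_restrict_space)
  qed simp
  then have "total_variation \<phi> \<Omega> Finf < \<infinity>" by (rule order_le_less_trans) simp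
  with c fin show ?thesis by (rule that)
qed

section \<open>The direct method\<close>

text \<open>
  Convexity of the total variation takes the place of compactness. The sets \<open>S k\<close> of functions whose
  total variation is within \<open>1 / Suc k\<close> of the infimum are nested and convex. Choose in each of them a
  function of almost minimal \<open>L\<^sup>2\<close> norm. The minimal norms \<open>d k\<close> increase and are bounded, and by the
  parallelogram law the chosen functions form a Cauchy sequence. A subsequence converges almost
  everywhere, and its limit is a minimiser by lower semicontinuity.
\<close>

lemma minimizer_exists:
  assumes \<Omega>: "open \<Omega>" "bounded \<Omega>" and \<phi>: "metric_integrand \<phi>"
    and meas: "\<And>u. u \<in> X \<Longrightarrow> u \<in> borel_measurable (lebesgue_on \<Omega>)"
    and bound: "\<And>u. u \<in> X \<Longrightarrow> AE x in lebesgue_on \<Omega>. \<bar>u x\<bar> \<le> b"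
    and mid: "\<And>u v. u \<in> X \<Longrightarrow> v \<in> X \<Longrightarrow> (\<lambda>x. (u x + v x) / 2) \<in> X"
    and lim: "\<And>u v. (\<And>k. u k \<in> X) \<Longrightarrow> v \<in> borel_measurable (lebesgue_on \<Omega>) \<Longrightarrow>
        AE x in lebesgue_on \<Omega>. (\<lambda>k. u k x) \<longlonglongrightarrow> v x \<Longrightarrow> v \<in> X"
    and F: "F \<in> X" "total_variation \<phi> \<Omega> F < \<infinity>"
  obtains u where "u \<in> X" "total_variation \<phi> \<Omega> u < \<infinity>"
    "\<And>v. v \<in> X \<Longrightarrow> total_variation \<phi> \<Omega> u \<le> total_variation \<phi> \<Omega> v"
proof -
  let ?M = "lebesgue_on \<Omega>" and ?TV = "total_variation \<phi> \<Omega>"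
  have \<Omega>m: "\<Omega> \<in> lmeasurable" using \<Omega> by (intro lmeasurable_open)
  interpret finite_measure ?M by (rule finite_measure_lebesgue_on[OF \<Omega>m])
  define A where "A = measure ?M (space ?M)"
  have "A \<ge> 0" by (simp add: A_def)
  have int: "integrable ?M u" if "u \<in> X" for u
    using bound[OF that] meas[OF that] by (intro integrable_const_bound[of _ b]) auto
  have sqb: "AE x in ?M. \<bar>u x * v x\<bar> \<le> b * b" if "u \<in> X" "v \<in> X" for u v
    using bound[OF that(1)] bound[OF that(2)]
    by eventually_elim (auto simp: abs_mult intro: mult_mono order_trans[OF abs_ge_zero])
  have int2: "integrable ?M (\<lambda>x. u x * v x)" if "u \<in> X" "v \<in> X" for u v
    using sqb[OF that] meas[OF that(1)] meas[OF that(2)] by (intro integrable_const_bound[of _ "b * b"]) auto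
  define q where "q u = (LINT x|?M. u x * u x)" for u :: "real^2 \<Rightarrow> real"
  have q0: "0 \<le> q u" for u by (simp add: q_def)
  have qb: "q u \<le> b * b * A" if "u \<in> X" for u
  proof -
    have "q u \<le> (LINT x|?M. b * b)"
      unfolding q_def using sqb[OF that that] by (intro integral_mono_AE int2[OF that that]) (auto elim!: eventually_mono)
    then show ?thesis by (simp add: A_def mult.commute)
  qed
  define t where "t = (INF u\<in>X. ?TV u)"
  have "t \<le> ?TV F" unfolding t_def by (rule INF_lower[OF F(1)])
  moreover have "0 \<le> t" unfolding t_def by (rule INF_greatest) (rule total_variation_nonneg[OF \<Omega>(1) \<phi>])
  ultimately obtain t0 where t0: "t = ereal t0" using F(2) by (cases t) auto
  define S where "S k = {u \<in> X. ?TV u \<le> ereal (t0 + 1 / real (Suc k))}" for k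
  have Sne: "S k \<noteq> {}" for k
  proof -
    have "t < ereal (t0 + 1 / real (Suc k))" by (simp add: t0)
    then obtain u where "u \<in> X" "?TV u < ereal (t0 + 1 / real (Suc k))"
      unfolding t_def INF_less_iff by blast
    then show ?thesis by (auto simp: S_def intro: less_imp_le)
  qed
  have Santi: "S j \<subseteq> S i" if "i \<le> j" for i j
  proof -
    have "1 / real (Suc j) \<le> 1 / real (Suc i)" using that by (simp add: frac_le)
    then have "ereal (t0 + 1 / real (Suc j)) \<le> ereal (t0 + 1 / real (Suc i))" by simp
    then show ?thesis unfolding S_def using order_trans by blast
  qed
  have SX: "S k \<subseteq> X" for k by (auto simp: S_def)
  have Smid: "(\<lambda>x. (u x + v x) / 2) \<in> S k" if "u \<in> S k" "v \<in> S k" for u v k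
    using that mid total_variation_convex[OF \<Omega>(1) \<phi> int _ int] by (auto simp: S_def)
  define d where "d k = (INF u\<in>S k. q u)" for k
  have bdd: "bdd_below (q ` S k)" for k using q0 by (intro bdd_belowI2) auto
  have d_le: "d k \<le> q u" if "u \<in> S k" for k u unfolding d_def by (rule cINF_lower[OF bdd that])
  have dmono: "d i \<le> d j" if "i \<le> j" for i j
    unfolding d_def using Santi[OF that] by (intro cINF_superset_mono Sne bdd) auto
  have dbd: "d k \<le> b * b * A" for k
    using Sne[of k] d_le[of _ k] qb SX by (metis all_not_in_conv order_trans subsetD)
  have "\<exists>u\<in>S k. q u < d k + 1 / real (Suc k)" for k
  proof -
    have "(INF u\<in>S k. q u) < d k + 1 / real (Suc k)" by (simp add: d_def)
    then show ?thesis using cINF_less_iff[OF Sne bdd] by blast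
  qed
  then obtain u where u: "\<And>k. u k \<in> S k" "\<And>k. q (u k) < d k + 1 / real (Suc k)" by metis
  have uX: "u k \<in> X" for k using u(1) SX by blast
  have "incseq d" using dmono by (simp add: incseq_def)
  then obtain D where D: "d \<longlonglongrightarrow> D" "\<And>k. d k \<le> D"
    using incseq_convergent[of d "b * b * A"] dbd by metis
  \<comment> \<open>The mean of two functions of \<open>S N\<close> lies in \<open>S N\<close>, so its norm is at least the minimal one.\<close>
  have par: "(LINT x|?M. (u i x - u j x)\<^sup>2) \<le> 4 * (D - d N) + 4 / real (Suc N)" if ij: "N \<le> i" "N \<le> j" for N i j
  proof -
    let ?m = "\<lambda>x. (u i x + u j x) / 2"
    have m: "?m \<in> S N" using u(1) Santi ij by (intro Smid) blast+
    have mX: "?m \<in> X" using m SX by blast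
    have "(LINT x|?M. (u i x - u j x)\<^sup>2) = (LINT x|?M. 2 * (u i x * u i x) + 2 * (u j x * u j x) - 4 * (?m x * ?m x))"
      by (rule Bochner_Integration.integral_cong) (auto simp: power2_eq_square field_simps)
    also have "\<dots> = 2 * q (u i) + 2 * q (u j) - 4 * q ?m"
    proof -
      have lin: "(LINT x|?M. 2 * f x + 2 * g x - 4 * h x) = 2 * integral\<^sup>L ?M f + 2 * integral\<^sup>L ?M g - 4 * integral\<^sup>L ?M h"
        if "integrable ?M f" "integrable ?M g" "integrable ?M h" for f g h :: "real^2 \<Rightarrow> real"
        using that by simp
      show ?thesis
        unfolding q_def by (rule lin[OF int2[OF uX uX] int2[OF uX uX] int2[OF mX mX]])
    qed
    also have "\<dots> \<le> 2 * (d i + 1 / real (Suc i)) + 2 * (d j + 1 / real (Suc j)) - 4 * d N"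
    proof -
      have aux: "2 * a + 2 * b - 4 * e \<le> 2 * a' + 2 * b' - 4 * e'" if "a < a'" "b < b'" "e' \<le> e" for a a' b b' e e' :: real
        using that by linarith
      show ?thesis by (rule aux[OF u(2) u(2) d_le[OF m]])
    qed
    also have "\<dots> \<le> 2 * (D + 1 / real (Suc N)) + 2 * (D + 1 / real (Suc N)) - 4 * d N"
    proof -
      have "1 / real (Suc i) \<le> 1 / real (Suc N)" "1 / real (Suc j) \<le> 1 / real (Suc N)"
        using ij by (simp_all add: frac_le)
      then show ?thesis
        by (intro diff_right_mono add_mono mult_left_mono D(2)) auto
    qed
    finally show ?thesis by simp
  qed
  have cauchy: "\<exists>N. \<forall>i\<ge>N. \<forall>j\<ge>N. (LINT x|?M. norm (u i x - u j x)) < e" if "e > 0" for e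
  proof -
    define s where "s = e / (A + 1)"
    have s: "s > 0" "s * A \<le> e" using \<open>e > 0\<close> \<open>A \<ge> 0\<close> by (auto simp: s_def field_simps)
    have "(\<lambda>N. 4 * (D - d N) + 4 * (1 / real (Suc N))) \<longlonglongrightarrow> 4 * (D - D) + 4 * 0"
      using lim_inverse_n'[THEN LIMSEQ_Suc] by (intro tendsto_intros D(1))
    then have "\<forall>\<^sub>F N in sequentially. 4 * (D - d N) + 4 * (1 / real (Suc N)) < s * e"
      using s(1) \<open>e > 0\<close> by (intro order_tendstoD(2)) auto
    then obtain N where N: "4 * (D - d N) + 4 / real (Suc N) < s * e"
      unfolding eventually_sequentially by auto
    have "(LINT x|?M. norm (u i x - u j x)) < e" if ij: "N \<le> i" "N \<le> j" for i j
    proof -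
      have sqi: "integrable ?M (\<lambda>x. (u i x - u j x)\<^sup>2)"
        using int2[OF uX[of i] uX[of i]] int2[OF uX[of j] uX[of j]] int2[OF uX[of i] uX[of j]]
        by (simp add: power2_eq_square algebra_simps)
      have "(LINT x|?M. norm (u i x - u j x)) \<le> (LINT x|?M. s / 2 + (u i x - u j x)\<^sup>2 / (2 * s))"
      proof (rule integral_mono)
        show "integrable ?M (\<lambda>x. norm (u i x - u j x))" using int[OF uX] by simp
        show "integrable ?M (\<lambda>x. s / 2 + (u i x - u j x)\<^sup>2 / (2 * s))" using sqi by simp
        fix x
        \<comment> \<open>Young's inequality trades the \<open>L\<^sup>1\<close> norm for the \<open>L\<^sup>2\<close> norm on a set of finite measure.\<close>
        have "2 * s * \<bar>u i x - u j x\<bar> \<le> s\<^sup>2 + (u i x - u j x)\<^sup>2"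
          using zero_le_power2[of "s - \<bar>u i x - u j x\<bar>"] by (simp add: power2_diff)
        then show "norm (u i x - u j x) \<le> s / 2 + (u i x - u j x)\<^sup>2 / (2 * s)"
          using s(1) by (simp add: field_simps power2_eq_square)
      qed
      also have "\<dots> = s / 2 * A + (LINT x|?M. (u i x - u j x)\<^sup>2) / (2 * s)"
        using sqi by (simp add: A_def)
      also have "\<dots> < s / 2 * A + s * e / (2 * s)"
        using par[OF ij] N s(1) by (intro add_strict_left_mono divide_strict_right_mono) auto
      also have "\<dots> \<le> e" using s by (simp add: field_simps)
      finally show ?thesis .
    qed
    then show ?thesis by blast
  qed
  obtain r where r: "strict_mono r" "AE x in ?M. Cauchy (\<lambda>i. u (r i) x)"
    by (rule cauchy_L1_AE_cauchy_subseq[OF int[OF uX] cauchy], assumption) (rule that; assumption)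
  define v where "v x = Topological_Spaces.lim (\<lambda>i. u (r i) x)" for x
  have vm: "v \<in> borel_measurable ?M"
    unfolding v_def by (intro borel_measurable_lim_metric meas uX)
  have vlim: "AE x in ?M. (\<lambda>i. u (r i) x) \<longlonglongrightarrow> v x"
    using r(2) by eventually_elim (simp add: v_def Cauchy_convergent_iff convergent_LIMSEQ_iff)
  have vX: "v \<in> X" by (rule lim[of "\<lambda>i. u (r i)", OF uX vm vlim])
  have "?TV v \<le> ereal t0"
  proof (rule total_variation_lower_semicontinuous[OF \<Omega>(1) \<phi> meas[OF uX] vm vlim, where g="\<lambda>_. b" and c="\<lambda>i. ereal (t0 + 1 / real (Suc (r i)))"])
    show "AE x in ?M. \<bar>u (r k) x\<bar> \<le> b" for k by (rule bound[OF uX])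
    show "?TV (u (r k)) \<le> ereal (t0 + 1 / real (Suc (r k)))" for k using u(1) by (simp add: S_def)
    have "(\<lambda>k. 1 / real (Suc (r k))) \<longlonglongrightarrow> 0"
      using LIMSEQ_subseq_LIMSEQ[OF lim_inverse_n'[THEN LIMSEQ_Suc] r(1)] by (simp add: o_def)
    then have "(\<lambda>k. t0 + 1 / real (Suc (r k))) \<longlonglongrightarrow> t0 + 0" by (intro tendsto_intros)
    then show "(\<lambda>k. ereal (t0 + 1 / real (Suc (r k)))) \<longlonglongrightarrow> ereal t0" by simp
  qed simp
  then have le: "?TV v \<le> t" by (simp add: t0)
  show ?thesis
  proof (rule that[OF vX])
    show "?TV v < \<infinity>" using le t0 by auto
    show "?TV v \<le> ?TV w" if "w \<in> X" for w using le INF_lower[OF that, of ?TV] by (simp add: t_def)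
  qed
qed

section \<open>Small caps of a strictly convex domain, and traces\<close>

text \<open>
  A supporting line that met the closure of \<open>\<Omega>\<close> in a second point would contain a segment of the
  boundary.
\<close>

lemma strictly_convex_exposed:
  assumes \<Omega>: "open \<Omega>" "strictly_convex \<Omega>" and x: "x \<in> frontier \<Omega>"
  obtains a where "a \<noteq> 0" "\<And>y. y \<in> closure \<Omega> \<Longrightarrow> y \<noteq> x \<Longrightarrow> a \<bullet> y < a \<bullet> x"
proof -
  have cvx: "convex \<Omega>" using \<Omega>(2) by (simp add: strictly_convex_def)
  have "x \<notin> \<Omega>" using x \<Omega>(1) by (simp add: frontier_def interior_open)
  have ne: "\<Omega> \<noteq> {}" using x by auto
  then obtain a b where a: "a \<noteq> 0" "\<And>y. y \<in> \<Omega> \<Longrightarrow> a \<bullet> y \<le> b" "b \<le> a \<bullet> x"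
    using separating_hyperplane_sets[OF cvx convex_singleton[of x] ne] \<open>x \<notin> \<Omega>\<close> by auto
  have cl: "a \<bullet> y \<le> a \<bullet> x" if "y \<in> closure \<Omega>" for y
  proof -
    have "closure \<Omega> \<subseteq> {y. a \<bullet> y \<le> a \<bullet> x}"
      using a by (intro closure_minimal closed_halfspace_le) (auto intro: order_trans)
    then show ?thesis using that by blast
  qed
  have int: "a \<bullet> y < a \<bullet> x" if y: "y \<in> \<Omega>" for y
  proof (rule ccontr)
    assume "\<not> a \<bullet> y < a \<bullet> x"
    obtain e where e: "e > 0" "cball y e \<subseteq> \<Omega>" using \<Omega>(1) y by (meson open_contains_cball)
    have "y + (e / norm a) *\<^sub>R a \<in> \<Omega>" using e a(1) by (intro subsetD[OF e(2)]) (simp add: dist_norm)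
    then have "a \<bullet> (y + (e / norm a) *\<^sub>R a) \<le> a \<bullet> x" using cl closure_subset by blast
    moreover have "(e / norm a) * (a \<bullet> a) > 0" using e(1) a(1) by simp
    ultimately show False using \<open>\<not> a \<bullet> y < a \<bullet> x\<close> by (simp add: inner_add_right)
  qed
  have "a \<bullet> y < a \<bullet> x" if y: "y \<in> closure \<Omega>" "y \<noteq> x" for y
  proof (rule ccontr)
    assume "\<not> a \<bullet> y < a \<bullet> x"
    then have eq: "a \<bullet> y = a \<bullet> x" using cl[OF y(1)] by simp
    have "closed_segment x y \<subseteq> frontier \<Omega>"
    proof
      fix p assume p: "p \<in> closed_segment x y"
      have "closed_segment x y \<subseteq> closure \<Omega>"
        using x y(1) convex_closure[OF cvx] by (intro closed_segment_subset) (auto simp: frontier_def)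
      moreover have "a \<bullet> p = a \<bullet> x"
      proof -
        obtain t where "p = (1 - t) *\<^sub>R x + t *\<^sub>R y" using p by (auto simp: in_segment)
        then have "a \<bullet> p = (1 - t) * (a \<bullet> x) + t * (a \<bullet> y)" by (simp add: inner_add_right)
        then show ?thesis using eq by (simp add: algebra_simps)
      qed
      ultimately show "p \<in> frontier \<Omega>" using p int[of p] \<Omega>(1) by (auto simp: frontier_def interior_open)
    qed
    with \<Omega>(2) y(2) show False by (metis strictly_convex_def)
  qed
  with a(1) show ?thesis by (rule that)
qed

text \<open>
  By exposedness and compactness, a half-plane whose edge is close to the supporting line at \<open>x\<close> cuts off
  an arbitrarily small cap around \<open>x\<close>. The conditions on this half-plane leave room for small changes of
  normal and offset, so a countable dense set of half-planes contains a suitable one. Countability matters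
  since constraints on the caps hold only almost everywhere.
\<close>

lemma countable_cap_family:
  assumes \<Omega>: "open \<Omega>" "bounded \<Omega>" "strictly_convex \<Omega>"
  obtains n :: "nat \<Rightarrow> real^2" and c :: "nat \<Rightarrow> real" where
    "\<exists>j. \<forall>x\<in>\<Omega>. n j \<bullet> x > c j"
    "\<And>x r. x \<in> frontier \<Omega> \<Longrightarrow> r > 0 \<Longrightarrow> \<exists>j. n j \<bullet> x > c j \<and> (\<forall>y\<in>\<Omega>. n j \<bullet> y > c j \<longrightarrow> dist x y < r)"
proof -
  obtain D :: "((real^2) \<times> real) set" where D: "countable D" "\<And>U. open U \<Longrightarrow> U \<noteq> {} \<Longrightarrow> \<exists>p\<in>D. p \<in> U"
    using countable_dense_exists by metis
  \<comment> \<open>The normal 0 with offset -1 makes all of \<open>\<Omega>\<close> a cap, which provides a global bound.\<close>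
  let ?D = "insert (0, -1) D"
  define e where "e = from_nat_into ?D"
  have rng: "\<exists>j. e j = p" if "p \<in> ?D" for p
    unfolding e_def using from_nat_into_surj[of ?D p] D(1) that by auto
  obtain R where R: "R > 0" "\<And>y. y \<in> closure \<Omega> \<Longrightarrow> norm y \<le> R"
    using bounded_closure[OF \<Omega>(2)] unfolding bounded_pos by blast
  show ?thesis
  proof (rule that[of "\<lambda>j. snd (e j)" "\<lambda>j. fst (e j)"])
    obtain j where "e j = (0, -1)" using rng by blast
    then show "\<exists>j. \<forall>x\<in>\<Omega>. fst (e j) \<bullet> x > snd (e j)" by (intro exI[of _ j]) simp
  next
    fix x and r :: real assume x: "x \<in> frontier \<Omega>" and "r > 0"
    obtain a where a: "a \<noteq> 0" "\<And>y. y \<in> closure \<Omega> \<Longrightarrow> y \<noteq> x \<Longrightarrow> a \<bullet> y < a \<bullet> x"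
      using strictly_convex_exposed[OF \<Omega>(1,3) x] by blast
    have xc: "x \<in> closure \<Omega>" using x by (simp add: frontier_def)
    let ?K = "closure \<Omega> - ball x r"
    obtain c where c: "c < a \<bullet> x" "\<And>y. y \<in> ?K \<Longrightarrow> a \<bullet> y < c"
    proof (cases "?K = {}")
      case True
      show ?thesis by (rule that[of "a \<bullet> x - 1"]) (use True in auto)
    next
      case False
      have "compact ?K" using \<Omega>(2) by (intro compact_diff) (auto simp: compact_closure)
      then obtain y0 where y0: "y0 \<in> ?K" "\<And>y. y \<in> ?K \<Longrightarrow> a \<bullet> y \<le> a \<bullet> y0"
        using continuous_attains_sup[OF \<open>compact ?K\<close> False, of "\<lambda>y. a \<bullet> y"]
          continuous_on_inner[OF continuous_on_const continuous_on_id] by blast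
      have "a \<bullet> y0 < a \<bullet> x" using a(2)[of y0] y0(1) \<open>r > 0\<close> by (cases "y0 = x") auto
      then show ?thesis using that[of "(a \<bullet> y0 + a \<bullet> x) / 2"] y0(2) by fastforce
    qed
    \<comment> \<open>On the closure of \<open>\<Omega>\<close> the perturbed linear form and offset each move by at most \<open>g\<close>, which is small
      compared with the gap between \<open>c\<close> and \<open>a \<bullet> x\<close>.\<close>
    define g where "g = min (a \<bullet> x - c) 1 / 4"
    define c1 where "c1 = (c + a \<bullet> x) / 2"
    have g: "g > 0" "4 * g \<le> a \<bullet> x - c" using c(1) by (auto simp: g_def)
    define U where "U = ball a (g / R) \<times> ball c1 g"
    have "g / R > 0" using g(1) R(1) by simp
    then have "open U" "(a, c1) \<in> U" using g(1) by (auto simp: U_def open_Times)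
    then have "open U" "U \<noteq> {}" by auto
    then obtain p where p: "p \<in> D" "p \<in> U" using D(2) by blast
    obtain m s where ms: "p = (m, s)" by (cases p)
    have m: "norm (m - a) < g / R" "\<bar>s - c1\<bar> < g" using p(2) ms by (auto simp: U_def dist_norm norm_minus_commute abs_minus_commute)
    have close: "\<bar>m \<bullet> y - a \<bullet> y\<bar> \<le> g" if "y \<in> closure \<Omega>" for y
    proof -
      have "\<bar>(m - a) \<bullet> y\<bar> \<le> norm (m - a) * norm y" by (rule Cauchy_Schwarz_ineq2)
      also have "\<dots> \<le> g / R * R" using m(1) R(2)[OF that] \<open>g / R > 0\<close> by (intro mult_mono) auto
      finally show ?thesis using R(1) by (simp add: inner_diff_left)
    qed
    obtain j where j: "e j = (m, s)" using rng[of p] p(1) ms by auto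
    have c1: "c + 2 * g \<le> c1" "c1 + 2 * g \<le> a \<bullet> x" using g(2) by (simp_all add: c1_def field_simps)
    have s: "c1 - g < s" "s < c1 + g" using m(2) by (simp_all add: abs_less_iff)
    have "a \<bullet> x - g \<le> m \<bullet> x" using close[OF xc] by (simp add: abs_le_iff)
    then have "m \<bullet> x > s" using s(2) c1(2) by linarith
    moreover have "dist x y < r" if "y \<in> \<Omega>" "m \<bullet> y > s" for y
    proof (rule ccontr)
      assume "\<not> dist x y < r"
      moreover have yc: "y \<in> closure \<Omega>" using that(1) closure_subset by blast
      ultimately have "a \<bullet> y < c" by (intro c(2)) simp
      moreover have "m \<bullet> y \<le> a \<bullet> y + g" using close[OF yc] by (simp add: abs_le_iff)
      ultimately show False using s(1) c1(1) that(2) by linarith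
    qed
    ultimately show "\<exists>j. fst (e j) \<bullet> x > snd (e j) \<and> (\<forall>y\<in>\<Omega>. fst (e j) \<bullet> y > snd (e j) \<longrightarrow> dist x y < r)"
      using j by (intro exI[of _ j]) simp
  qed
qed

lemma hausdorff1_empty: "hausdorff1 {} = 0"
proof -
  have "hausdorff1_pre \<delta> {} = 0" if "\<delta> > 0" for \<delta>
  proof -
    have "hausdorff1_pre \<delta> {} \<le> (\<Sum>n. ennreal (diameter ((\<lambda>n::nat. {}::(real^2) set) n)))"
      unfolding hausdorff1_pre_def using that by (intro INF_lower) auto
    then show ?thesis by simp
  qed
  then show ?thesis by (simp add: hausdorff1_def)
qed

text \<open>
  If \<open>u\<close> converges to \<open>g x\<close>, up to null sets, at every boundary point \<open>x\<close>, the exceptional set in the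
  definition of the trace is empty.
\<close>

lemma has_trace_if_limit:
  assumes \<Omega>: "open \<Omega>" "bounded \<Omega>" and u: "u \<in> borel_measurable (lebesgue_on \<Omega>)"
    and near: "\<And>x \<tau>. x \<in> frontier \<Omega> \<Longrightarrow> \<tau> > 0 \<Longrightarrow>
      \<exists>\<rho>>0. AE y in lebesgue_on \<Omega>. y \<in> ball x \<rho> \<longrightarrow> \<bar>u y - g x\<bar> \<le> \<tau>"
  shows "has_trace \<Omega> u g"
proof -
  have "((\<lambda>r. (LINT y|lebesgue_on (ball x r \<inter> \<Omega>). \<bar>u y - g x\<bar>) / measure lebesgue (ball x r \<inter> \<Omega>)) \<longlongrightarrow> 0) (at_right 0)"
    if x: "x \<in> frontier \<Omega>" for x
  proof (rule tendstoI)
    fix e :: real assume "e > 0"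
    obtain \<rho> where \<rho>: "\<rho> > 0" "AE y in lebesgue_on \<Omega>. y \<in> ball x \<rho> \<longrightarrow> \<bar>u y - g x\<bar> \<le> e / 2"
      using near[OF x, of "e / 2"] \<open>e > 0\<close> by auto
    have "dist ((LINT y|lebesgue_on (ball x r \<inter> \<Omega>). \<bar>u y - g x\<bar>) / measure lebesgue (ball x r \<inter> \<Omega>)) 0 < e"
      if r: "0 < r" "r < \<rho>" for r
    proof -
      let ?B = "ball x r \<inter> \<Omega>"
      have oB: "open ?B" using \<Omega>(1) by auto
      have Bm: "?B \<in> lmeasurable" using oB \<Omega>(2) by (intro lmeasurable_open) (auto intro: bounded_Int)
      interpret finite_measure "lebesgue_on ?B" by (rule finite_measure_lebesgue_on[OF Bm])
      have ae: "AE y in lebesgue_on ?B. \<bar>u y - g x\<bar> \<le> e / 2"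
        using \<rho>(2) r unfolding AE_lebesgue_on_iff[OF \<Omega>(1)] AE_lebesgue_on_iff[OF oB]
        by (auto elim!: eventually_mono)
      have um: "u \<in> borel_measurable (lebesgue_on ?B)"
        using measurable_restrict_mono[OF u] by blast
      have "integrable (lebesgue_on ?B) (\<lambda>y. \<bar>u y - g x\<bar>)"
        using ae um by (intro integrable_const_bound[of _ "e / 2"]) auto
      then have "(LINT y|lebesgue_on ?B. \<bar>u y - g x\<bar>) \<le> (LINT y|lebesgue_on ?B. e / 2)"
        using ae by (intro integral_mono_AE) auto
      also have "\<dots> = e / 2 * measure lebesgue ?B"
        using Bm by (simp add: measure_restrict_space fmeasurableD)
      finally have "(LINT y|lebesgue_on ?B. \<bar>u y - g x\<bar>) \<le> e / 2 * measure lebesgue ?B" .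
      then have "(LINT y|lebesgue_on ?B. \<bar>u y - g x\<bar>) / measure lebesgue ?B \<le> e / 2"
        using \<open>e > 0\<close> by (cases "measure lebesgue ?B = 0") (auto simp: field_simps zero_less_measure_iff)
      moreover have "0 \<le> (LINT y|lebesgue_on ?B. \<bar>u y - g x\<bar>) / measure lebesgue ?B" by simp
      ultimately show ?thesis using \<open>e > 0\<close> unfolding dist_real_def by linarith
    qed
    then show "\<forall>\<^sub>F r in at_right 0. dist ((LINT y|lebesgue_on (ball x r \<inter> \<Omega>). \<bar>u y - g x\<bar>) / measure lebesgue (ball x r \<inter> \<Omega>)) 0 < e"
      unfolding eventually_at_right_field using \<rho>(1) by blast
  qed
  then have empty: "{x \<in> frontier \<Omega>.
       \<not> ((\<lambda>r. (LINT y|lebesgue_on (ball x r \<inter> \<Omega>). \<bar>u y - g x\<bar>) / measure lebesgue (ball x r \<inter> \<Omega>))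
            \<longlongrightarrow> 0) (at_right 0)} = {}" by blast
  show ?thesis unfolding has_trace_def empty by (rule hausdorff1_empty)
qed

section \<open>Existence of a solution\<close>

lemma clip_between:
  fixes m M F v :: real
  assumes "m \<le> F" "F \<le> M"
  shows "v \<le> F \<Longrightarrow> v \<le> max m (min M v) \<and> max m (min M v) \<le> F"
    and "F \<le> v \<Longrightarrow> F \<le> max m (min M v) \<and> max m (min M v) \<le> v"
  using assms by (auto simp: max_def min_def)

text \<open>
  A value is clipped successively to intervals that all contain \<open>F\<close>. Each clip moves it towards \<open>F\<close>
  without passing \<open>F\<close>, so the values are monotone and converge. As the intervals share the point \<open>F\<close>, a later
  clip never leaves an interval that has been entered before, and the limit lies in all of them.
\<close>

lemma sequential_clipping_limit:
  fixes w :: "nat \<Rightarrow> real" and F :: real and J :: "nat set"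
  assumes F: "\<And>k. k \<in> J \<Longrightarrow> m k \<le> F \<and> F \<le> M k"
    and w: "\<And>k. w (Suc k) = (if k \<in> J then max (m k) (min (M k) (w k)) else w k)"
  shows "\<bar>w k - F\<bar> \<le> \<bar>w 0 - F\<bar>"
    and "convergent w"
    and "k \<in> J \<Longrightarrow> m k \<le> lim w \<and> lim w \<le> M k"
proof -
  have "(w 0 \<le> F \<longrightarrow> incseq w \<and> (\<forall>k. w k \<le> F)) \<and> (F \<le> w 0 \<longrightarrow> decseq w \<and> (\<forall>k. F \<le> w k))"
  proof (intro conjI impI)
    assume "w 0 \<le> F"
    then have le: "w k \<le> F" for k
    proof (induction k)
      case (Suc k)
      then show ?case using clip_between(1)[of "m k" F "M k" "w k"] F[of k] w[of k] by auto
    qed (use \<open>w 0 \<le> F\<close> in simp)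
    have "w k \<le> w (Suc k)" for k
      using clip_between(1)[of "m k" F "M k" "w k"] F[of k] w[of k] le[of k] by auto
    then show "incseq w" "\<forall>k. w k \<le> F" using le incseq_SucI by blast+
  next
    assume "F \<le> w 0"
    then have ge: "F \<le> w k" for k
    proof (induction k)
      case (Suc k)
      then show ?case using clip_between(2)[of "m k" F "M k" "w k"] F[of k] w[of k] by auto
    qed (use \<open>F \<le> w 0\<close> in simp)
    have "w (Suc k) \<le> w k" for k
      using clip_between(2)[of "m k" F "M k" "w k"] F[of k] w[of k] ge[of k] by auto
    then show "decseq w" "\<forall>k. F \<le> w k" using ge decseq_SucI by blast+
  qed
  then show "\<bar>w k - F\<bar> \<le> \<bar>w 0 - F\<bar>" and conv: "convergent w"
    using incseqD[of w 0 k] decseqD[of w 0 k] incseq_convergent[of w F] decseq_convergent[of w F]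
    unfolding convergent_def by (smt (verit) le0)+
  assume k: "k \<in> J"
  have "m k \<le> w j \<and> w j \<le> M k" if "Suc k \<le> j" for j
    using that
  proof (induction j rule: dec_induct)
    case base
    have "m k \<le> M k" using F[OF k] by linarith
    then show ?case using w[of k] k by auto
  next
    case (step j)
    show ?case
    proof (cases "j \<in> J")
      case True
      then show ?thesis using step.IH F[OF k] F[OF True] w[of j] by auto
    next
      case False
      then show ?thesis using step.IH w[of j] by simp
    qed
  qed
  then have ev: "\<forall>\<^sub>F j in sequentially. m k \<le> w j" "\<forall>\<^sub>F j in sequentially. w j \<le> M k"
    unfolding eventually_sequentially by blast+
  have "w \<longlonglongrightarrow> lim w" using conv by (simp add: convergent_LIMSEQ_iff)
  then show "m k \<le> lim w \<and> lim w \<le> M k"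
    using tendsto_lowerbound[OF _ ev(1)] tendsto_upperbound[OF _ ev(2)] by simp
qed

lemma lgp_solution_empty:
  assumes "metric_integrand \<phi>"
  shows "anisotropic_lgp_solution \<phi> {} f (\<lambda>x. 0)"
proof -
  have int: "(LINT x|lebesgue_on {}. h x) = 0" for h :: "real^2 \<Rightarrow> real"
    using Bochner_Integration.integral_cong[of "lebesgue_on {}" "lebesgue_on {}" h "\<lambda>x. 0"]
    by (simp add: space_restrict_space)
  have "total_variation \<phi> {} u = total_variation \<phi> {} v" for u v
    unfolding total_variation_def int ..
  moreover have "(\<lambda>x. 0) \<in> BV {}"
    unfolding BV_def int by (auto intro!: bdd_aboveI[of _ 0])
  ultimately have "least_gradient \<phi> {} (\<lambda>x. 0)"
    unfolding least_gradient_def by (metis order_refl)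
  then show ?thesis
    by (simp add: anisotropic_lgp_solution_def has_trace_def hausdorff1_empty)
qed

theorem theorem5p2:
  fixes \<Omega> :: "(real^2) set" and \<phi> f :: "real^2 \<Rightarrow> real"
  assumes "open \<Omega>" and "bounded \<Omega>" and "strictly_convex \<Omega>"
    and "metric_integrand \<phi>"
    and "continuous_on (frontier \<Omega>) f"
  shows "\<exists>u. anisotropic_lgp_solution \<phi> \<Omega> f u"
proof (cases "\<Omega> = {}")
  case True
  then show ?thesis using lgp_solution_empty[OF assms(4)] by blast
next
  case False
  note \<Omega> = assms(1,2) and \<phi> = assms(4)
  let ?L = "lebesgue_on \<Omega>" and ?TV = "total_variation \<phi> \<Omega>"
  have cvx: "convex \<Omega>" using assms(3) by (simp add: strictly_convex_def)
  have \<Omega>m: "\<Omega> \<in> lmeasurable" using \<Omega> by (intro lmeasurable_open)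
  interpret finite_measure ?L by (rule finite_measure_lebesgue_on[OF \<Omega>m])
  obtain F where F: "continuous_on UNIV F" "\<And>x. x \<in> frontier \<Omega> \<Longrightarrow> F x = f x" "?TV F < \<infinity>"
    using boundary_extension[OF \<Omega> cvx False \<phi> assms(5)] by blast
  obtain n :: "nat \<Rightarrow> real^2" and c :: "nat \<Rightarrow> real" where
    all: "\<exists>j. \<forall>x\<in>\<Omega>. n j \<bullet> x > c j" and
    small: "\<And>x r. x \<in> frontier \<Omega> \<Longrightarrow> r > 0 \<Longrightarrow> \<exists>j. n j \<bullet> x > c j \<and> (\<forall>y\<in>\<Omega>. n j \<bullet> y > c j \<longrightarrow> dist x y < r)"
    by (rule countable_cap_family[OF \<Omega> assms(3)]) (rule that; assumption)
  have "bounded (F ` closure \<Omega>)"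
    using \<Omega>(2) by (intro compact_imp_bounded compact_continuous_image continuous_on_subset[OF F(1)]) (auto simp: compact_closure)
  then obtain B where B: "\<And>x. x \<in> \<Omega> \<Longrightarrow> \<bar>F x\<bar> \<le> B"
    using closure_subset[of \<Omega>] unfolding bounded_pos by fastforce
  define H where "H j = {x \<in> \<Omega>. n j \<bullet> x > c j}" for j
  \<comment> \<open>The bounds on a cap come from \<open>F\<close> and not from \<open>f\<close> on the arc: then \<open>F\<close> itself satisfies all
    constraints, and those of two intersecting caps are compatible.\<close>
  define m where "m j = (INF x\<in>H j. F x)" for j
  define M where "M j = (SUP x\<in>H j. F x)" for j
  have bdd: "bdd_below (F ` H j)" "bdd_above (F ` H j)" for j
    using B by (auto simp: H_def abs_le_iff intro!: bdd_belowI2[of _ "-B"] bdd_aboveI2[of _ _ B]) (smt (verit))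
  have mM: "m j \<le> F x \<and> F x \<le> M j" if "x \<in> \<Omega>" "n j \<bullet> x > c j" for j x
    unfolding m_def M_def using that by (intro conjI cINF_lower cSUP_upper bdd) (auto simp: H_def)
  define X where "X = {u \<in> borel_measurable ?L. \<forall>j. AE x in ?L. n j \<bullet> x > c j \<longrightarrow> m j \<le> u x \<and> u x \<le> M j}"
  have Fm: "F \<in> borel_measurable ?L"
    using borel_measurable_continuous_onI[OF F(1)] by (intro measurable_restrict_space1 measurable_completion) simp
  have FX: "F \<in> X"
    unfolding X_def using Fm mM by (auto simp: space_restrict_space intro!: AE_I2)
  obtain j0 where j0: "\<And>x. x \<in> \<Omega> \<Longrightarrow> n j0 \<bullet> x > c j0" using all by blast
  define b where "b = max \<bar>m j0\<bar> \<bar>M j0\<bar>"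
  have Xb: "AE x in ?L. \<bar>u x\<bar> \<le> b" if "u \<in> X" for u
  proof -
    have "AE x in ?L. n j0 \<bullet> x > c j0 \<longrightarrow> m j0 \<le> u x \<and> u x \<le> M j0" using that by (simp add: X_def)
    moreover have "AE x in ?L. n j0 \<bullet> x > c j0" using j0 by (intro AE_I2) (simp add: space_restrict_space)
    ultimately show ?thesis by eventually_elim (auto simp: b_def)
  qed
  have Xmid: "(\<lambda>x. (u x + v x) / 2) \<in> X" if "u \<in> X" "v \<in> X" for u v
  proof -
    have "AE x in ?L. n j \<bullet> x > c j \<longrightarrow> m j \<le> (u x + v x) / 2 \<and> (u x + v x) / 2 \<le> M j" for j
    proof -
      have "AE x in ?L. n j \<bullet> x > c j \<longrightarrow> m j \<le> u x \<and> u x \<le> M j" "AE x in ?L. n j \<bullet> x > c j \<longrightarrow> m j \<le> v x \<and> v x \<le> M j"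
        using that by (simp_all add: X_def)
      then show ?thesis by eventually_elim auto
    qed
    moreover have "(\<lambda>x. (u x + v x) / 2) \<in> borel_measurable ?L"
    proof -
      have [measurable]: "u \<in> borel_measurable ?L" "v \<in> borel_measurable ?L" using that by (simp_all add: X_def)
      show ?thesis by measurable
    qed
    ultimately show ?thesis by (simp add: X_def)
  qed
  have Xlim: "v \<in> X" if "\<And>k. u k \<in> X" "v \<in> borel_measurable ?L" "AE x in ?L. (\<lambda>k. u k x) \<longlonglongrightarrow> v x" for u v
  proof -
    have "AE x in ?L. n j \<bullet> x > c j \<longrightarrow> m j \<le> v x \<and> v x \<le> M j" for j
    proof -
      have "AE x in ?L. \<forall>k. n j \<bullet> x > c j \<longrightarrow> m j \<le> u k x \<and> u k x \<le> M j"
        unfolding AE_all_countable using that(1) by (simp add: X_def)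
      with that(3) show ?thesis
        by eventually_elim (auto intro: LIMSEQ_le_const LIMSEQ_le_const2)
    qed
    then show ?thesis using that(2) by (simp add: X_def)
  qed
  have Xmeas: "u \<in> borel_measurable ?L" if "u \<in> X" for u using that by (simp add: X_def)
  obtain u where u: "u \<in> X" "?TV u < \<infinity>" and min: "\<And>v. v \<in> X \<Longrightarrow> ?TV u \<le> ?TV v"
    by (rule minimizer_exists[OF \<Omega> \<phi> Xmeas Xb Xmid Xlim FX F(3)]; (assumption | (rule that; assumption)))
  have um: "u \<in> borel_measurable ?L" by (rule Xmeas[OF u(1)])
  have ui: "integrable ?L u" using Xb[OF u(1)] um by (intro integrable_const_bound[of _ b]) auto
  have uj: "AE x in ?L. n j \<bullet> x > c j \<longrightarrow> m j \<le> u x \<and> u x \<le> M j" for j using u(1) by (simp add: X_def)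
  have "has_trace \<Omega> u f"
  proof (rule has_trace_if_limit[OF \<Omega> um])
    \<comment> \<open>On a cap around \<open>x\<close> so small that \<open>F\<close> is close to \<open>f x\<close>, the constraint forces \<open>u\<close> to be close to \<open>f x\<close>.\<close>
    fix x and \<tau> :: real assume x: "x \<in> frontier \<Omega>" and "\<tau> > 0"
    obtain r where r: "r > 0" "\<And>y. dist y x < r \<Longrightarrow> dist (F y) (F x) < \<tau>"
      using F(1) \<open>\<tau> > 0\<close> unfolding continuous_on_iff by (metis UNIV_I)
    obtain j where j: "n j \<bullet> x > c j" "\<And>y. y \<in> \<Omega> \<Longrightarrow> n j \<bullet> y > c j \<Longrightarrow> dist x y < r"
      using small[OF x r(1)] by blast
    have "open {y. n j \<bullet> y > c j}" by (rule open_halfspace_gt)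
    from openE[OF this, of x] obtain \<rho> where \<rho>: "\<rho> > 0" "ball x \<rho> \<subseteq> {y. n j \<bullet> y > c j}"
      using j(1) by blast
    have cap: "f x - \<tau> \<le> F y" "F y \<le> f x + \<tau>" if "y \<in> H j" for y
      using r(2)[of y] j(2)[of y] that F(2)[OF x] by (auto simp: H_def dist_real_def dist_commute abs_le_iff)
    have mMj: "f x - \<tau> \<le> m j" "M j \<le> f x + \<tau>" if "y \<in> H j" for y
      unfolding m_def M_def using cap that by (auto intro!: cINF_greatest cSUP_least)
    have "AE y in ?L. y \<in> \<Omega>" by (intro AE_I2) (simp add: space_restrict_space)
    with uj[of j] have "AE y in ?L. y \<in> ball x \<rho> \<longrightarrow> \<bar>u y - f x\<bar> \<le> \<tau>"
    proof eventually_elim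
      case (elim y)
      show ?case
      proof
        assume "y \<in> ball x \<rho>"
        then have y: "n j \<bullet> y > c j" using \<rho>(2) by blast
        then have "y \<in> H j" using elim(2) by (simp add: H_def)
        from mMj[OF this] elim(1) y show "\<bar>u y - f x\<bar> \<le> \<tau>" by (simp add: abs_le_iff)
      qed
    qed
    then show "\<exists>\<rho>>0. AE y in ?L. y \<in> ball x \<rho> \<longrightarrow> \<bar>u y - f x\<bar> \<le> \<tau>" using \<rho>(1) by blast
  qed
  moreover have "least_gradient \<phi> \<Omega> u"
    unfolding least_gradient_def
  proof (intro conjI ballI impI)
    show "u \<in> BV \<Omega>" by (rule BV_if_finite_total_variation[OF \<Omega>(1) \<phi> ui u(2)])
    fix v assume v: "v \<in> BV \<Omega>" and "\<exists>K. compact K \<and> K \<subseteq> \<Omega> \<and> (AE x in ?L. x \<notin> K \<longrightarrow> v x = 0)"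
    then obtain K where K: "compact K" "K \<subseteq> \<Omega>" and v0: "AE x in ?L. x \<notin> K \<longrightarrow> v x = 0" by blast
    have vi: "integrable ?L v" using v by (simp add: BV_def)
    \<comment> \<open>The competitor \<open>u + v\<close> is clipped cap by cap to a function of \<open>X\<close>. Off \<open>K\<close> it coincides with \<open>u\<close>,
      which satisfies the constraints, so only values on \<open>K\<close> change and no clip increases the variation.\<close>
    define W where "W = rec_nat (\<lambda>x. u x + v x) (\<lambda>k w x. if n k \<bullet> x > c k then max (m k) (min (M k) (w x)) else w x)"
    have W0: "W 0 = (\<lambda>x. u x + v x)" by (simp add: W_def)
    have WS: "W (Suc k) = (\<lambda>x. if n k \<bullet> x > c k then max (m k) (min (M k) (W k x)) else W k x)" for k
      unfolding W_def by simp
    have hs: "{x \<in> space ?L. n k \<bullet> x > c k} \<in> sets ?L" for k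
    proof -
      have "(\<lambda>x. n k \<bullet> x) \<in> borel_measurable ?L"
        by (intro measurable_restrict_space1 measurable_completion) simp
      then show ?thesis by measurable
    qed
    have W: "integrable ?L (W k) \<and> ?TV (W k) \<le> ?TV (\<lambda>x. u x + v x) \<and> (AE x in ?L. x \<notin> K \<longrightarrow> W k x = u x)" for k
    proof (induction k)
      case 0
      then show ?case using ui vi v0 by (auto simp: W0 elim!: eventually_mono)
    next
      case (Suc k)
      then have Wi: "integrable ?L (W k)" and WT: "?TV (W k) \<le> ?TV (\<lambda>x. u x + v x)"
        and WK: "AE x in ?L. x \<notin> K \<longrightarrow> W k x = u x" by auto
      let ?W' = "\<lambda>x. if n k \<bullet> x > c k then min (M k) (W k x) else W k x"
      have Wm: "W k \<in> borel_measurable ?L" using Wi by simp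
      have bi: "integrable ?L h" if "h \<in> borel_measurable ?L" "\<And>x. \<bar>h x\<bar> \<le> \<bar>W k x\<bar> + (\<bar>M k\<bar> + \<bar>m k\<bar>)" for h
        by (rule Bochner_Integration.integrable_bound[of _ "\<lambda>x. \<bar>W k x\<bar> + (\<bar>M k\<bar> + \<bar>m k\<bar>)"])
           (use Wi that in auto)
      have W'i: "integrable ?L ?W'"
      proof (rule bi)
        show "?W' \<in> borel_measurable ?L" by (rule measurable_If) (use Wm hs in auto)
        show "\<bar>?W' x\<bar> \<le> \<bar>W k x\<bar> + (\<bar>M k\<bar> + \<bar>m k\<bar>)" for x by auto
      qed
      have mMk: "AE x in ?L. n k \<bullet> x > c k \<longrightarrow> m k \<le> M k"
        using mM[of _ k] by (intro AE_I2) (force simp: space_restrict_space)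
      have 1: "?TV ?W' \<le> ?TV (W k)"
        by (rule cap_truncation[OF \<Omega>(1) \<phi> Wi K]) (use WK uj[of k] in \<open>eventually_elim, auto\<close>)
      have "AE x in ?L. x \<notin> K \<longrightarrow> n k \<bullet> x > c k \<longrightarrow> m k \<le> ?W' x"
        using WK uj[of k] mMk by eventually_elim auto
      then have 2: "?TV (\<lambda>x. if n k \<bullet> x > c k then max (m k) (?W' x) else ?W' x) \<le> ?TV ?W'"
        by (rule cap_truncation_ge[OF \<Omega>(1) \<phi> W'i K])
      have eq: "(\<lambda>x. if n k \<bullet> x > c k then max (m k) (?W' x) else ?W' x) = W (Suc k)"
        unfolding WS by auto
      have "integrable ?L (W (Suc k))"
      proof (rule bi)
        show "W (Suc k) \<in> borel_measurable ?L" unfolding WS by (rule measurable_If) (use Wm hs in auto)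
        show "\<bar>W (Suc k) x\<bar> \<le> \<bar>W k x\<bar> + (\<bar>M k\<bar> + \<bar>m k\<bar>)" for x unfolding WS by auto
      qed
      moreover have "?TV (W (Suc k)) \<le> ?TV (\<lambda>x. u x + v x)"
        using 1 2 WT unfolding eq by (meson order_trans)
      moreover have "AE x in ?L. x \<notin> K \<longrightarrow> W (Suc k) x = u x"
        using WK uj[of k] unfolding WS by eventually_elim auto
      ultimately show ?case by blast
    qed
    define w where "w x = lim (\<lambda>k. W k x)" for x
    have Wm: "W k \<in> borel_measurable ?L" for k using W[of k] by auto
    have wm: "w \<in> borel_measurable ?L" unfolding w_def by (intro borel_measurable_lim_metric Wm)
    have clip: "\<bar>W k x - F x\<bar> \<le> \<bar>W 0 x - F x\<bar>" "convergent (\<lambda>k. W k x)"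
      "n k \<bullet> x > c k \<longrightarrow> m k \<le> w x \<and> w x \<le> M k" if x: "x \<in> \<Omega>" for x k
    proof -
      let ?J = "{k. n k \<bullet> x > c k}"
      have 1: "m k \<le> F x \<and> F x \<le> M k" if "k \<in> ?J" for k using mM[OF x] that by simp
      have 2: "W (Suc k) x = (if k \<in> ?J then max (m k) (min (M k) (W k x)) else W k x)" for k
        by (simp add: WS)
      note L = sequential_clipping_limit[where J="?J" and m=m and F="F x" and M=M and w="\<lambda>k. W k x", OF 1 2]
      show "\<bar>W k x - F x\<bar> \<le> \<bar>W 0 x - F x\<bar>" by (rule L(1))
      show "convergent (\<lambda>k. W k x)" by (rule L(2))
      show "n k \<bullet> x > c k \<longrightarrow> m k \<le> w x \<and> w x \<le> M k" using L(3)[of k] by (simp add: w_def)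
    qed
    have "w \<in> X"
      unfolding X_def using wm clip(3) by (auto intro!: AE_I2 simp: space_restrict_space)
    then have "?TV u \<le> ?TV w" by (rule min)
    also have "\<dots> \<le> ?TV (\<lambda>x. u x + v x)"
    proof (rule total_variation_lower_semicontinuous[OF \<Omega>(1) \<phi> Wm wm, where g="\<lambda>x. \<bar>u x + v x\<bar> + 2 * B" and c="\<lambda>_. ?TV (\<lambda>x. u x + v x)"])
      show "AE x in ?L. (\<lambda>k. W k x) \<longlonglongrightarrow> w x"
        unfolding w_def using clip(2) by (intro AE_I2) (simp add: space_restrict_space convergent_LIMSEQ_iff)
      show "AE x in ?L. \<bar>W k x\<bar> \<le> \<bar>u x + v x\<bar> + 2 * B" for k
      proof (rule AE_I2)
        fix x assume "x \<in> space ?L"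
        then have "x \<in> \<Omega>" by (simp add: space_restrict_space)
        from clip(1)[OF this, of k] B[OF this] show "\<bar>W k x\<bar> \<le> \<bar>u x + v x\<bar> + 2 * B"
          unfolding W0 by linarith
      qed
    qed (use ui vi W in auto)
    finally show "?TV u \<le> ?TV (\<lambda>x. u x + v x)" .
  qed
  ultimately show ?thesis unfolding anisotropic_lgp_solution_def by blast
qed

end
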